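(* Let $\Lambda_c$ be the conifold algebra and $R_c$ its center. Intersecting two-sided prime ideals with the center determines a continuous map $$\psi:\mathrm{spec}\,\Lambda_c\longrightarrow\mathrm{spec}\,R_c$$ which is a one-to-one correspondence away from the unique singularity of $\mathrm{spec}\,R_c$, where the fiber consists of two points.
   Context: The conifold algebra is $$\Lambda_c=\frac{\mathbb{C}\langle X,Y,Z\rangle}{(Z^2-1,\ XZ+ZX,\ YZ+ZY,\ [X^2,Y],\ [Y^2,X])},\qquad [A,B]=AB-BA.$$ Its center $R_c$ is generated by $x=X^2$, $y=Y^2$, $z=\frac12(XY+YX)$ and $D=XYZ-YXZ$, and $R_c\simeq\mathbb{C}[x,y,z,D]/(D^2-4(z^2-xy))$, which is isomorphic to the coordinate ring $\mathbb{C}[a,b,c,d]/(ab-cd)$ of the conifold singularity. For a (non-commutative) algebra $\Lambda$, $\mathrm{spec}\,\Lambda$ is the set of two-sided prime ideals $P$ ($a\Lambda b\subset P\Rightarrow a\in P$ or $b\in P$) with the Zariski topology whose open sets are $\mathbb{X}(I)=\{P: I\not\subset P\}$ for two-sided ideals $I$. *)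

theory Defs
  imports
    "HOL-Algebra.Algebraic_Closure_Type"
    "HOL-Algebra.QuotRing"
    "HOL-Algebra.Ring_Divisibility"
    "HOL-Library.Poly_Mapping"
    "HOL-Library.Extended_Nat"
    "HOL-Analysis.Abstract_Topology"
begin

section \<open>The conifold algebra and its center\<close>

datatype 'g word = Word (letters: "'g list")

instantiation word :: (type) monoid_add
begin

definition zero_word :: "'a word" where
  "0 = Word []"

definition plus_word :: "'a word \<Rightarrow> 'a word \<Rightarrow> 'a word" where
  "u + v = Word (letters u @ letters v)"

instance
  by standard (simp_all add: zero_word_def plus_word_def)

end

text \<open>
  The monoid algebra over \<open>\<complex>\<close> of the free monoid of words is the free algebra; its product is the
  convolution product that the library provides on \<^typ>\<open>'g word \<Rightarrow>\<^sub>0 complex\<close>.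
\<close>

type_synonym 'g free_algebra = "'g word \<Rightarrow>\<^sub>0 complex"

definition gen :: "'g \<Rightarrow> 'g free_algebra" where
  "gen g = Poly_Mapping.single (Word [g]) 1"

datatype conifold_gen = GX | GY | GZ

abbreviation "gX \<equiv> gen GX"
abbreviation "gY \<equiv> gen GY"
abbreviation "gZ \<equiv> gen GZ"

definition conifold_relations :: "conifold_gen free_algebra set" where
  "conifold_relations =
    {gZ\<^sup>2 - 1, gX * gZ + gZ * gX, gY * gZ + gZ * gY, gX\<^sup>2 * gY - gY * gX\<^sup>2,
     gY\<^sup>2 * gX - gX * gY\<^sup>2}"

text \<open>
  The algebra is unital, so its ring ideals are the same as its algebra ideals, and only its
  ring structure is recorded.
\<close>

definition conifold_algebra :: "conifold_gen free_algebra set ring" where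
  "conifold_algebra =
    ring_of_type_algebra Quot (genideal ring_of_type_algebra conifold_relations)"

definition ring_center :: "('a, 'm) ring_scheme \<Rightarrow> ('a, 'm) ring_scheme" where
  "ring_center R =
    R\<lparr>carrier := {c \<in> carrier R. \<forall>a\<in>carrier R. c \<otimes>\<^bsub>R\<^esub> a = a \<otimes>\<^bsub>R\<^esub> c}\<rparr>"


section \<open>The prime spectrum of a not necessarily commutative ring\<close>

text \<open>\<^const>\<open>ideal\<close> means two-sided ideal. As usual, prime ideals are proper.\<close>

definition two_sided_prime :: "'a set \<Rightarrow> ('a, 'm) ring_scheme \<Rightarrow> bool" where
  "two_sided_prime P R \<longleftrightarrow>
    ideal P R \<and> P \<noteq> carrier R \<and>
    (\<forall>a\<in>carrier R. \<forall>b\<in>carrier R.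
      (\<forall>r\<in>carrier R. a \<otimes>\<^bsub>R\<^esub> r \<otimes>\<^bsub>R\<^esub> b \<in> P) \<longrightarrow> a \<in> P \<or> b \<in> P)"

definition prime_spec :: "('a, 'm) ring_scheme \<Rightarrow> 'a set set" where
  "prime_spec R = {P. two_sided_prime P R}"

definition zariski_open :: "('a, 'm) ring_scheme \<Rightarrow> 'a set \<Rightarrow> 'a set set" where
  "zariski_open R I = {P \<in> prime_spec R. \<not> I \<subseteq> P}"

definition zariski :: "('a, 'm) ring_scheme \<Rightarrow> 'a set topology" where
  "zariski R = topology (\<lambda>U. \<exists>I. ideal I R \<and> U = zariski_open R I)"

lemma two_sided_prime_Int_subset:
  assumes "two_sided_prime P R" "ideal I R" "ideal J R" "I \<inter> J \<subseteq> P"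
  shows "I \<subseteq> P \<or> J \<subseteq> P"
proof (rule ccontr)
  assume "\<not> ?thesis"
  then obtain a b where ab: "a \<in> I" "a \<notin> P" "b \<in> J" "b \<notin> P" by blast
  have a: "a \<in> carrier R" and b: "b \<in> carrier R"
    using ab assms(2,3) by (meson additive_subgroup.a_Hcarr ideal.axioms(1))+
  have "ring R" using assms(2) by (rule ideal.axioms(2))
  have "a \<otimes>\<^bsub>R\<^esub> r \<otimes>\<^bsub>R\<^esub> b \<in> P" if "r \<in> carrier R" for r
  proof -
    have "a \<otimes>\<^bsub>R\<^esub> r \<in> I" "a \<otimes>\<^bsub>R\<^esub> r \<in> carrier R"
      using ideal.I_r_closed[OF assms(2) ab(1) that] a that \<open>ring R\<close>
      by (auto intro: monoid.m_closed ring.is_monoid)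
    then show ?thesis
      using ideal.I_r_closed[OF assms(2) _ b] ideal.I_l_closed[OF assms(3) ab(3)] assms(4) by blast
  qed
  then show False
    using assms(1) a b ab unfolding two_sided_prime_def by blast
qed

lemma istopology_zariski:
  assumes "ring R"
  shows "istopology (\<lambda>U. \<exists>I. ideal I R \<and> U = zariski_open R I)"
  unfolding istopology_def
proof (intro conjI allI impI)
  fix S T
  assume "\<exists>I. ideal I R \<and> S = zariski_open R I" "\<exists>I. ideal I R \<and> T = zariski_open R I"
  then obtain I J where IJ: "ideal I R" "ideal J R" "S = zariski_open R I" "T = zariski_open R J"
    by blast
  then have "S \<inter> T = zariski_open R (I \<inter> J)"
    using two_sided_prime_Int_subset[of _ R I J]
    unfolding zariski_open_def prime_spec_def by blast
  then show "\<exists>I. ideal I R \<and> S \<inter> T = zariski_open R I"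
    using ring.i_intersect[OF assms IJ(1,2)] by blast
next
  fix K
  assume "\<forall>U\<in>K. \<exists>I. ideal I R \<and> U = zariski_open R I"
  then obtain f where f: "\<And>U. U \<in> K \<Longrightarrow> ideal (f U) R \<and> U = zariski_open R (f U)"
    by metis
  let ?A = "\<Union>U\<in>K. f U"
  have sub: "?A \<subseteq> carrier R"
    using f by (meson UN_least additive_subgroup.a_subset ideal.axioms(1))
  have "genideal R ?A \<subseteq> P \<longleftrightarrow> ?A \<subseteq> P" if "ideal P R" for P
    using ring.Idl_subset_ideal[OF assms that sub] .
  then have "genideal R ?A \<subseteq> P \<longleftrightarrow> (\<forall>U\<in>K. f U \<subseteq> P)" if "P \<in> prime_spec R" for P
    using that unfolding prime_spec_def two_sided_prime_def by (simp add: UN_subset_iff)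
  then have "zariski_open R (genideal R ?A) = (\<Union>U\<in>K. zariski_open R (f U))"
    unfolding zariski_open_def by auto
  also have "\<dots> = \<Union>K" using f by auto
  finally show "\<exists>I. ideal I R \<and> \<Union>K = zariski_open R I"
    using ring.genideal_ideal[OF assms sub] by metis
qed

lemma openin_zariski:
  assumes "ring R"
  shows "openin (zariski R) U \<longleftrightarrow> (\<exists>I. ideal I R \<and> U = zariski_open R I)"
  unfolding zariski_def by (simp add: topology_inverse' [OF istopology_zariski[OF assms]])

lemma topspace_zariski:
  assumes "ring R"
  shows "topspace (zariski R) = prime_spec R"
proof -
  have "zariski_open R (carrier R) = prime_spec R"
    unfolding zariski_open_def prime_spec_def two_sided_prime_def
    using additive_subgroup.a_subset ideal.axioms(1) by blast
  then have "openin (zariski R) (prime_spec R)"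
    unfolding openin_zariski[OF assms] using ring.oneideal[OF assms] by metis
  moreover have "topspace (zariski R) \<subseteq> prime_spec R"
    using openin_topspace[of "zariski R"]
    unfolding openin_zariski[OF assms] zariski_open_def by blast
  ultimately show ?thesis
    using openin_subset by blast
qed


section \<open>Singular points of the spectrum of a commutative ring\<close>

text \<open>
  In the localization of \<open>R\<close> at a prime \<open>P\<close>, the fractions \<open>r/s\<close> and \<open>r'/s'\<close> agree iff
  \<open>u (r s' - r' s) = 0\<close> for some \<open>u\<close> outside \<open>P\<close>. A fraction is the class of its representing pairs.
\<close>

definition fraction_rel :: "('a, 'm) ring_scheme \<Rightarrow> 'a set \<Rightarrow> (('a \<times> 'a) \<times> ('a \<times> 'a)) set" where
  "fraction_rel R P =
    {((r, s), (r', s')). r \<in> carrier R \<and> s \<in> carrier R - P \<and> r' \<in> carrier R \<and> s' \<in> carrier R - P \<and>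
      (\<exists>u\<in>carrier R - P. u \<otimes>\<^bsub>R\<^esub> (r \<otimes>\<^bsub>R\<^esub> s' \<ominus>\<^bsub>R\<^esub> r' \<otimes>\<^bsub>R\<^esub> s) = \<zero>\<^bsub>R\<^esub>)}"

definition fraction :: "('a, 'm) ring_scheme \<Rightarrow> 'a set \<Rightarrow> 'a \<Rightarrow> 'a \<Rightarrow> ('a \<times> 'a) set" where
  "fraction R P r s = fraction_rel R P `` {(r, s)}"

definition localization :: "('a, 'm) ring_scheme \<Rightarrow> 'a set \<Rightarrow> ('a \<times> 'a) set ring" where
  "localization R P =
    \<lparr>carrier = (carrier R \<times> (carrier R - P)) // fraction_rel R P,
     monoid.mult = (\<lambda>A B. \<Union>(r, s)\<in>A. \<Union>(r', s')\<in>B.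
       fraction R P (r \<otimes>\<^bsub>R\<^esub> r') (s \<otimes>\<^bsub>R\<^esub> s')),
     one = fraction R P \<one>\<^bsub>R\<^esub> \<one>\<^bsub>R\<^esub>,
     zero = fraction R P \<zero>\<^bsub>R\<^esub> \<one>\<^bsub>R\<^esub>,
     add = (\<lambda>A B. \<Union>(r, s)\<in>A. \<Union>(r', s')\<in>B.
       fraction R P (r \<otimes>\<^bsub>R\<^esub> s' \<oplus>\<^bsub>R\<^esub> r' \<otimes>\<^bsub>R\<^esub> s) (s \<otimes>\<^bsub>R\<^esub> s'))\<rparr>"

definition krull_dim :: "('a, 'm) ring_scheme \<Rightarrow> enat" where
  "krull_dim R =
    Sup {enat n | n. \<exists>C :: nat \<Rightarrow> 'a set.
      (\<forall>i\<le>n. primeideal (C i) R) \<and> (\<forall>i<n. C i \<subset> C (Suc i))}"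

text \<open>
  A Noetherian local ring is regular if its maximal ideal can be generated by \<open>d\<close> elements,
  where \<open>d\<close> is the Krull dimension. A family of \<open>d\<close> generators may contain repetitions, so as a
  set it has at most \<open>d\<close> elements.
\<close>

definition regular_local_ring :: "('a, 'm) ring_scheme \<Rightarrow> bool" where
  "regular_local_ring R \<longleftrightarrow>
    cring R \<and> noetherian_ring R \<and>
    (\<exists>M. {I. maximalideal I R} = {M} \<and>
      (\<exists>S\<subseteq>carrier R. finite S \<and> enat (card S) \<le> krull_dim R \<and> genideal R S = M))"

definition singular_points :: "('a, 'm) ring_scheme \<Rightarrow> 'a set set" where
  "singular_points R = {P \<in> prime_spec R. \<not> regular_local_ring (localization R P)}"


section \<open>Intersecting with the center\<close>

definition center_contraction :: "('a, 'm) ring_scheme \<Rightarrow> 'a set \<Rightarrow> 'a set" where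
  "center_contraction R P = P \<inter> carrier (ring_center R)"

end

theory Submission
  imports
    Defs
    "HOL-Algebra.Subrings"
    "HOL-Analysis.Cartesian_Space"
    "HOL-Computational_Algebra.Polynomial"
    "HOL-Library.Product_Plus"
begin

text \<open>
  Let \<open>S = \<complex>[p, r, q, s]\<close> be graded with \<open>p, r\<close> in degree \<open>1\<close> and \<open>q, s\<close> in degree \<open>-1\<close>. Sending
  \<open>X\<close>, \<open>Y\<close>, \<open>Z\<close> to the matrices with rows \<open>(0, p), (q, 0)\<close>, respectively \<open>(0, r), (s, 0)\<close> and
  \<open>(1, 0), (0, -1)\<close>, identifies the conifold algebra with the matrices whose entries have degrees
  \<open>(0, 1), (-1, 0)\<close>: modulo the relations a word in \<open>X\<close> and \<open>Y\<close> depends only on the letters in odd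
  positions and on the letters in even positions, up to order. The center becomes the ring \<open>S\<^sub>0\<close>
  generated by the four products \<open>f\<close> of one of \<open>p, r\<close> with one of \<open>q, s\<close>; they generate the ideal of
  the vertex.

  For each such \<open>f\<close>, the element \<open>f tr(\<lambda>)\<close> is a sum of products \<open>u \<lambda> v\<close>, and \<open>f \<lambda>\<close> is a
  combination of traces \<open>tr(w \<lambda>)\<close>. Hence over a prime \<open>q\<close> that does not contain \<open>f\<close> the only prime is
  the set of all \<open>\<lambda>\<close> with \<open>tr(\<mu> \<lambda>) \<in> q\<close> for all \<open>\<mu>\<close>. A prime over the vertex contains the square
  of the ideal of all matrices with diagonal entries in the ideal of the vertex, hence this ideal itself,
  and then one of the two diagonal idempotents.

  After inverting \<open>f\<close>, the center becomes a localization of a polynomial ring in three variables, so it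
  is regular away from the vertex. At the vertex it is not: four elements of \<open>S\<^sub>0\<close> are algebraically
  dependent, which bounds the dimension by \<open>3\<close>, but the linear parts of the four generators are
  independent.
\<close>

section \<open>Localization at a prime ideal\<close>

text \<open>Regularity concerns the localization, whose Krull dimension is awkward to compute, but
  two inequalities suffice. A chain of n + 1 primes ending in q, with at most n elements that
  generate q up to factors outside q, proves regularity. An upper bound on the dimension of the
  whole ring, with a larger lower bound on the number of such generators, refutes it. Neither
  criterion mentions fractions, so the commutative algebra takes place in \<open>S\<^sub>0\<close>
  and in polynomial rings, as types.

  The dimension bound 3 is a count: \<open>S\<^sub>0\<close> has at most (h + 1)^3 monomials with at
  most h forward letters, while four elements have N^4 products of powers with exponents below N,
  and h only has to grow linearly in N.

  Two points lie over the vertex because the off-diagonal matrix units do not have the right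
  degrees. They can only be replaced by \<open>fwd_mat\<close> and \<open>bwd_mat\<close>, whose
  products carry a factor f. Where some f is invertible, the algebra behaves like a full matrix
  algebra; at the vertex every f vanishes and the two diagonal entries decouple.\<close>

context primeideal
begin

abbreviation (input) "denoms \<equiv> carrier R - I"

abbreviation "fr \<equiv> fraction R I"
abbreviation "Loc \<equiv> localization R I"

lemma denoms_mult: "s \<in> denoms \<Longrightarrow> t \<in> denoms \<Longrightarrow> s \<otimes> t \<in> denoms"
  using I_prime by blast

lemma denoms_one: "\<one> \<in> denoms"
  using I_notcarr one_imp_carrier by blast

lemma fraction_rel_iff:
  "((r, s), (r', s')) \<in> fraction_rel R I \<longleftrightarrow>
    r \<in> carrier R \<and> s \<in> denoms \<and> r' \<in> carrier R \<and> s' \<in> denoms \<and>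
    (\<exists>u\<in>denoms. u \<otimes> (r \<otimes> s') = u \<otimes> (r' \<otimes> s))"
proof -
  have "u \<otimes> (a \<ominus> b) = \<zero> \<longleftrightarrow> u \<otimes> a = u \<otimes> b"
    if "u \<in> carrier R" "a \<in> carrier R" "b \<in> carrier R" for u a b
    using that by (metis a_minus_def m_closed r_distr r_minus r_right_minus_eq a_inv_closed)
  then show ?thesis
    unfolding fraction_rel_def by fastforce
qed

lemma equiv_fraction_rel: "equiv (carrier R \<times> denoms) (fraction_rel R I)"
proof (rule equivI)
  show "fraction_rel R I \<subseteq> (carrier R \<times> denoms) \<times> (carrier R \<times> denoms)"
    by (auto simp: fraction_rel_def)
  show "refl_on (carrier R \<times> denoms) (fraction_rel R I)"
    using denoms_one by (auto intro!: refl_onI simp: fraction_rel_iff)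
  show "sym (fraction_rel R I)"
    by (rule symI) (auto simp: fraction_rel_iff eq_commute)
  show "trans (fraction_rel R I)"
  proof (rule transI, clarify)
    fix r s r' s' r'' s''
    assume 1: "((r, s), (r', s')) \<in> fraction_rel R I" and 2: "((r', s'), (r'', s'')) \<in> fraction_rel R I"
    then have c: "r \<in> carrier R" "s \<in> carrier R" "r' \<in> carrier R" "s' \<in> carrier R"
       "r'' \<in> carrier R" "s'' \<in> carrier R"
      by (auto simp: fraction_rel_iff)
    obtain u where u: "u \<in> denoms" "u \<otimes> (r \<otimes> s') = u \<otimes> (r' \<otimes> s)"
      using 1 by (auto simp: fraction_rel_iff)
    obtain v where v: "v \<in> denoms" "v \<otimes> (r' \<otimes> s'') = v \<otimes> (r'' \<otimes> s')"
      using 2 by (auto simp: fraction_rel_iff)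
    have uv: "u \<in> carrier R" "v \<in> carrier R" using u v by auto
    \<comment> \<open>Zero divisors are allowed, so the middle denominator \<open>s'\<close> cannot
      be cancelled; it joins \<open>u\<close> and \<open>v\<close> in the witness.\<close>
    have "(u \<otimes> v \<otimes> s') \<otimes> (r \<otimes> s'') = (v \<otimes> s'') \<otimes> (u \<otimes> (r \<otimes> s'))"
      using c uv by (simp add: m_ac)
    also have "\<dots> = (u \<otimes> s) \<otimes> (v \<otimes> (r' \<otimes> s''))"
      unfolding u(2) using c uv by (simp add: m_ac)
    also have "\<dots> = (u \<otimes> v \<otimes> s') \<otimes> (r'' \<otimes> s)"
      unfolding v(2) using c uv by (simp add: m_ac)
    finally have "(u \<otimes> v \<otimes> s') \<otimes> (r \<otimes> s'') = (u \<otimes> v \<otimes> s') \<otimes> (r'' \<otimes> s)" .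
    moreover have "u \<otimes> v \<otimes> s' \<in> denoms"
      using u(1) v(1) 1 by (intro denoms_mult) (auto simp: fraction_rel_iff)
    ultimately show "((r, s), (r'', s'')) \<in> fraction_rel R I"
      using 1 2 unfolding fraction_rel_iff by blast
  qed
qed

lemma frac_eq_iff:
  assumes "r \<in> carrier R" "s \<in> denoms" "r' \<in> carrier R" "s' \<in> denoms"
  shows "fr r s = fr r' s' \<longleftrightarrow> (\<exists>u\<in>denoms. u \<otimes> (r \<otimes> s') = u \<otimes> (r' \<otimes> s))"
  unfolding fraction_def
  using eq_equiv_class_iff[OF equiv_fraction_rel, of "(r, s)" "(r', s')"] assms
  by (auto simp: fraction_rel_iff)

lemma frac_eqI:
  assumes "r \<in> carrier R" "s \<in> denoms" "r' \<in> carrier R" "s' \<in> denoms" "r \<otimes> s' = r' \<otimes> s"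
  shows "fr r s = fr r' s'"
  using assms denoms_one by (subst frac_eq_iff) auto

lemma frac_cancel:
  assumes "r \<in> carrier R" "s \<in> denoms" "t \<in> denoms"
  shows "fr (t \<otimes> r) (t \<otimes> s) = fr r s"
  using assms denoms_mult by (intro frac_eqI) (auto simp: m_ac)

lemma mem_carrier_Loc:
  "x \<in> carrier Loc \<longleftrightarrow> (\<exists>r\<in>carrier R. \<exists>s\<in>denoms. x = fr r s)"
  by (auto simp: localization_def quotient_def fraction_def)

lemma frac_closed: "r \<in> carrier R \<Longrightarrow> s \<in> denoms \<Longrightarrow> fr r s \<in> carrier Loc"
  using mem_carrier_Loc by blast

text \<open>The definition takes a union over all representatives; it collapses to one class because
  the formula respects \<open>fraction_rel\<close> in both arguments. \<open>add_frac\<close>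
  follows the same pattern.\<close>

lemma mult_frac:
  assumes "r \<in> carrier R" "s \<in> denoms" "r' \<in> carrier R" "s' \<in> denoms"
  shows "fr r s \<otimes>\<^bsub>Loc\<^esub> fr r' s' = fr (r \<otimes> r') (s \<otimes> s')"
proof -
  have "congruent2 (fraction_rel R I) (fraction_rel R I)
          (\<lambda>(r, s) (r', s'). fr (r \<otimes> r') (s \<otimes> s'))"
  proof (rule congruent2I'; clarify)
    fix r s r' s' a b a' b'
    assume 1: "((r, s), (r', s')) \<in> fraction_rel R I" and 2: "((a, b), (a', b')) \<in> fraction_rel R I"
    obtain u where u: "u \<in> denoms" "u \<otimes> (r \<otimes> s') = u \<otimes> (r' \<otimes> s)"
      using 1 by (auto simp: fraction_rel_iff)
    obtain v where v: "v \<in> denoms" "v \<otimes> (a \<otimes> b') = v \<otimes> (a' \<otimes> b)"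
      using 2 by (auto simp: fraction_rel_iff)
    have c: "r \<in> carrier R" "s \<in> carrier R" "r' \<in> carrier R" "s' \<in> carrier R" "u \<in> carrier R"
       "a \<in> carrier R" "b \<in> carrier R" "a' \<in> carrier R" "b' \<in> carrier R" "v \<in> carrier R"
      using 1 2 u v by (auto simp: fraction_rel_iff)
    have "(u \<otimes> v) \<otimes> ((r \<otimes> a) \<otimes> (s' \<otimes> b')) = (u \<otimes> (r \<otimes> s')) \<otimes> (v \<otimes> (a \<otimes> b'))"
      using c by (simp add: m_ac)
    also have "\<dots> = (u \<otimes> v) \<otimes> ((r' \<otimes> a') \<otimes> (s \<otimes> b))"
      unfolding u(2) v(2) using c by (simp add: m_ac)
    finally show "fr (r \<otimes> a) (s \<otimes> b) = fr (r' \<otimes> a') (s' \<otimes> b')"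
      using c 1 2 u(1) v(1) denoms_mult by (subst frac_eq_iff) (auto simp: fraction_rel_iff)
  qed
  from UN_equiv_class2[OF equiv_fraction_rel equiv_fraction_rel this, of "(r, s)" "(r', s')"] assms
  show ?thesis
    by (simp add: localization_def fraction_def split_beta)
qed

lemma add_frac:
  assumes "r \<in> carrier R" "s \<in> denoms" "r' \<in> carrier R" "s' \<in> denoms"
  shows "fr r s \<oplus>\<^bsub>Loc\<^esub> fr r' s' = fr (r \<otimes> s' \<oplus> r' \<otimes> s) (s \<otimes> s')"
proof -
  have "congruent2 (fraction_rel R I) (fraction_rel R I)
          (\<lambda>(r, s) (r', s'). fr (r \<otimes> s' \<oplus> r' \<otimes> s) (s \<otimes> s'))"
  proof (rule congruent2I'; clarify)
    fix r s r' s' a b a' b'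
    assume 1: "((r, s), (r', s')) \<in> fraction_rel R I" and 2: "((a, b), (a', b')) \<in> fraction_rel R I"
    obtain u where u: "u \<in> denoms" "u \<otimes> (r \<otimes> s') = u \<otimes> (r' \<otimes> s)"
      using 1 by (auto simp: fraction_rel_iff)
    obtain v where v: "v \<in> denoms" "v \<otimes> (a \<otimes> b') = v \<otimes> (a' \<otimes> b)"
      using 2 by (auto simp: fraction_rel_iff)
    have c: "r \<in> carrier R" "s \<in> carrier R" "r' \<in> carrier R" "s' \<in> carrier R" "u \<in> carrier R"
       "a \<in> carrier R" "b \<in> carrier R" "a' \<in> carrier R" "b' \<in> carrier R" "v \<in> carrier R"
      using 1 2 u v by (auto simp: fraction_rel_iff)
    have "(u \<otimes> v) \<otimes> ((r \<otimes> b \<oplus> a \<otimes> s) \<otimes> (s' \<otimes> b')) =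
        (v \<otimes> b \<otimes> b') \<otimes> (u \<otimes> (r \<otimes> s')) \<oplus> (u \<otimes> s \<otimes> s') \<otimes> (v \<otimes> (a \<otimes> b'))"
      using c by (simp add: m_ac l_distr r_distr)
    also have "\<dots> = (u \<otimes> v) \<otimes> ((r' \<otimes> b' \<oplus> a' \<otimes> s') \<otimes> (s \<otimes> b))"
      unfolding u(2) v(2) using c by (simp add: m_ac l_distr r_distr)
    finally show "fr (r \<otimes> b \<oplus> a \<otimes> s) (s \<otimes> b) = fr (r' \<otimes> b' \<oplus> a' \<otimes> s') (s' \<otimes> b')"
      using c 1 2 u(1) v(1) denoms_mult by (subst frac_eq_iff) (auto simp: fraction_rel_iff)
  qed
  from UN_equiv_class2[OF equiv_fraction_rel equiv_fraction_rel this, of "(r, s)" "(r', s')"] assms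
  show ?thesis
    by (simp add: localization_def fraction_def split_beta)
qed

text \<open>With equal denominators only the numerators are added, so the additive axioms of
  \<open>Loc\<close> follow from those of \<open>R\<close> after passing to a common
  denominator.\<close>

lemma add_frac_same:
  assumes "r \<in> carrier R" "s \<in> denoms" "r' \<in> carrier R"
  shows "fr r s \<oplus>\<^bsub>Loc\<^esub> fr r' s = fr (r \<oplus> r') s"
proof -
  have "r \<otimes> s \<oplus> r' \<otimes> s = s \<otimes> (r \<oplus> r')"
    using assms by (simp add: m_comm r_distr)
  then show ?thesis
    using assms by (simp add: add_frac frac_cancel)
qed

lemma one_Loc: "\<one>\<^bsub>Loc\<^esub> = fr \<one> \<one>"
  and zero_Loc: "\<zero>\<^bsub>Loc\<^esub> = fr \<zero> \<one>"
  by (simp_all add: localization_def)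

lemma frac_zero: "s \<in> denoms \<Longrightarrow> fr \<zero> s = \<zero>\<^bsub>Loc\<^esub>"
  unfolding zero_Loc using denoms_one by (intro frac_eqI) auto

lemma common_denominator:
  assumes "x \<in> carrier Loc" "y \<in> carrier Loc"
  obtains r r' s where "r \<in> carrier R" "r' \<in> carrier R" "s \<in> denoms" "x = fr r s" "y = fr r' s"
proof -
  obtain a b a' b' where ab: "a \<in> carrier R" "b \<in> denoms" "x = fr a b"
      "a' \<in> carrier R" "b' \<in> denoms" "y = fr a' b'"
    using assms unfolding mem_carrier_Loc by blast
  have "x = fr (b' \<otimes> a) (b \<otimes> b')" "y = fr (b \<otimes> a') (b \<otimes> b')"
    using ab frac_cancel[of a b b'] frac_cancel[of a' b' b] by (simp_all add: m_comm)
  then show ?thesis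
    using ab denoms_mult by (intro that[of "b' \<otimes> a" "b \<otimes> a'" "b \<otimes> b'"]) auto
qed

lemma cring_Loc: "cring Loc"
proof (rule cringI)
  have cl: "x \<oplus>\<^bsub>Loc\<^esub> y \<in> carrier Loc" if "x \<in> carrier Loc" "y \<in> carrier Loc" for x y
    using common_denominator[OF that] by (metis add_frac_same frac_closed add.m_closed)
  have clm: "x \<otimes>\<^bsub>Loc\<^esub> y \<in> carrier Loc" if "x \<in> carrier Loc" "y \<in> carrier Loc" for x y
    using that unfolding mem_carrier_Loc by (metis mult_frac denoms_mult m_closed)
  have three: "\<exists>a\<in>carrier R. \<exists>b\<in>carrier R. \<exists>c\<in>carrier R. \<exists>s\<in>denoms. x = fr a s \<and> y = fr b s \<and> z = fr c s"
    if xyz: "x \<in> carrier Loc" "y \<in> carrier Loc" "z \<in> carrier Loc" for x y z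
  proof -
    obtain a b s where ab: "a \<in> carrier R" "b \<in> carrier R" "s \<in> denoms" "x = fr a s" "y = fr b s"
      using common_denominator[OF xyz(1,2)] .
    obtain c t where c: "c \<in> carrier R" "t \<in> denoms" "z = fr c t"
      using xyz(3) unfolding mem_carrier_Loc by blast
    have "x = fr (t \<otimes> a) (t \<otimes> s)" "y = fr (t \<otimes> b) (t \<otimes> s)" "z = fr (s \<otimes> c) (t \<otimes> s)"
      using ab c frac_cancel[of a s t] frac_cancel[of b s t] frac_cancel[of c t s]
      by (simp_all add: m_comm)
    then show ?thesis
      using ab c denoms_mult by (metis DiffE m_closed)
  qed
  show "abelian_group Loc"
  proof (rule abelian_groupI)
    show "\<zero>\<^bsub>Loc\<^esub> \<in> carrier Loc"
      unfolding zero_Loc using denoms_one by (intro frac_closed) auto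
    fix x assume x: "x \<in> carrier Loc"
    show "\<exists>y\<in>carrier Loc. y \<oplus>\<^bsub>Loc\<^esub> x = \<zero>\<^bsub>Loc\<^esub>"
    proof -
      obtain a s where "a \<in> carrier R" "s \<in> denoms" "x = fr a s"
        using x unfolding mem_carrier_Loc by blast
      then show ?thesis
        by (intro bexI[of _ "fr (\<ominus> a) s"]) (auto simp: add_frac_same frac_zero l_neg frac_closed)
    qed
    show "\<zero>\<^bsub>Loc\<^esub> \<oplus>\<^bsub>Loc\<^esub> x = x"
    proof -
      obtain a s where "a \<in> carrier R" "s \<in> denoms" "x = fr a s"
        using x unfolding mem_carrier_Loc by blast
      then show ?thesis
        by (metis add_frac_same frac_zero l_zero zero_closed)
    qed
    fix y assume y: "y \<in> carrier Loc"
    show "x \<oplus>\<^bsub>Loc\<^esub> y = y \<oplus>\<^bsub>Loc\<^esub> x"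
      using common_denominator[OF x y] by (metis add_frac_same a_comm)
    fix z assume z: "z \<in> carrier Loc"
    show "(x \<oplus>\<^bsub>Loc\<^esub> y) \<oplus>\<^bsub>Loc\<^esub> z = x \<oplus>\<^bsub>Loc\<^esub> (y \<oplus>\<^bsub>Loc\<^esub> z)"
      using three[OF x y z] by (auto simp: add_frac_same a_assoc)
  qed (rule cl)
  show "comm_monoid Loc"
  proof (rule comm_monoidI)
    show "\<one>\<^bsub>Loc\<^esub> \<in> carrier Loc"
      unfolding one_Loc using denoms_one by (intro frac_closed) auto
    fix x assume x: "x \<in> carrier Loc"
    then obtain a s where as: "a \<in> carrier R" "s \<in> denoms" "x = fr a s"
      unfolding mem_carrier_Loc by blast
    then show "\<one>\<^bsub>Loc\<^esub> \<otimes>\<^bsub>Loc\<^esub> x = x"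
      using denoms_one by (simp add: one_Loc mult_frac)
    fix y assume y: "y \<in> carrier Loc"
    then obtain b t where bt: "b \<in> carrier R" "t \<in> denoms" "y = fr b t"
      unfolding mem_carrier_Loc by blast
    show "x \<otimes>\<^bsub>Loc\<^esub> y = y \<otimes>\<^bsub>Loc\<^esub> x"
      using as bt by (simp add: mult_frac m_comm)
    fix z assume z: "z \<in> carrier Loc"
    then obtain c w where "c \<in> carrier R" "w \<in> denoms" "z = fr c w"
      unfolding mem_carrier_Loc by blast
    then show "(x \<otimes>\<^bsub>Loc\<^esub> y) \<otimes>\<^bsub>Loc\<^esub> z = x \<otimes>\<^bsub>Loc\<^esub> (y \<otimes>\<^bsub>Loc\<^esub> z)"
      using as bt denoms_mult by (simp add: mult_frac m_assoc)
  qed (rule clm)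
  fix x y z assume "x \<in> carrier Loc" "y \<in> carrier Loc" "z \<in> carrier Loc"
  from three[OF this] obtain a b c s where h: "a \<in> carrier R" "b \<in> carrier R" "c \<in> carrier R" "s \<in> denoms"
      "x = fr a s" "y = fr b s" "z = fr c s"
    by auto
  have ss: "s \<otimes> s \<in> denoms" using h(4) h(4) by (rule denoms_mult)
  have "(x \<oplus>\<^bsub>Loc\<^esub> y) \<otimes>\<^bsub>Loc\<^esub> z = fr ((a \<oplus> b) \<otimes> c) (s \<otimes> s)"
    unfolding h(5-7) using h(1-4) by (subst add_frac_same, (simp; fail)+, subst mult_frac) auto
  also have "\<dots> = fr (a \<otimes> c \<oplus> b \<otimes> c) (s \<otimes> s)"
    using h(1-3) by (simp only: l_distr)
  also have "\<dots> = fr (a \<otimes> c) (s \<otimes> s) \<oplus>\<^bsub>Loc\<^esub> fr (b \<otimes> c) (s \<otimes> s)"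
    using h(1-3) ss by (intro add_frac_same[symmetric]) auto
  also have "\<dots> = x \<otimes>\<^bsub>Loc\<^esub> z \<oplus>\<^bsub>Loc\<^esub> y \<otimes>\<^bsub>Loc\<^esub> z"
    unfolding h(5-7) using h(1-4) mult_frac by simp
  finally show "(x \<oplus>\<^bsub>Loc\<^esub> y) \<otimes>\<^bsub>Loc\<^esub> z = x \<otimes>\<^bsub>Loc\<^esub> z \<oplus>\<^bsub>Loc\<^esub> y \<otimes>\<^bsub>Loc\<^esub> z" .
qed

section \<open>Extension and contraction of ideals\<close>

definition extn :: "'a set \<Rightarrow> ('a \<times> 'a) set set" where
  "extn J = {fr r s | r s. r \<in> J \<and> s \<in> denoms}"

definition contr :: "('a \<times> 'a) set set \<Rightarrow> 'a set" where
  "contr K = {r \<in> carrier R. fr r \<one> \<in> K}"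

lemma extnI: "r \<in> J \<Longrightarrow> s \<in> denoms \<Longrightarrow> fr r s \<in> extn J"
  by (auto simp: extn_def)

lemma frac_mem_extn_iff:
  assumes J: "ideal J R" and r: "r \<in> carrier R" "s \<in> denoms"
  shows "fr r s \<in> extn J \<longleftrightarrow> (\<exists>u\<in>denoms. u \<otimes> r \<in> J)"
proof
  interpret J: ideal J R by (rule J)
  show "\<exists>u\<in>denoms. u \<otimes> r \<in> J" if x: "fr r s \<in> extn J"
  proof -
    obtain a t where a: "a \<in> J" "t \<in> denoms" "fr r s = fr a t"
      using x unfolding extn_def by blast
    then obtain u where u: "u \<in> denoms" "u \<otimes> (r \<otimes> t) = u \<otimes> (a \<otimes> s)"
      using frac_eq_iff[OF r J.a_Hcarr[OF a(1)] a(2)] by auto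
    have "u \<otimes> t \<otimes> r = u \<otimes> s \<otimes> a"
      using u a r J.a_Hcarr by (simp add: m_ac)
    moreover have "u \<otimes> s \<otimes> a \<in> J"
      using u a r by (intro J.I_l_closed) auto
    ultimately have "u \<otimes> t \<otimes> r \<in> J" by simp
    then show ?thesis using denoms_mult[OF u(1) a(2)] by blast
  qed
  show "fr r s \<in> extn J" if "\<exists>u\<in>denoms. u \<otimes> r \<in> J"
  proof -
    obtain u where u: "u \<in> denoms" "u \<otimes> r \<in> J" using \<open>\<exists>u\<in>denoms. u \<otimes> r \<in> J\<close> by blast
    show ?thesis using extnI[OF u(2) denoms_mult[OF u(1) r(2)]] frac_cancel[OF r u(1)] by simp
  qed
qed

lemma ideal_extn:
  assumes J: "ideal J R"
  shows "ideal (extn J) Loc"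
proof -
  interpret J: ideal J R by (rule J)
  interpret L: cring Loc by (rule cring_Loc)
  show ?thesis
  proof (rule idealI)
    show "ring Loc" by (rule L.ring_axioms)
    show "subgroup (extn J) (add_monoid Loc)"
    proof (rule L.add.subgroupI)
      show "extn J \<subseteq> carrier Loc"
        using frac_closed J.a_Hcarr by (auto simp: extn_def)
      show "extn J \<noteq> {}"
        using extnI[OF additive_subgroup.zero_closed[OF J.is_additive_subgroup] denoms_one] by auto
      fix x assume "x \<in> extn J"
      then obtain a s where a: "a \<in> J" "s \<in> denoms" "x = fr a s" by (auto simp: extn_def)
      have "fr (\<ominus> a) s \<oplus>\<^bsub>Loc\<^esub> x = \<zero>\<^bsub>Loc\<^esub>"
        using a J.a_Hcarr by (simp add: add_frac_same frac_zero l_neg)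
      then have "\<ominus>\<^bsub>Loc\<^esub> x = fr (\<ominus> a) s"
        using a J.a_Hcarr frac_closed by (intro L.minus_equality) auto
      moreover have "\<ominus> a \<in> J"
        using a by (simp add: J.a_inv_closed)
      ultimately show "\<ominus>\<^bsub>Loc\<^esub> x \<in> extn J"
        using a extnI by simp
      fix y assume "y \<in> extn J"
      then obtain b t where b: "b \<in> J" "t \<in> denoms" "y = fr b t" by (auto simp: extn_def)
      have "a \<otimes> t \<oplus> b \<otimes> s \<in> J"
        using a b by (intro J.a_closed J.I_r_closed) auto
      then show "x \<oplus>\<^bsub>Loc\<^esub> y \<in> extn J"
        using a b denoms_mult J.a_Hcarr unfolding extn_def by (auto simp: add_frac)
    qed
    fix x y assume "x \<in> extn J" "y \<in> carrier Loc"
    then obtain a s b t where a: "a \<in> J" "s \<in> denoms" "x = fr a s"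
        and b: "b \<in> carrier R" "t \<in> denoms" "y = fr b t"
      by (auto simp: extn_def mem_carrier_Loc)
    have "a \<otimes> b \<in> J" "b \<otimes> a \<in> J"
      using a b by (auto intro: J.I_r_closed J.I_l_closed)
    then show "x \<otimes>\<^bsub>Loc\<^esub> y \<in> extn J" "y \<otimes>\<^bsub>Loc\<^esub> x \<in> extn J"
      using a b denoms_mult J.a_Hcarr unfolding extn_def by (auto simp: mult_frac)
  qed
qed

lemma canonical_hom: "(\<lambda>r. fr r \<one>) \<in> ring_hom R Loc"
  using denoms_one
  by (intro ring_hom_memI) (auto simp: frac_closed mult_frac add_frac_same one_Loc)

lemma ideal_contr: "ideal K Loc \<Longrightarrow> ideal (contr K) R"
  unfolding contr_def
  using ring_hom_ring.ideal_vimage[OF ring_hom_ringI2[OF ring_axioms cring.axioms(1)[OF cring_Loc] canonical_hom]] .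

text \<open>Multiplying by \<open>s/1\<close> and by \<open>1/s\<close> shows that
  \<open>r/s\<close> lies in \<open>K\<close> iff \<open>r/1\<close> does. Hence
  \<open>contr\<close> is injective on the ideals of \<open>Loc\<close>, and both finite generation
  and prime chains can be studied in \<open>R\<close>.\<close>

lemma extn_contr:
  assumes K: "ideal K Loc"
  shows "extn (contr K) = K"
proof -
  interpret K: ideal K Loc by (rule K)
  show ?thesis
  proof
    show "extn (contr K) \<subseteq> K"
    proof
      fix x assume "x \<in> extn (contr K)"
      then obtain r s where r: "r \<in> carrier R" "fr r \<one> \<in> K" "s \<in> denoms" "x = fr r s"
        by (auto simp: extn_def contr_def)
      have "fr r \<one> \<otimes>\<^bsub>Loc\<^esub> fr \<one> s \<in> K"
        using r by (intro K.I_r_closed frac_closed) auto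
      then show "x \<in> K"
        using r denoms_one by (simp add: mult_frac)
    qed
    show "K \<subseteq> extn (contr K)"
    proof
      fix x assume x: "x \<in> K"
      then obtain r s where r: "r \<in> carrier R" "s \<in> denoms" "x = fr r s"
        using K.a_Hcarr mem_carrier_Loc by blast
      have "fr s \<one> \<otimes>\<^bsub>Loc\<^esub> x \<in> K"
        using r x denoms_one by (intro K.I_l_closed frac_closed) auto
      moreover have "fr s \<one> \<otimes>\<^bsub>Loc\<^esub> x = fr (s \<otimes> r) (s \<otimes> \<one>)"
        using r denoms_one by (simp add: mult_frac)
      then have "fr s \<one> \<otimes>\<^bsub>Loc\<^esub> x = fr r \<one>"
        using frac_cancel[OF r(1) denoms_one r(2)] by simp
      ultimately show "x \<in> extn (contr K)"
        using r by (auto simp: extn_def contr_def)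
    qed
  qed
qed

lemma frac_mem_extn_prime:
  assumes Q: "primeideal Q R" and QI: "Q \<subseteq> I" and r: "r \<in> carrier R" "s \<in> denoms"
  shows "fr r s \<in> extn Q \<longleftrightarrow> r \<in> Q"
proof
  interpret Q: primeideal Q R by (rule Q)
  show "r \<in> Q" if x: "fr r s \<in> extn Q"
  proof -
    obtain u where u: "u \<in> denoms" "u \<otimes> r \<in> Q" using x frac_mem_extn_iff[OF Q.is_ideal r] by auto
    then show ?thesis using Q.I_prime[of u r] r(1) QI by auto
  qed
  show "fr r s \<in> extn Q" if "r \<in> Q" using that r(2) by (rule extnI)
qed

lemma primeideal_extn:
  assumes Q: "primeideal Q R" and QI: "Q \<subseteq> I"
  shows "primeideal (extn Q) Loc"
proof -
  interpret Q: primeideal Q R by (rule Q)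
  have mem: "fr r s \<in> extn Q \<longleftrightarrow> r \<in> Q" if "r \<in> carrier R" "s \<in> denoms" for r s
    using frac_mem_extn_prime[OF Q QI that] .
  show ?thesis
  proof (rule primeidealI)
    show "ideal (extn Q) Loc" by (rule ideal_extn[OF Q.is_ideal])
    show "cring Loc" by (rule cring_Loc)
    have "fr \<one> \<one> \<notin> extn Q"
      using mem[of \<one> \<one>] denoms_one QI by auto
    then show "carrier Loc \<noteq> extn Q"
      using frac_closed[of \<one> \<one>] denoms_one by auto
    fix x y assume xy: "x \<in> carrier Loc" "y \<in> carrier Loc" "x \<otimes>\<^bsub>Loc\<^esub> y \<in> extn Q"
    then obtain a s b t where a: "a \<in> carrier R" "s \<in> denoms" "x = fr a s"
        and b: "b \<in> carrier R" "t \<in> denoms" "y = fr b t"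
      by (auto simp: mem_carrier_Loc)
    then have "a \<otimes> b \<in> Q"
      using xy mem[of "a \<otimes> b" "s \<otimes> t"] denoms_mult by (simp add: mult_frac)
    then show "x \<in> extn Q \<or> y \<in> extn Q"
      using Q.I_prime a b mem by auto
  qed
qed

lemma primeideal_contr:
  assumes K: "primeideal K Loc"
  shows "primeideal (contr K) R"
proof -
  interpret K: primeideal K Loc by (rule K)
  show ?thesis
  proof (rule primeidealI)
    show "ideal (contr K) R" by (rule ideal_contr[OF K.is_ideal])
    show "cring R" by (rule is_cring)
    have "fr \<one> \<one> \<notin> K"
      using K.one_imp_carrier[unfolded one_Loc] K.I_notcarr by auto
    then show "carrier R \<noteq> contr K" by (auto simp: contr_def)
    show "a \<in> contr K \<or> b \<in> contr K"
      if "a \<in> carrier R" "b \<in> carrier R" "a \<otimes> b \<in> contr K" for a b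
      using that K.I_prime[of "fr a \<one>" "fr b \<one>"] denoms_one
      by (auto simp: contr_def mult_frac frac_closed)
  qed
qed

text \<open>Contraction keeps a chain strict, because \<open>extn\<close> recovers every member from
  its contraction.\<close>

lemma krull_dim_Loc_le: "krull_dim Loc \<le> krull_dim R"
  unfolding krull_dim_def
proof (rule Sup_subset_mono, clarify)
  fix n and C :: "nat \<Rightarrow> ('a \<times> 'a) set set"
  assume C: "\<forall>i\<le>n. primeideal (C i) Loc" "\<forall>i<n. C i \<subset> C (Suc i)"
  have "contr (C i) \<subset> contr (C (Suc i))" if "i < n" for i
  proof -
    have "C i = extn (contr (C i))" "C (Suc i) = extn (contr (C (Suc i)))"
      using C(1) that extn_contr[OF primeideal.axioms(1)] by simp_all
    moreover have "C i \<subset> C (Suc i)" using C that by blast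
    ultimately show ?thesis
      by (auto simp: contr_def)
  qed
  moreover have "primeideal (contr (C i)) R" if "i \<le> n" for i
    using C that primeideal_contr by blast
  ultimately show "\<exists>k. enat n = enat k \<and> (\<exists>C. (\<forall>i\<le>k. primeideal (C i) R) \<and> (\<forall>i<k. C i \<subset> C (Suc i)))"
    by (intro exI[of _ n] conjI refl exI[of _ "\<lambda>i. contr (C i)"]) auto
qed

lemma genideal_Loc:
  assumes F: "F \<subseteq> carrier R"
  shows "genideal Loc ((\<lambda>r. fr r \<one>) ` F) = extn (genideal R F)"
proof -
  interpret L: cring Loc by (rule cring_Loc)
  have sub: "(\<lambda>r. fr r \<one>) ` F \<subseteq> carrier Loc"
    using F denoms_one by (auto intro: frac_closed)
  show ?thesis
  proof
    have "(\<lambda>r. fr r \<one>) ` F \<subseteq> extn (genideal R F)"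
      using genideal_self[OF F] denoms_one by (auto simp: extn_def)
    then show "genideal Loc ((\<lambda>r. fr r \<one>) ` F) \<subseteq> extn (genideal R F)"
      using F by (intro L.genideal_minimal ideal_extn genideal_ideal) auto
    have "F \<subseteq> contr (genideal Loc ((\<lambda>r. fr r \<one>) ` F))"
      using L.genideal_self[OF sub] F by (auto simp: contr_def)
    then have "genideal R F \<subseteq> contr (genideal Loc ((\<lambda>r. fr r \<one>) ` F))"
      using sub by (intro genideal_minimal ideal_contr L.genideal_ideal) auto
    then have "extn (genideal R F) \<subseteq> extn (contr (genideal Loc ((\<lambda>r. fr r \<one>) ` F)))"
      by (auto simp: extn_def)
    then show "extn (genideal R F) \<subseteq> genideal Loc ((\<lambda>r. fr r \<one>) ` F)"
      using extn_contr[OF L.genideal_ideal[OF sub]] by simp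
  qed
qed

text \<open>A fraction outside \<open>extn I\<close> has its numerator outside \<open>I\<close>, so
  it is a unit. Every proper ideal therefore lies in \<open>extn I\<close>.\<close>

lemma maximalideals_Loc: "{K. maximalideal K Loc} = {extn I}"
proof -
  interpret L: cring Loc by (rule cring_Loc)
  have ext: "primeideal (extn I) Loc"
    using primeideal_extn[OF primeideal_axioms] by simp
  have below: "K \<subseteq> extn I" if K: "ideal K Loc" "K \<noteq> carrier Loc" for K
  proof
    interpret K: ideal K Loc by (rule K(1))
    fix x assume x: "x \<in> K"
    then obtain r s where r: "r \<in> carrier R" "s \<in> denoms" "x = fr r s"
      using K.a_Hcarr mem_carrier_Loc by blast
    show "x \<in> extn I"
    proof (rule ccontr)
      assume "x \<notin> extn I"
      then have rI: "r \<in> denoms" using r extnI[of r I s] by auto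
      have "x \<otimes>\<^bsub>Loc\<^esub> fr s r \<in> K"
        using r rI x by (intro K.I_r_closed frac_closed) auto
      moreover have "x \<otimes>\<^bsub>Loc\<^esub> fr s r = fr (r \<otimes> s) (s \<otimes> r)"
        unfolding r(3) using r(1,2) rI by (intro mult_frac) auto
      moreover have "fr (r \<otimes> s) (s \<otimes> r) = \<one>\<^bsub>Loc\<^esub>"
        unfolding one_Loc using r(1,2) rI denoms_one denoms_mult[OF r(2) rI]
        by (intro frac_eqI) (auto simp: m_comm)
      ultimately show False using K.one_imp_carrier K(2) by simp
    qed
  qed
  interpret E: primeideal "extn I" Loc by (rule ext)
  have max: "maximalideal (extn I) Loc"
  proof (rule maximalidealI)
    show "ideal (extn I) Loc" by (rule E.is_ideal)
    show "carrier Loc \<noteq> extn I" using E.I_notcarr .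
    show "J = extn I \<or> J = carrier Loc" if "ideal J Loc" "extn I \<subseteq> J" "J \<subseteq> carrier Loc" for J
      using that below by blast
  qed
  moreover have "K = extn I" if K: "maximalideal K Loc" for K
  proof -
    interpret K: maximalideal K Loc by (rule K)
    have "K \<subseteq> extn I" using below K.is_ideal K.I_notcarr by auto
    then show ?thesis
      using K.I_maximal[OF E.is_ideal] E.I_notcarr
        additive_subgroup.a_subset[OF E.is_additive_subgroup] by auto
  qed
  ultimately show ?thesis by blast
qed

section \<open>Regularity of the localization in terms of the ring itself\<close>

definition locally_generates :: "'a set \<Rightarrow> 'a set \<Rightarrow> bool" where
  "locally_generates F J \<longleftrightarrow> (\<forall>x\<in>J. \<exists>u\<in>denoms. u \<otimes> x \<in> genideal R F)"

lemma extn_genideal_eq: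
  assumes J: "ideal J R" and F: "F \<subseteq> J" and gen: "locally_generates F J"
  shows "extn (genideal R F) = extn J"
proof
  interpret J: ideal J R by (rule J)
  have Fc: "F \<subseteq> carrier R" using F J.Icarr by blast
  have "genideal R F \<subseteq> J" using F by (intro genideal_minimal J)
  then show "extn (genideal R F) \<subseteq> extn J" by (auto simp: extn_def)
  show "extn J \<subseteq> extn (genideal R F)"
    using gen frac_mem_extn_iff[OF genideal_ideal[OF Fc]] J.Icarr
    unfolding locally_generates_def by (auto simp: extn_def[of J])
qed

text \<open>The dimension is never computed: the chain ending in \<open>I\<close> bounds it below by
  \<open>n\<close>, and the definition of regularity only asks that the number of generators not
  exceed it. Noetherianity follows in the same spirit, from local generators of the contracted
  ideals.\<close>

lemma regular_localizationI:
  assumes C: "\<And>i. i \<le> n \<Longrightarrow> primeideal (C i) R" "\<And>i. i < n \<Longrightarrow> C i \<subset> C (Suc i)" "C n = I"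
    and F: "finite F" "card F \<le> n" "F \<subseteq> I" "locally_generates F I"
    and noeth: "\<And>J. ideal J R \<Longrightarrow> \<exists>G. finite G \<and> G \<subseteq> J \<and> locally_generates G J"
  shows "regular_local_ring Loc"
  unfolding regular_local_ring_def
proof (intro conjI exI)
  show "cring Loc" by (rule cring_Loc)
  interpret L: cring Loc by (rule cring_Loc)
  show "noetherian_ring Loc"
  proof (intro noetherian_ring.intro L.ring_axioms noetherian_ring_axioms.intro)
    fix K assume K: "ideal K Loc"
    obtain G where G: "finite G" "G \<subseteq> contr K" "locally_generates G (contr K)"
      using noeth[OF ideal_contr[OF K]] by blast
    then have Gc: "G \<subseteq> carrier R" by (auto simp: contr_def)
    have "K = genideal Loc ((\<lambda>r. fr r \<one>) ` G)"
      using genideal_Loc[OF Gc] extn_genideal_eq[OF ideal_contr[OF K] G(2,3)] extn_contr[OF K] by simp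
    then show "\<exists>A\<subseteq>carrier Loc. finite A \<and> K = genideal Loc A"
      using Gc G(1) denoms_one by (intro exI[of _ "(\<lambda>r. fr r \<one>) ` G"]) (auto intro: frac_closed)
  qed
  show "{K. maximalideal K Loc} = {extn I}" by (rule maximalideals_Loc)
  have Fc: "F \<subseteq> carrier R" using F Icarr by blast
  show "(\<lambda>r. fr r \<one>) ` F \<subseteq> carrier Loc" using Fc denoms_one by (auto intro: frac_closed)
  show "finite ((\<lambda>r. fr r \<one>) ` F)" using F by blast
  show "genideal Loc ((\<lambda>r. fr r \<one>) ` F) = extn I"
    using genideal_Loc[OF Fc] extn_genideal_eq[OF is_ideal F(3,4)] by simp
  have CI: "C i \<subseteq> I" if "i \<le> n" for i
    using that C(2,3) by (induction i rule: inc_induct) auto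
  have mem: "fr r \<one> \<in> extn (C i) \<longleftrightarrow> r \<in> C i" if "i \<le> n" "r \<in> carrier R" for i r
    using frac_mem_extn_prime[OF C(1)[OF that(1)] CI[OF that(1)] that(2) denoms_one] .
  have "extn (C i) \<subset> extn (C (Suc i))" if i: "i < n" for i
  proof -
    obtain x where x: "x \<in> C (Suc i)" "x \<notin> C i" using C(2)[OF i] by blast
    have "x \<in> carrier R" using x(1) CI[of "Suc i"] i Icarr by auto
    then have "fr x \<one> \<in> extn (C (Suc i))" "fr x \<one> \<notin> extn (C i)"
      using mem x i by auto
    moreover have "extn (C i) \<subseteq> extn (C (Suc i))"
      using C(2)[OF i] by (auto simp: extn_def)
    ultimately show ?thesis by blast
  qed
  then have "enat n \<le> krull_dim Loc"
    unfolding krull_dim_def using primeideal_extn C(1) CI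
    by (intro Sup_upper CollectI exI[of _ n] conjI refl exI[of _ "\<lambda>i. extn (C i)"]) auto
  moreover have "card ((\<lambda>r. fr r \<one>) ` F) \<le> n"
    using card_image_le[OF F(1)] F(2) by (rule le_trans)
  ultimately show "enat (card ((\<lambda>r. fr r \<one>) ` F)) \<le> krull_dim Loc"
    by (meson enat_ord_simps(1) order_trans)
qed

text \<open>Numerators of generators of the maximal ideal generate \<open>I\<close> locally, since
  denominators are units in \<open>Loc\<close>. The bound is stated with the dimension of
  \<open>R\<close>, which is the one that can be estimated.\<close>

lemma regular_localizationE:
  assumes "regular_local_ring Loc"
  obtains F where "finite F" "F \<subseteq> I" "locally_generates F I" "enat (card F) \<le> krull_dim R"
proof -
  interpret L: cring Loc by (rule cring_Loc)
  obtain S where S: "S \<subseteq> carrier Loc" "finite S" "enat (card S) \<le> krull_dim Loc" "genideal Loc S = extn I"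
    using assms maximalideals_Loc unfolding regular_local_ring_def by auto
  have "\<exists>r. r \<in> I \<and> (\<exists>s\<in>denoms. x = fr r s)" if "x \<in> S" for x
    using that L.genideal_self[OF S(1)] S(4) by (auto simp: extn_def)
  then obtain f where f: "\<And>x. x \<in> S \<Longrightarrow> f x \<in> I \<and> (\<exists>s\<in>denoms. x = fr (f x) s)"
    by metis
  have fc: "f ` S \<subseteq> carrier R" using f Icarr by auto
  have "S \<subseteq> extn (genideal R (f ` S))"
    using f genideal_self[OF fc] by (fastforce simp: extn_def)
  then have "extn I \<subseteq> extn (genideal R (f ` S))"
    unfolding S(4)[symmetric] using fc by (intro L.genideal_minimal ideal_extn genideal_ideal)
  then have "locally_generates (f ` S) I"
    unfolding locally_generates_def
    using frac_mem_extn_iff[OF genideal_ideal[OF fc] Icarr denoms_one] extnI[OF _ denoms_one, of _ I] by blast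
  moreover have "enat (card (f ` S)) \<le> krull_dim R"
    using card_image_le[OF S(2), of f] S(3) krull_dim_Loc_le
    by (meson enat_ord_simps(1) order_trans)
  ultimately show thesis
    using f S(2) by (intro that[of "f ` S"]) auto
qed

end

section \<open>Polynomial rings\<close>

text \<open>A commutative ring is a module over itself and its submodules are its ideals; so
  \<open>ideals.subspace\<close> means ideal and \<open>ideals.span\<close> is the generated
  ideal.\<close>

interpretation ideals: Modules.module "(*) :: 'a::comm_ring_1 \<Rightarrow> 'a \<Rightarrow> 'a"
  by standard (simp_all add: algebra_simps)

text \<open>As a simplification rule, \<open>scale_scale\<close> reverses \<open>mult.assoc\<close> and loops with it.\<close>

declare ideals.scale_scale [simp del]

definition prime_set :: "'a::comm_ring_1 set \<Rightarrow> bool" where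
  "prime_set P \<longleftrightarrow> ideals.subspace P \<and> 1 \<notin> P \<and> (\<forall>a b. a * b \<in> P \<longrightarrow> a \<in> P \<or> b \<in> P)"

lemma prime_setI:
  assumes "0 \<in> P" "\<And>a b. a \<in> P \<Longrightarrow> b \<in> P \<Longrightarrow> a + b \<in> P" "\<And>a b. b \<in> P \<Longrightarrow> a * b \<in> P"
    "1 \<notin> P" "\<And>a b. a * b \<in> P \<Longrightarrow> a \<in> P \<or> b \<in> P"
  shows "prime_set P"
  using assms unfolding prime_set_def by (auto intro: ideals.subspaceI)

lemma
  assumes "prime_set P"
  shows prime_set_zero: "0 \<in> P"
    and prime_set_add: "a \<in> P \<Longrightarrow> b \<in> P \<Longrightarrow> a + b \<in> P"
    and prime_set_diff: "a \<in> P \<Longrightarrow> b \<in> P \<Longrightarrow> a - b \<in> P"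
    and prime_set_mult: "b \<in> P \<Longrightarrow> a * b \<in> P"
    and prime_set_mult_iff: "a * b \<in> P \<longleftrightarrow> a \<in> P \<or> b \<in> P"
    and prime_set_sum: "(\<And>i. i \<in> A \<Longrightarrow> h i \<in> P) \<Longrightarrow> sum h A \<in> P"
    and prime_set_one: "1 \<notin> P"
proof -
  have P: "ideals.subspace P" using assms by (simp add: prime_set_def)
  show "0 \<in> P" "a \<in> P \<Longrightarrow> b \<in> P \<Longrightarrow> a + b \<in> P" "a \<in> P \<Longrightarrow> b \<in> P \<Longrightarrow> a - b \<in> P"
    using P by (auto intro: ideals.subspace_0 ideals.subspace_add ideals.subspace_diff)
  show mult: "b \<in> P \<Longrightarrow> a * b \<in> P" for a b
    using P by (auto intro: ideals.subspace_scale)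
  show "a * b \<in> P \<longleftrightarrow> a \<in> P \<or> b \<in> P"
    using mult[of b a] mult[of a b] assms by (auto simp: prime_set_def mult.commute)
  show "(\<And>i. i \<in> A \<Longrightarrow> h i \<in> P) \<Longrightarrow> sum h A \<in> P"
    using ideals.subspace_sum[OF P, of A h] by blast
  show "1 \<notin> P" using assms by (simp add: prime_set_def)
qed

lemma prime_set_power: "prime_set P \<Longrightarrow> a ^ n \<in> P \<Longrightarrow> a \<in> P"
  by (induction n) (auto simp: prime_set_mult_iff prime_set_one)

definition generates_at :: "'a::comm_ring_1 set \<Rightarrow> 'a set \<Rightarrow> 'a set \<Rightarrow> bool" where
  "generates_at P F J \<longleftrightarrow> (\<forall>x\<in>J. \<exists>u. u \<notin> P \<and> u * x \<in> ideals.span F)"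

text \<open>A certificate for regularity of the localization at \<open>P\<close>, matching the first
  assumptions of \<open>regular_localizationI\<close>. In this form it passes to polynomial rings
  and through charts without any fractions.\<close>

definition regular_at :: "'a::comm_ring_1 set \<Rightarrow> bool" where
  "regular_at P \<longleftrightarrow>
    (\<exists>n C F. (\<forall>i\<le>n. prime_set (C i)) \<and> (\<forall>i<n. C i \<subset> C (Suc i)) \<and> C n = P \<and>
      finite F \<and> card F \<le> n \<and> F \<subseteq> P \<and> generates_at P F P)"

lemma regular_atI:
  assumes "\<And>i. i \<le> n \<Longrightarrow> prime_set (C i)" "\<And>i. i < n \<Longrightarrow> C i \<subset> C (Suc i)" "C n = P"
    "finite F" "card F \<le> n" "F \<subseteq> P" "generates_at P F P"
  shows "regular_at P"
  using assms unfolding regular_at_def by blast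

lemma chain_subset_last:
  assumes "\<And>i. i < n \<Longrightarrow> C i \<subset> C (Suc i)" "i \<le> n"
  shows "C i \<subseteq> C n"
  using assms(2) by (induction i rule: inc_induct) (use assms(1) in auto)

lemma prime_set_field:
  fixes P :: "'a::field set"
  assumes "prime_set P"
  shows "P = {0}"
  using prime_set_mult[OF assms] prime_set_one[OF assms] prime_set_zero[OF assms]
  by (metis left_inverse insertI1 singletonI subsetI subset_singletonD empty_iff)

lemma regular_at_field:
  fixes P :: "'a::field set"
  assumes "prime_set P"
  shows "regular_at P"
proof (rule regular_atI[where n = 0 and F = "{}" and C = "\<lambda>_. P"])
  show "generates_at P {} P"
    using prime_set_field[OF assms] by (auto simp: generates_at_def intro!: exI[of _ 1])
qed (use assms in auto)

definition coeffs_in :: "'a::comm_ring_1 set \<Rightarrow> 'a poly set" where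
  "coeffs_in P = {f. \<forall>i. coeff f i \<in> P}"

text \<open>The extension \<open>P[t]\<close> is prime by the argument of Gauss: let
  \<open>i\<close> and \<open>j\<close> be the least indices of coefficients of \<open>f\<close> and
  \<open>g\<close> outside \<open>P\<close>. Modulo \<open>P\<close> the coefficient of
  \<open>f * g\<close> at \<open>i + j\<close> is the product of these two, as every other summand
  has an index below \<open>i\<close> or below \<open>j\<close>.\<close>

lemma prime_set_coeffs_in:
  assumes P: "prime_set P"
  shows "prime_set (coeffs_in P)"
proof (rule prime_setI)
  show "0 \<in> coeffs_in P" "1 \<notin> coeffs_in P"
    using prime_set_zero[OF P] prime_set_one[OF P]
    by (auto simp: coeffs_in_def intro!: exI[of _ 0])
  show "f + g \<in> coeffs_in P" if "f \<in> coeffs_in P" "g \<in> coeffs_in P" for f g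
    using that by (auto simp: coeffs_in_def prime_set_add[OF P])
  show "f * g \<in> coeffs_in P" if "g \<in> coeffs_in P" for f g
    using that by (auto simp: coeffs_in_def coeff_mult intro!: prime_set_sum[OF P] prime_set_mult[OF P])
  fix f g assume fg: "f * g \<in> coeffs_in P"
  show "f \<in> coeffs_in P \<or> g \<in> coeffs_in P"
  proof (rule ccontr)
    assume "\<not> ?thesis"
    then have ex: "\<exists>i. coeff f i \<notin> P" "\<exists>j. coeff g j \<notin> P" by (auto simp: coeffs_in_def)
    define i j where "i = (LEAST i. coeff f i \<notin> P)" and "j = (LEAST j. coeff g j \<notin> P)"
    have i: "coeff f i \<notin> P" "\<And>k. k < i \<Longrightarrow> coeff f k \<in> P"
      unfolding i_def using LeastI_ex[OF ex(1)] not_less_Least by auto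
    have j: "coeff g j \<notin> P" "\<And>k. k < j \<Longrightarrow> coeff g k \<in> P"
      unfolding j_def using LeastI_ex[OF ex(2)] not_less_Least by auto
    have "coeff (f * g) (i + j) = (\<Sum>k\<le>i+j. coeff f k * coeff g (i + j - k))"
      by (simp add: coeff_mult)
    also have "\<dots> = coeff f i * coeff g j + (\<Sum>k\<in>{..i+j} - {i}. coeff f k * coeff g (i + j - k))"
      by (subst sum.remove[of _ i]) auto
    finally have "coeff f i * coeff g j =
        coeff (f * g) (i + j) - (\<Sum>k\<in>{..i+j} - {i}. coeff f k * coeff g (i + j - k))"
      by simp
    moreover have "coeff f k * coeff g (i + j - k) \<in> P" if k: "k \<in> {..i+j} - {i}" for k
    proof (cases "k < i")
      case False
      then have "i + j - k < j" using k by auto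
      then show ?thesis using j(2) by (auto simp: prime_set_mult_iff[OF P])
    qed (use i(2) in \<open>auto simp: prime_set_mult_iff[OF P]\<close>)
    ultimately have "coeff f i * coeff g j \<in> P"
      using fg by (auto simp: coeffs_in_def intro!: prime_set_diff[OF P] prime_set_sum[OF P])
    then show False using i j by (simp add: prime_set_mult_iff[OF P])
  qed
qed

lemma const_span:
  assumes "x \<in> ideals.span F"
  shows "[:x:] \<in> ideals.span ((\<lambda>c. [:c:]) ` F)"
proof (rule ideals.span_induct[OF assms])
  show "ideals.subspace {x. [:x:] \<in> ideals.span ((\<lambda>c. [:c:]) ` F)}"
  proof (intro ideals.subspaceI; clarsimp)
    show "0 \<in> ideals.span ((\<lambda>c. [:c:]) ` F)" by (rule ideals.span_zero)
    show "[:x + y:] \<in> ideals.span ((\<lambda>c. [:c:]) ` F)"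
      if "[:x:] \<in> ideals.span ((\<lambda>c. [:c:]) ` F)" "[:y:] \<in> ideals.span ((\<lambda>c. [:c:]) ` F)" for x y
      using ideals.span_add[OF that] by simp
    show "[:c * x:] \<in> ideals.span ((\<lambda>c. [:c:]) ` F)"
      if "[:x:] \<in> ideals.span ((\<lambda>c. [:c:]) ` F)" for c x
      using ideals.span_scale[OF that, of "[:c:]"] by (simp add: mult.commute)
  qed
qed (auto intro: ideals.span_base)

text \<open>Each coefficient needs its own multiplier outside \<open>P\<close>. There are finitely
  many coefficients, so the product of the multipliers serves for all of them.\<close>

lemma coeffs_in_generated:
  assumes P: "prime_set P" and F: "generates_at P F P" and f: "f \<in> coeffs_in P"
  shows "\<exists>u. u \<notin> P \<and> [:u:] * f \<in> ideals.span ((\<lambda>c. [:c:]) ` F)"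
  using f
proof (induction f)
  case 0
  show ?case using prime_set_one[OF P] ideals.span_zero by (intro exI[of _ 1]) auto
next
  case (pCons a f)
  have "coeff (pCons a f) i \<in> P" for i using pCons.prems by (auto simp: coeffs_in_def)
  from this[of 0] this[of "Suc _"] have a: "a \<in> P" and f: "f \<in> coeffs_in P"
    by (auto simp: coeffs_in_def)
  obtain u where u: "u \<notin> P" "[:u:] * f \<in> ideals.span ((\<lambda>c. [:c:]) ` F)"
    using pCons.IH f by blast
  obtain v where v: "v \<notin> P" "v * a \<in> ideals.span F"
    using F a by (auto simp: generates_at_def)
  have e: "[:u * v:] = [:u:] * [:v:]" "[:v * a:] = [:v:] * [:a:]" "pCons a f = [:a:] + [:0, 1:] * f"
    by (simp_all add: mult.commute)
  have "[:u * v:] * pCons a f = [:u:] * [:v * a:] + ([:v:] * [:0, 1:]) * ([:u:] * f)"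
    unfolding e by (simp only: algebra_simps)
  also have "\<dots> \<in> ideals.span ((\<lambda>c. [:c:]) ` F)"
    by (intro ideals.span_add ideals.span_scale u const_span v)
  finally show ?case
    using u v by (intro exI[of _ "u * v"]) (auto simp: prime_set_mult_iff[OF P])
qed

text \<open>With \<open>p\<close> the constants in \<open>Q\<close>, either \<open>Q = p[t]\<close>, or \<open>Q\<close> is locally generated by \<open>p\<close> and an element
  of least degree outside \<open>p[t]\<close>, and has one more step in its chain.\<close>

theorem regular_at_poly:
  fixes Q :: "'a::comm_ring_1 poly set"
  assumes reg: "\<And>P :: 'a set. prime_set P \<Longrightarrow> regular_at P" and Q: "prime_set Q"
  shows "regular_at Q"
proof -
  define p where "p = {a. [:a:] \<in> Q}"
  have p: "prime_set p"
  proof (rule prime_setI)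
    show "0 \<in> p" "1 \<notin> p"
      using prime_set_zero[OF Q] prime_set_one[OF Q] by (auto simp: p_def one_pCons)
    show "a + b \<in> p" if "a \<in> p" "b \<in> p" for a b
      using that prime_set_add[OF Q, of "[:a:]" "[:b:]"] by (simp add: p_def)
    show "a * b \<in> p" if "b \<in> p" for a b
      using that prime_set_mult[OF Q, of "[:b:]" "[:a:]"] by (simp add: p_def mult.commute)
    show "a \<in> p \<or> b \<in> p" if "a * b \<in> p" for a b
      using that prime_set_mult_iff[OF Q, of "[:a:]" "[:b:]"] by (simp add: p_def mult.commute)
  qed
  obtain n C F where C: "\<And>i. i \<le> n \<Longrightarrow> prime_set (C i)" "\<And>i. i < n \<Longrightarrow> C i \<subset> C (Suc i)" "C n = p"
      and F: "finite F" "card F \<le> n" "F \<subseteq> p" "generates_at p F p"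
    using reg[OF p] unfolding regular_at_def by blast
  let ?c = "\<lambda>c::'a. [:c:]"
  have card_le: "card (?c ` F) \<le> n" using card_image_le[OF F(1), of ?c] F(2) by linarith
  have strict: "coeffs_in (C i) \<subset> coeffs_in (C (Suc i))" if i: "i < n" for i
  proof -
    obtain x where x: "x \<in> C (Suc i)" "x \<notin> C i" using C(2)[OF i] by blast
    have "?c x \<in> coeffs_in (C (Suc i))" "?c x \<notin> coeffs_in (C i)"
      using x prime_set_zero[OF C(1)[of "Suc i"]] i
      by (auto simp: coeffs_in_def coeff_pCons split: nat.split intro!: exI[of _ 0])
    moreover have "coeffs_in (C i) \<subseteq> coeffs_in (C (Suc i))"
      using C(2)[OF i] by (auto simp: coeffs_in_def)
    ultimately show ?thesis by blast
  qed
  have sub: "coeffs_in p \<subseteq> Q"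
  proof
    fix f assume "f \<in> coeffs_in p"
    then show "f \<in> Q"
    proof (induction f)
      case 0
      show ?case by (rule prime_set_zero[OF Q])
    next
      case (pCons a f)
      have "coeff (pCons a f) i \<in> p" for i using pCons.prems by (auto simp: coeffs_in_def)
      from this[of 0] this[of "Suc _"] have a: "a \<in> p" and f: "f \<in> coeffs_in p"
        by (auto simp: coeffs_in_def)
      have "pCons a f = [:a:] + [:0, 1:] * f" by simp
      then show ?case
        using a pCons.IH[OF f] prime_set_add[OF Q] prime_set_mult[OF Q] by (simp only: p_def mem_Collect_eq)
    qed
  qed
  show ?thesis
  proof (cases "Q = coeffs_in p")
    case True
    show ?thesis
    proof (rule regular_atI[where n = n and C = "\<lambda>i. coeffs_in (C i)" and F = "?c ` F"])
      show "?c ` F \<subseteq> Q" using F(3) by (auto simp: p_def)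
      show "generates_at Q (?c ` F) Q"
        using coeffs_in_generated[OF p F(4)] True unfolding generates_at_def p_def by blast
    qed (use C True card_le F strict in \<open>auto intro: prime_set_coeffs_in\<close>)
  next
    case False
    then have ex: "\<exists>g. g \<in> Q - coeffs_in p" using sub by blast
    define g where "g = arg_min degree (\<lambda>g. g \<in> Q - coeffs_in p)"
    have g: "g \<in> Q" "g \<notin> coeffs_in p"
      using arg_min_natI[of "\<lambda>g. g \<in> Q - coeffs_in p" _ degree] ex unfolding g_def by blast+
    have min: "degree g \<le> degree h" if "h \<in> Q" "h \<notin> coeffs_in p" for h
      unfolding g_def using that by (intro arg_min_nat_le) auto
    have g0: "g \<noteq> 0" using g prime_set_zero[OF p] by (auto simp: coeffs_in_def)
    \<comment> \<open>Otherwise the leading monomial lies in \<open>p[t]\<close>, hence in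
      \<open>Q\<close>, and removing it would leave an element of \<open>Q\<close> outside
      \<open>p[t]\<close> of smaller degree.\<close>
    have lc: "lead_coeff g \<notin> p"
    proof
      assume l: "lead_coeff g \<in> p"
      define h where "h = g - monom (lead_coeff g) (degree g)"
      have m: "monom (lead_coeff g) (degree g) \<in> coeffs_in p"
        using l prime_set_zero[OF p] by (auto simp: coeffs_in_def coeff_monom)
      have "h \<in> Q" unfolding h_def using g m sub prime_set_diff[OF Q] by blast
      moreover have "h \<notin> coeffs_in p"
      proof
        assume "h \<in> coeffs_in p"
        then have "h + monom (lead_coeff g) (degree g) \<in> coeffs_in p"
          using m prime_set_add[OF prime_set_coeffs_in[OF p]] by blast
        then show False using g by (simp add: h_def)
      qed
      ultimately have "degree g \<le> degree h" "h \<noteq> 0" using min prime_set_zero[OF p] by (auto simp: coeffs_in_def)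
      moreover have "degree h \<le> degree g"
        unfolding h_def by (intro degree_diff_le degree_monom_le) auto
      ultimately have "degree h = degree g" "coeff h (degree h) \<noteq> 0" by auto
      then show False by (simp add: h_def)
    qed
    define F' where "F' = insert g (?c ` F)"
    have gen: "generates_at Q F' Q"
      unfolding generates_at_def
    proof
      fix h assume h: "h \<in> Q"
      \<comment> \<open>Ordinary division by \<open>g\<close> is impossible, but pseudo-division
        only multiplies \<open>h\<close> by a power of the leading coefficient. That power is
        outside \<open>Q\<close>, so it is a permitted local factor, and by minimality of the degree
        of \<open>g\<close> the remainder falls into \<open>p[t]\<close>.\<close>
      obtain q r where qr: "pseudo_divmod h g = (q, r)" by fastforce
      define k where "k = Suc (degree h) - degree g"
      have eq: "smult (lead_coeff g ^ k) h = g * q + r" and r: "r = 0 \<or> degree r < degree g"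
        using pseudo_divmod[OF g0 qr] by (auto simp: k_def)
      have "r = [:lead_coeff g ^ k:] * h - q * g" using eq by (simp add: mult.commute)
      then have "r \<in> Q" using h g prime_set_diff[OF Q] prime_set_mult[OF Q] by metis
      then have "r \<in> coeffs_in p"
        using r min[of r] prime_set_zero[OF prime_set_coeffs_in[OF p]] by force
      then obtain u where u: "u \<notin> p" "[:u:] * r \<in> ideals.span (?c ` F)"
        using coeffs_in_generated[OF p F(4)] by blast
      have "[:u * lead_coeff g ^ k:] * h = [:u:] * smult (lead_coeff g ^ k) h"
        by (simp add: mult.commute)
      also have "\<dots> = ([:u:] * q) * g + [:u:] * r"
        unfolding eq by (simp add: algebra_simps)
      also have "\<dots> \<in> ideals.span F'"
      proof (rule ideals.span_add)
        show "([:u:] * q) * g \<in> ideals.span F'"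
          unfolding F'_def by (intro ideals.span_scale ideals.span_base) simp
        show "[:u:] * r \<in> ideals.span F'"
          using u(2) ideals.span_mono[of "?c ` F" F'] unfolding F'_def by blast
      qed
      finally have "[:u * lead_coeff g ^ k:] * h \<in> ideals.span F'" .
      moreover have "u * lead_coeff g ^ k \<notin> p"
        using u lc prime_set_power[OF p] prime_set_mult_iff[OF p] by blast
      ultimately show "\<exists>u. u \<notin> Q \<and> u * h \<in> ideals.span F'"
        by (auto simp: p_def)
    qed
    show ?thesis
    proof (rule regular_atI[where n = "Suc n" and F = F' and
          C = "\<lambda>i. if i \<le> n then coeffs_in (C i) else Q"])
      show "(if i \<le> n then coeffs_in (C i) else Q) \<subset> (if Suc i \<le> n then coeffs_in (C (Suc i)) else Q)"
        if "i < Suc n" for i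
      proof (cases "i = n")
        case True
        then show ?thesis using C(3) sub False by auto
      qed (use that strict in auto)
      show "card F' \<le> Suc n"
      proof -
        have "card F' \<le> Suc (card (?c ` F))" unfolding F'_def using F(1) by (simp add: card_insert_if)
        then show ?thesis using card_le by linarith
      qed
      show "F' \<subseteq> Q" using F(3) g by (auto simp: p_def F'_def)
    qed (use C Q F gen in \<open>auto intro: prime_set_coeffs_in simp: F'_def\<close>)
  qed
qed

section \<open>Hilbert's basis theorem\<close>

definition fin_gen :: "'a::comm_ring_1 set \<Rightarrow> bool" where
  "fin_gen J \<longleftrightarrow> (\<exists>G. finite G \<and> J = ideals.span G)"

text \<open>If \<open>K\<close> were not finitely generated, one could keep choosing an element of
  least degree in \<open>K\<close> outside the ideal generated so far. The ideal of all leading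
  coefficients is finitely generated, so some leading coefficient is a combination of earlier ones;
  cancelling it contradicts the minimal degree of that choice.\<close>

theorem Hilbert_basis:
  fixes K :: "'a::comm_ring_1 poly set"
  assumes noeth: "\<And>J :: 'a set. ideals.subspace J \<Longrightarrow> fin_gen J" and K: "ideals.subspace K"
  shows "fin_gen K"
proof (rule ccontr)
  assume nfg: "\<not> fin_gen K"
  define pick where "pick G = arg_min degree (\<lambda>g. g \<in> K - ideals.span G)" for G :: "'a poly set"
  have pick: "pick G \<in> K \<and> pick G \<notin> ideals.span G \<and>
      (\<forall>h\<in>K. h \<notin> ideals.span G \<longrightarrow> degree (pick G) \<le> degree h)"
    if "finite G" "G \<subseteq> K" for G
  proof -
    have "ideals.span G \<subseteq> K" using that(2) K by (rule ideals.span_minimal)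
    moreover have "K \<noteq> ideals.span G" using nfg that(1) by (auto simp: fin_gen_def)
    ultimately have ex: "\<exists>g. g \<in> K - ideals.span G" by blast
    show ?thesis
      using arg_min_natI[of "\<lambda>g. g \<in> K - ideals.span G" _ degree] ex
        arg_min_nat_le[of "\<lambda>g. g \<in> K - ideals.span G" _ degree] unfolding pick_def by blast
  qed
  define gs where "gs = rec_nat {} (\<lambda>_ G. insert (pick G) G)"
  have gs_simps: "gs 0 = {}" "gs (Suc n) = insert (pick (gs n)) (gs n)" for n
    by (simp_all add: gs_def)
  have gs: "finite (gs n) \<and> gs n \<subseteq> K" for n
    by (induction n) (use pick in \<open>auto simp: gs_simps\<close>)
  define f where "f n = pick (gs n)" for n
  have gs_f: "gs n = f ` {..<n}" for n
    by (induction n) (auto simp: gs_simps f_def lessThan_Suc)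
  define a where "a n = lead_coeff (f n)" for n
  obtain G where G: "finite G" "ideals.span (range a) = ideals.span G"
    using noeth[OF ideals.subspace_span] by (auto simp: fin_gen_def)
  \<comment> \<open>A linear combination uses finitely many of the \<open>a i\<close>. This replaces
    an ascending chain condition: finitely many generators are all reached at one common stage
    \<open>n\<close>.\<close>
  have "\<exists>n. x \<in> ideals.span (a ` {..<n})" if x: "x \<in> ideals.span (range a)" for x
  proof -
    obtain t r where t: "finite t" "t \<subseteq> range a" "x = (\<Sum>y\<in>t. r y * y)"
      using x unfolding ideals.span_explicit by blast
    obtain N where N: "finite N" "t = a ` N"
      using finite_subset_image[OF t(1,2)] by blast
    obtain n where "N \<subseteq> {..<n}" using N(1) finite_nat_iff_bounded by blast
    then have "t \<subseteq> a ` {..<n}" using N by blast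
    then have "x \<in> ideals.span (a ` {..<n})"
      unfolding t(3) by (intro ideals.span_sum ideals.span_scale ideals.span_base) auto
    then show ?thesis ..
  qed
  then have "\<forall>x\<in>G. \<exists>n. x \<in> ideals.span (a ` {..<n})"
    using G(2) ideals.span_base[of _ G] by blast
  then obtain N where N: "\<And>x. x \<in> G \<Longrightarrow> x \<in> ideals.span (a ` {..<N x})" by metis
  define n where "n = Max (insert 0 (N ` G))"
  have "x \<in> ideals.span (a ` {..<n})" if "x \<in> G" for x
  proof -
    have "N x \<le> n" unfolding n_def using G(1) that by (intro Max_ge) auto
    then have "a ` {..<N x} \<subseteq> a ` {..<n}" by auto
    then show ?thesis using N[OF that] ideals.span_mono by blast
  qed
  then have "ideals.span G \<subseteq> ideals.span (a ` {..<n})"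
    by (intro ideals.span_minimal ideals.subspace_span) auto
  then have an: "a n \<in> ideals.span (a ` {..<n})"
    using G(2) ideals.span_base[of "a n" "range a"] by blast
  define D where "D = degree (f n)"
  have fn: "f n \<in> K" "f n \<notin> ideals.span (gs n)"
      "\<And>h. h \<in> K \<Longrightarrow> h \<notin> ideals.span (gs n) \<Longrightarrow> D \<le> degree h"
    using pick[of "gs n"] gs[of n] unfolding D_def f_def by auto
  \<comment> \<open>At stage \<open>i\<close> the later choice \<open>f n\<close> was also a
    candidate, so the chosen degrees do not decrease.\<close>
  have deg: "degree (f i) \<le> D" if "i < n" for i
  proof -
    have "gs i \<subseteq> gs n" using that by (auto simp: gs_f)
    then have "f n \<notin> ideals.span (gs i)" using fn(2) ideals.span_mono by blast
    then show ?thesis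
      using pick[of "gs i"] gs[of i] fn(1) unfolding D_def f_def by auto
  qed
  \<comment> \<open>The coefficients at \<open>D\<close> of elements of degree at most
    \<open>D\<close> in the span of the earlier choices form an ideal. It contains each earlier
    \<open>a i\<close>, because multiplying \<open>f i\<close> by a power of the variable raises its
    degree bound to \<open>D\<close>. Hence it contains \<open>a n\<close>, and some
    \<open>h\<close> cancels the leading term of \<open>f n\<close>.\<close>
  define V where "V = {c. \<exists>h\<in>ideals.span (gs n). degree h \<le> D \<and> coeff h D = c}"
  have "ideals.subspace V"
  proof (rule ideals.subspaceI)
    show "0 \<in> V" unfolding V_def using ideals.span_zero by force
    show "x + y \<in> V" if xy: "x \<in> V" "y \<in> V" for x y
    proof -
      obtain h k where "h \<in> ideals.span (gs n)" "degree h \<le> D" "coeff h D = x"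
          "k \<in> ideals.span (gs n)" "degree k \<le> D" "coeff k D = y"
        using xy by (auto simp: V_def)
      then show ?thesis
        unfolding V_def by (auto intro!: bexI[of _ "h + k"] ideals.span_add degree_add_le)
    qed
    show "c * x \<in> V" if x: "x \<in> V" for c x
    proof -
      obtain h where h: "h \<in> ideals.span (gs n)" "degree h \<le> D" "coeff h D = x"
        using x by (auto simp: V_def)
      have "smult c h \<in> ideals.span (gs n)"
        using ideals.span_scale[OF h(1), of "[:c:]"] by simp
      then show ?thesis
        unfolding V_def using h by (auto intro!: bexI[of _ "smult c h"] order_trans[OF degree_smult_le])
    qed
  qed
  moreover have "a i \<in> V" if i: "i < n" for i
  proof -
    define h where "h = monom 1 (D - degree (f i)) * f i"
    have "h \<in> ideals.span (gs n)"
      unfolding h_def using i by (intro ideals.span_scale ideals.span_base) (auto simp: gs_f)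
    moreover have "degree h \<le> D"
      unfolding h_def using degree_mult_le[of "monom 1 (D - degree (f i))" "f i"]
        degree_monom_le[of "1::'a" "D - degree (f i)"] deg[OF i] by linarith
    moreover have "coeff h D = a i"
      unfolding h_def a_def using deg[OF i] by (simp add: coeff_monom_mult)
    ultimately show ?thesis by (auto simp: V_def)
  qed
  ultimately have "ideals.span (a ` {..<n}) \<subseteq> V"
    by (intro ideals.span_minimal) auto
  then obtain h where h: "h \<in> ideals.span (gs n)" "degree h \<le> D" "coeff h D = a n"
    using an by (auto simp: V_def)
  have "ideals.span (gs n) \<subseteq> K" using gs K by (intro ideals.span_minimal) auto
  then have "f n - h \<in> K" using h fn K by (intro ideals.subspace_diff) auto
  moreover have nin: "f n - h \<notin> ideals.span (gs n)"
    using fn(2) h(1) ideals.span_add[of "f n - h" "gs n" h] by auto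
  ultimately have "D \<le> degree (f n - h)" using fn(3) by blast
  moreover have "degree (f n - h) \<le> D" using h(2) by (intro degree_diff_le) (auto simp: D_def)
  moreover have "coeff (f n - h) D = 0" using h(3) by (simp add: a_def D_def)
  ultimately have "f n - h = 0" by (metis leading_coeff_0_iff order_antisym)
  then show False using nin ideals.span_zero[of "gs n"] by simp
qed

lemma fin_gen_field:
  fixes J :: "'a::field set"
  assumes J: "ideals.subspace J"
  shows "fin_gen J"
proof (cases "J = {0}")
  case True
  then show ?thesis by (auto simp: fin_gen_def intro!: exI[of _ "{}"])
next
  case False
  then obtain a where "a \<in> J" "a \<noteq> 0" using ideals.subspace_0[OF J] by blast
  then have "1 \<in> J" using ideals.subspace_scale[OF J, of a "inverse a"] by simp
  then have "J = UNIV" using ideals.subspace_scale[OF J, of 1] by auto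
  moreover have "x \<in> ideals.span {1 :: 'a}" for x
    using ideals.span_scale[OF ideals.span_base[of 1 "{1}"], of x] by simp
  ultimately show ?thesis by (auto simp: fin_gen_def intro!: exI[of _ "{1}"])
qed

subsection \<open>Evaluation and dimension\<close>

definition ring_morph :: "('a::comm_ring_1 \<Rightarrow> 'b::comm_ring_1) \<Rightarrow> bool" where
  "ring_morph f \<longleftrightarrow> f 1 = 1 \<and> (\<forall>a b. f (a + b) = f a + f b) \<and> (\<forall>a b. f (a * b) = f a * f b)"

lemma
  assumes "ring_morph f"
  shows ring_morph_1: "f 1 = 1" and ring_morph_add: "f (a + b) = f a + f b"
    and ring_morph_mult: "f (a * b) = f a * f b" and ring_morph_0: "f 0 = 0"
    and ring_morph_power: "f (a ^ n) = f a ^ n" and ring_morph_diff: "f (a - b) = f a - f b"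
    and ring_morph_sum: "f (sum h A) = (\<Sum>i\<in>A. f (h i))"
proof -
  show 1: "f 1 = 1" and add: "f (a + b) = f a + f b" and mult: "f (a * b) = f a * f b" for a b
    using assms by (auto simp: ring_morph_def)
  show 0: "f 0 = 0" using add[of 0 0] by simp
  show "f (a ^ n) = f a ^ n" by (induction n) (auto simp: 1 mult)
  show "f (a - b) = f a - f b" using add[of "a - b" b] by (simp add: algebra_simps)
  show "f (sum h A) = (\<Sum>i\<in>A. f (h i))" by (induction A rule: infinite_finite_induct) (auto simp: 0 add)
qed

text \<open>Polynomials in several variables are nested \<open>poly\<close> types. Nested uses of
  \<open>poly_eval\<close> evaluate them, the outermost argument being the value of the outermost
  variable.\<close>

definition poly_eval :: "('a::comm_ring_1 \<Rightarrow> 'b::comm_ring_1) \<Rightarrow> 'b \<Rightarrow> 'a poly \<Rightarrow> 'b" where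
  "poly_eval f t p = poly (map_poly f p) t"

context
  fixes f :: "'a::comm_ring_1 \<Rightarrow> 'b::comm_ring_1" and t :: 'b
  assumes f: "ring_morph f"
begin

lemma poly_eval_pCons: "poly_eval f t (pCons a p) = f a + t * poly_eval f t p"
  by (simp add: poly_eval_def map_poly_pCons ring_morph_0[OF f])

lemma poly_eval_0: "poly_eval f t 0 = 0"
  by (simp add: poly_eval_def)

lemma poly_eval_add: "poly_eval f t (p + q) = poly_eval f t p + poly_eval f t q"
  by (induction p q rule: poly_induct2)
    (auto simp: poly_eval_pCons poly_eval_0 ring_morph_add[OF f] algebra_simps)

lemma poly_eval_smult: "poly_eval f t (smult c p) = f c * poly_eval f t p"
  by (induction p) (simp_all add: poly_eval_pCons poly_eval_0 ring_morph_mult[OF f] distrib_left mult.left_commute)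

lemma ring_morph_poly_eval: "ring_morph (poly_eval f t)"
  unfolding ring_morph_def
proof (intro conjI allI)
  show "poly_eval f t 1 = 1"
    by (simp add: one_pCons poly_eval_pCons poly_eval_0 ring_morph_1[OF f])
  show "poly_eval f t (p * q) = poly_eval f t p * poly_eval f t q" for p q
  proof (induction p)
    case 0
    show ?case by (simp only: mult_zero_left poly_eval_0)
  next
    case (pCons a p)
    have "poly_eval f t (pCons a p * q) = poly_eval f t (smult a q + pCons 0 (p * q))"
      by simp
    also have "\<dots> = f a * poly_eval f t q + t * (poly_eval f t p * poly_eval f t q)"
      by (simp only: poly_eval_add poly_eval_smult poly_eval_pCons ring_morph_0[OF f] add_0_left pCons.IH)
    finally show ?case by (simp only: poly_eval_pCons distrib_right mult.assoc)
  qed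
qed (rule poly_eval_add)

lemma poly_eval_const: "poly_eval f t [:c:] = f c"
  by (simp add: poly_eval_pCons poly_eval_0)

lemma poly_eval_X: "poly_eval f t [:0, 1:] = t"
  by (simp add: poly_eval_pCons poly_eval_0 ring_morph_0[OF f] ring_morph_1[OF f])

lemma poly_eval_monom: "poly_eval f t (monom c n) = f c * t ^ n"
  by (induction n) (simp_all add: monom_0 monom_Suc poly_eval_pCons poly_eval_0 ring_morph_0[OF f] mult_ac)

text \<open>A polynomial relation at \<open>x \<in> P' - P\<close> loses its variable: divide by the highest possible power
  of \<open>x\<close>, which is allowed modulo \<open>P\<close>, and then reduce modulo \<open>P'\<close>.\<close>

lemma relation_drop_variable:
  assumes P: "prime_set P" and P': "prime_set P'" "P \<subseteq> P'" and t: "t \<in> P'" "t \<notin> P"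
    and G: "G \<noteq> 0" "poly_eval f t G \<in> P"
  shows "\<exists>H. H \<noteq> 0 \<and> f H \<in> P'"
  using G
proof (induction G)
  case 0
  then show ?case by simp
next
  case (pCons a G)
  have *: "f a + t * poly_eval f t G \<in> P" using pCons.prems by (simp add: poly_eval_pCons)
  show ?case
  proof (cases "a = 0")
    case True
    then have "t * poly_eval f t G \<in> P" using * by (simp add: ring_morph_0[OF f])
    then have "poly_eval f t G \<in> P" using t(2) prime_set_mult_iff[OF P] by blast
    then show ?thesis using pCons True by auto
  next
    case False
    have "poly_eval f t G * t \<in> P'" by (rule prime_set_mult[OF P'(1) t(1)])
    then have "f a + t * poly_eval f t G - poly_eval f t G * t \<in> P'"
      using * P' by (intro prime_set_diff) auto
    then show ?thesis using False by (auto simp: mult.commute)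
  qed
qed

end

text \<open>Pick one new element \<open>x i\<close> for each of the four steps of the chain. A
  relation among these elements loses one variable per step, beginning with the outermost one at
  \<open>x 0\<close>, and ends as a nonzero constant in \<open>C 4\<close>. A nonzero constant is a
  unit, so \<open>C 4\<close> would not be proper.\<close>

lemma no_prime_chain:
  fixes \<kappa> :: "'k::field \<Rightarrow> 'a::comm_ring_1" and C :: "nat \<Rightarrow> 'a set"
  assumes \<kappa>: "ring_morph \<kappa>"
    and dep: "\<And>x y z w. \<exists>G. G \<noteq> 0 \<and>
      poly_eval (poly_eval (poly_eval (poly_eval \<kappa> w) z) y) x G = 0"
    and C: "\<And>i. i \<le> 4 \<Longrightarrow> prime_set (C i)" "\<And>i. i < 4 \<Longrightarrow> C i \<subset> C (Suc i)"
  shows False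
proof -
  have "\<exists>x. x \<in> C (Suc i) \<and> x \<notin> C i" if "i < 4" for i using C(2)[OF that] by blast
  then obtain x where x: "\<And>i. i < 4 \<Longrightarrow> x i \<in> C (Suc i)" "\<And>i. i < 4 \<Longrightarrow> x i \<notin> C i" by metis
  have P: "prime_set (C 0)" "prime_set (C 1)" "prime_set (C 2)" "prime_set (C 3)" "prime_set (C 4)"
    by (auto intro: C)
  have sub: "C 0 \<subseteq> C 1" "C 1 \<subseteq> C 2" "C 2 \<subseteq> C 3" "C 3 \<subseteq> C 4"
    using C(2)[of 0] C(2)[of 1] C(2)[of 2] C(2)[of 3] by (auto simp: eval_nat_numeral)
  have xs: "x 0 \<in> C 1" "x 1 \<in> C 2" "x 2 \<in> C 3" "x 3 \<in> C 4"
    using x(1)[of 0] x(1)[of 1] x(1)[of 2] x(1)[of 3] by (auto simp: eval_nat_numeral)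
  have xn: "x 0 \<notin> C 0" "x 1 \<notin> C 1" "x 2 \<notin> C 2" "x 3 \<notin> C 3"
    using x(2) by auto
  note m1 = ring_morph_poly_eval[OF \<kappa>]
  note m2 = ring_morph_poly_eval[OF m1]
  note m3 = ring_morph_poly_eval[OF m2]
  obtain G where G: "G \<noteq> 0" "poly_eval (poly_eval (poly_eval (poly_eval \<kappa> (x 3)) (x 2)) (x 1)) (x 0) G \<in> C 0"
    using dep prime_set_zero[OF P(1)] by metis
  obtain G1 where G1: "G1 \<noteq> 0" "poly_eval (poly_eval (poly_eval \<kappa> (x 3)) (x 2)) (x 1) G1 \<in> C 1"
    using relation_drop_variable[OF m3 P(1,2) sub(1) xs(1) xn(1) G] by blast
  obtain G2 where G2: "G2 \<noteq> 0" "poly_eval (poly_eval \<kappa> (x 3)) (x 2) G2 \<in> C 2"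
    using relation_drop_variable[OF m2 P(2,3) sub(2) xs(2) xn(2) G1] by blast
  obtain G3 where G3: "G3 \<noteq> 0" "poly_eval \<kappa> (x 3) G3 \<in> C 3"
    using relation_drop_variable[OF m1 P(3,4) sub(3) xs(3) xn(3) G2] by blast
  obtain c where c: "c \<noteq> 0" "\<kappa> c \<in> C 4"
    using relation_drop_variable[OF \<kappa> P(4,5) sub(4) xs(4) xn(4) G3] by blast
  have "\<kappa> (inverse c) * \<kappa> c \<in> C 4" using c(2) by (rule prime_set_mult[OF P(5)])
  then show False
    using c(1) prime_set_one[OF P(5)] by (simp add: ring_morph_mult[OF \<kappa>, symmetric] ring_morph_1[OF \<kappa>])
qed

lemma span_image:
  assumes "ring_morph f" "x \<in> ideals.span F"
  shows "f x \<in> ideals.span (f ` F)"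
proof (rule ideals.span_induct[OF assms(2)])
  show "ideals.subspace {x. f x \<in> ideals.span (f ` F)}"
    by (intro ideals.subspaceI)
      (auto simp: ring_morph_0 ring_morph_add ring_morph_mult assms(1)
        intro: ideals.span_zero ideals.span_add ideals.span_scale)
qed (auto intro: ideals.span_base)

text \<open>A chart: after inverting \<open>f = \<phi> f0\<close> the ring becomes a localization of the domain of \<open>\<phi>\<close>.\<close>

context
  fixes \<phi> :: "'b::comm_ring_1 \<Rightarrow> 'a::comm_ring_1" and f0 :: 'b
  assumes \<phi>: "ring_morph \<phi>" and inj: "\<And>y. \<phi> y = 0 \<Longrightarrow> y = 0"
    and surj: "\<And>r. \<exists>k y. \<phi> f0 ^ k * r = \<phi> y"
begin

lemma chart_inj: "\<phi> y = \<phi> z \<Longrightarrow> y = z"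
  using inj[of "y - z"] by (simp add: ring_morph_diff[OF \<phi>])

text \<open>The preimage \<open>Q\<close> of \<open>P\<close> has a certificate by assumption; its
  chain and generators are carried to the codomain. No member of the chain contains
  \<open>f0\<close>, since all of them lie in \<open>Q\<close>, and this keeps the carried ideals
  prime and distinct.\<close>

lemma regular_at_chart:
  assumes reg: "\<And>Q :: 'b set. prime_set Q \<Longrightarrow> regular_at Q"
    and P: "prime_set P" and f: "\<phi> f0 \<notin> P"
  shows "regular_at P"
proof -
  note hom = ring_morph_mult[OF \<phi>] ring_morph_power[OF \<phi>] ring_morph_add[OF \<phi>]
  define Q where "Q = \<phi> -` P"
  have Q: "prime_set Q"
    unfolding Q_def
    by (rule prime_setI)
      (auto simp: hom ring_morph_0[OF \<phi>] ring_morph_1[OF \<phi>] prime_set_zero[OF P] prime_set_one[OF P]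
         prime_set_add[OF P] prime_set_mult_iff[OF P])
  obtain n C F where C: "\<And>i. i \<le> n \<Longrightarrow> prime_set (C i)" "\<And>i. i < n \<Longrightarrow> C i \<subset> C (Suc i)" "C n = Q"
      and F: "finite F" "card F \<le> n" "F \<subseteq> Q" "generates_at Q F Q"
    using reg[OF Q] unfolding regular_at_def by blast
  have f0: "f0 \<notin> C i" if "i \<le> n" for i
    using chain_subset_last[of n C i, OF C(2) that] C(3) f by (auto simp: Q_def)
  have f0p: "f0 ^ k \<notin> C i" if "i \<le> n" for k i
    using f0 prime_set_power[OF C(1)] that by blast
  \<comment> \<open>The image of \<open>C i\<close> need not be an ideal. \<open>D i\<close> is the
    contraction of its extension to the ring with \<open>f\<close> inverted, written without
    fractions.\<close>
  define D where "D i = {r. \<exists>k y. y \<in> C i \<and> \<phi> f0 ^ k * r = \<phi> y}" for i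
  have D_iff: "\<phi> y \<in> D i \<longleftrightarrow> y \<in> C i" if "i \<le> n" for y i
  proof
    assume "\<phi> y \<in> D i"
    then obtain k z where "z \<in> C i" "\<phi> f0 ^ k * \<phi> y = \<phi> z" by (auto simp: D_def)
    then have "f0 ^ k * y \<in> C i" using chart_inj by (metis hom(1,2))
    then show "y \<in> C i" using f0p that prime_set_mult_iff[OF C(1)[OF that]] by blast
  next
    assume "y \<in> C i"
    then show "\<phi> y \<in> D i" unfolding D_def by (intro CollectI exI[of _ 0] exI[of _ y]) simp
  qed
  have D: "prime_set (D i)" if i: "i \<le> n" for i
  proof (rule prime_setI)
    note Ci = C(1)[OF i]
    show "0 \<in> D i" using D_iff[OF i, of 0] prime_set_zero[OF Ci] ring_morph_0[OF \<phi>] by simp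
    show "1 \<notin> D i" using D_iff[OF i, of 1] prime_set_one[OF Ci] ring_morph_1[OF \<phi>] by simp
    show "r + s \<in> D i" if rs: "r \<in> D i" "s \<in> D i" for r s
    proof -
      obtain k y l z where h: "y \<in> C i" "\<phi> f0 ^ k * r = \<phi> y" "z \<in> C i" "\<phi> f0 ^ l * s = \<phi> z"
        using rs by (auto simp: D_def)
      have "\<phi> f0 ^ (k + l) * (r + s) = \<phi> f0 ^ l * (\<phi> f0 ^ k * r) + \<phi> f0 ^ k * (\<phi> f0 ^ l * s)"
        by (simp add: algebra_simps power_add)
      also have "\<dots> = \<phi> (f0 ^ l * y + f0 ^ k * z)" by (simp add: h hom)
      finally show ?thesis
        unfolding D_def using h prime_set_add[OF Ci] prime_set_mult[OF Ci] by blast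
    qed
    show "c * r \<in> D i" if r: "r \<in> D i" for c r
    proof -
      obtain k y where h: "y \<in> C i" "\<phi> f0 ^ k * r = \<phi> y" using r by (auto simp: D_def)
      obtain m w where w: "\<phi> f0 ^ m * c = \<phi> w" using surj by blast
      have "\<phi> f0 ^ (m + k) * (c * r) = (\<phi> f0 ^ m * c) * (\<phi> f0 ^ k * r)"
        by (simp add: algebra_simps power_add)
      also have "\<dots> = \<phi> (w * y)" by (simp add: h w hom)
      finally show ?thesis
        unfolding D_def using h prime_set_mult[OF Ci] by blast
    qed
    show "r \<in> D i \<or> s \<in> D i" if rs: "r * s \<in> D i" for r s
    proof -
      obtain k y where y: "y \<in> C i" "\<phi> f0 ^ k * (r * s) = \<phi> y" using rs by (auto simp: D_def)
      obtain l u where u: "\<phi> f0 ^ l * r = \<phi> u" using surj by blast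
      obtain m v where v: "\<phi> f0 ^ m * s = \<phi> v" using surj by blast
      have "\<phi> (f0 ^ k * (u * v)) = \<phi> f0 ^ k * ((\<phi> f0 ^ l * r) * (\<phi> f0 ^ m * s))"
        by (simp add: hom u v)
      also have "\<dots> = \<phi> f0 ^ (l + m) * (\<phi> f0 ^ k * (r * s))"
        by (simp add: algebra_simps power_add)
      also have "\<dots> = \<phi> (f0 ^ (l + m) * y)" by (simp add: y hom)
      finally have "f0 ^ k * (u * v) \<in> C i" using chart_inj y prime_set_mult[OF Ci] by metis
      then have "u \<in> C i \<or> v \<in> C i" using f0p[OF i] prime_set_mult_iff[OF Ci] by blast
      then show ?thesis using u v by (auto simp: D_def)
    qed
  qed
  have "\<phi> x \<in> P" if "x \<in> Q" for x using that by (simp add: Q_def)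
  have Dn: "D n = P"
  proof (intro equalityI subsetI)
    fix r assume "r \<in> D n"
    then obtain k y where "\<phi> y \<in> P" "\<phi> f0 ^ k * r = \<phi> y" by (auto simp: D_def C(3) Q_def)
    then have "\<phi> f0 ^ k * r \<in> P" by simp
    then show "r \<in> P" using f prime_set_power[OF P] prime_set_mult_iff[OF P] by blast
  next
    fix r assume r: "r \<in> P"
    obtain k y where "\<phi> f0 ^ k * r = \<phi> y" using surj by blast
    moreover from this r have "y \<in> Q" using prime_set_mult[OF P, of r "\<phi> f0 ^ k"] by (simp add: Q_def)
    ultimately show "r \<in> D n" by (auto simp: D_def C(3))
  qed
  show ?thesis
  proof (rule regular_atI[where n = n and C = D and F = "\<phi> ` F"])
    show "D i \<subset> D (Suc i)" if i: "i < n" for i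
    proof -
      obtain y where "y \<in> C (Suc i)" "y \<notin> C i" using C(2)[OF i] by blast
      then have "\<phi> y \<in> D (Suc i)" "\<phi> y \<notin> D i" using D_iff i by auto
      moreover have "D i \<subseteq> D (Suc i)" using C(2)[OF i] by (auto simp: D_def)
      ultimately show ?thesis by blast
    qed
    show "card (\<phi> ` F) \<le> n" using card_image_le[OF F(1), of \<phi>] F(2) by linarith
    show "\<phi> ` F \<subseteq> P" using F(3) by (auto simp: Q_def)
    show "generates_at P (\<phi> ` F) P"
      unfolding generates_at_def
    proof
      fix x assume x: "x \<in> P"
      obtain k y where y: "\<phi> f0 ^ k * x = \<phi> y" using surj by blast
      then have "y \<in> Q" using x prime_set_mult[OF P, of x "\<phi> f0 ^ k"] by (simp add: Q_def)
      then obtain u where u: "u \<notin> Q" "u * y \<in> ideals.span F" using F(4) by (auto simp: generates_at_def)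
      have "(\<phi> u * \<phi> f0 ^ k) * x = \<phi> (u * y)" by (simp add: hom y mult.assoc)
      also have "\<dots> \<in> ideals.span (\<phi> ` F)" using span_image[OF \<phi> u(2)] .
      finally have "(\<phi> u * \<phi> f0 ^ k) * x \<in> ideals.span (\<phi> ` F)" .
      moreover have "\<phi> u * \<phi> f0 ^ k \<notin> P"
        using u(1) f prime_set_power[OF P] prime_set_mult_iff[OF P] by (auto simp: Q_def)
      ultimately show "\<exists>u. u \<notin> P \<and> u * x \<in> ideals.span (\<phi> ` F)" by blast
    qed
  qed (use D Dn F in auto)
qed

text \<open>Some power of \<open>f\<close> times any element of \<open>J\<close> is the image of an
  element of the preimage of \<open>J\<close>. Images of finitely many generators of that preimage
  thus generate \<open>J\<close> up to a factor outside \<open>P\<close>.\<close>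

lemma noetherian_at_chart:
  assumes noeth: "\<And>K :: 'b set. ideals.subspace K \<Longrightarrow> fin_gen K"
    and P: "prime_set P" and f: "\<phi> f0 \<notin> P" and J: "ideals.subspace J"
  shows "\<exists>G. finite G \<and> G \<subseteq> J \<and> generates_at P G J"
proof -
  have "ideals.subspace (\<phi> -` J)"
    by (rule ideals.subspaceI)
      (auto simp: ring_morph_0[OF \<phi>] ring_morph_add[OF \<phi>] ring_morph_mult[OF \<phi>]
        intro: ideals.subspace_0[OF J] ideals.subspace_add[OF J] ideals.subspace_scale[OF J])
  then obtain G where G: "finite G" "\<phi> -` J = ideals.span G"
    using noeth unfolding fin_gen_def by blast
  have "generates_at P (\<phi> ` G) J"
    unfolding generates_at_def
  proof
    fix x assume x: "x \<in> J"
    obtain k y where y: "\<phi> f0 ^ k * x = \<phi> y" using surj by blast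
    then have "y \<in> ideals.span G"
      using x ideals.subspace_scale[OF J, of x "\<phi> f0 ^ k"] G(2) by auto
    then have "\<phi> f0 ^ k * x \<in> ideals.span (\<phi> ` G)" using span_image[OF \<phi>] y by simp
    moreover have "\<phi> f0 ^ k \<notin> P" using f prime_set_power[OF P] by blast
    ultimately show "\<exists>u. u \<notin> P \<and> u * x \<in> ideals.span (\<phi> ` G)" by blast
  qed
  moreover have "\<phi> ` G \<subseteq> J" using G(2) ideals.span_base by blast
  ultimately show ?thesis using G(1) by blast
qed

end

text \<open>Gaussian elimination on an indexed family. Indices rather than sets matter in the
  application, where different exponent vectors may give the same product but must count as
  different monomials of the relation.\<close>

lemma linear_dependence:
  fixes v :: "'i \<Rightarrow> 'k \<Rightarrow> 'f::field"
  assumes "finite K" "finite I" "card K < card I"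
  shows "\<exists>c. (\<exists>i\<in>I. c i \<noteq> 0) \<and> (\<forall>k\<in>K. (\<Sum>i\<in>I. c i * v i k) = 0)"
  using assms
proof (induction K arbitrary: I v rule: finite_induct)
  case empty
  then have "I \<noteq> {}" by auto
  then show ?case by (auto intro!: exI[of _ "\<lambda>_. 1"])
next
  case (insert k K)
  show ?case
  proof (cases "\<forall>i\<in>I. v i k = 0")
    case True
    have "card K < card I" using insert by simp
    from insert.IH[OF insert.prems(1) this, of v] True show ?thesis by auto
  next
    case False
    then obtain j where j: "j \<in> I" "v j k \<noteq> 0" by blast
    define w where "w i l = v i l - v i k / v j k * v j l" for i l
    have "card K < card (I - {j})" "finite (I - {j})" using insert j by auto
    from insert.IH[OF this(2,1), of w] obtain c where
      c: "\<exists>i\<in>I - {j}. c i \<noteq> 0" "\<forall>l\<in>K. (\<Sum>i\<in>I - {j}. c i * w i l) = 0" by blast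
    \<comment> \<open>The coefficient of the pivot \<open>j\<close> compensates the multiples of
      \<open>v j\<close> that were subtracted, so that a relation among the \<open>w i\<close>
      becomes one among the \<open>v i\<close>.\<close>
    define d where "d i = (if i = j then - (\<Sum>i\<in>I - {j}. c i * (v i k / v j k)) else c i)" for i
    have d: "(\<Sum>i\<in>I. d i * v i l) = (\<Sum>i\<in>I - {j}. c i * w i l)" for l
    proof -
      have "(\<Sum>i\<in>I. d i * v i l) = d j * v j l + (\<Sum>i\<in>I - {j}. d i * v i l)"
        using insert.prems(1) j(1) by (rule sum.remove)
      also have "(\<Sum>i\<in>I - {j}. d i * v i l) = (\<Sum>i\<in>I - {j}. c i * v i l)"
        by (intro sum.cong) (auto simp: d_def)
      also have "d j * v j l = - (\<Sum>i\<in>I - {j}. c i * (v i k / v j k * v j l))"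
        by (simp add: d_def sum_distrib_right mult.assoc)
      also have "- (\<Sum>i\<in>I - {j}. c i * (v i k / v j k * v j l)) + (\<Sum>i\<in>I - {j}. c i * v i l) =
          (\<Sum>i\<in>I - {j}. c i * w i l)"
        by (simp only: w_def right_diff_distrib sum_subtractf) simp
      finally show ?thesis .
    qed
    have "w i k = 0" for i using j(2) by (simp add: w_def)
    then have "\<forall>l\<in>insert k K. (\<Sum>i\<in>I. d i * v i l) = 0" using c(2) by (simp add: d)
    moreover have "\<exists>i\<in>I. d i \<noteq> 0" using c(1) by (auto simp: d_def)
    ultimately show ?thesis by blast
  qed
qed

section \<open>The conifold algebra as a matrix algebra\<close>

abbreviation "lookup \<equiv> Poly_Mapping.lookup"
abbreviation "keys \<equiv> Poly_Mapping.keys"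
abbreviation "single \<equiv> Poly_Mapping.single"

lemma poly_mapping_sum_single: "(\<Sum>k\<in>keys p. single k (lookup p k)) = p"
proof (rule poly_mapping_eqI)
  fix k
  have "lookup (\<Sum>k\<in>keys p. single k (lookup p k)) k =
      (\<Sum>l\<in>keys p. if l = k then lookup p l else 0)"
    by (auto simp: lookup_sum lookup_single when_def intro!: sum.cong)
  also have "\<dots> = lookup p k"
    by (simp add: sum.delta in_keys_iff)
  finally show "lookup (\<Sum>k\<in>keys p. single k (lookup p k)) k = lookup p k" .
qed

lemma poly_mapping_induct [case_names zero single add]:
  fixes p :: "'a \<Rightarrow>\<^sub>0 'b::comm_monoid_add"
  assumes "P 0" "\<And>k c. P (single k c)" "\<And>p q. P p \<Longrightarrow> P q \<Longrightarrow> P (p + q)"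
  shows "P p"
proof -
  have "P (\<Sum>k\<in>A. single k (lookup p k))" if "finite A" for A
    using that by (induction A rule: finite_induct) (use assms in auto)
  from this[OF finite_keys, of p] show ?thesis by (simp add: poly_mapping_sum_single)
qed

text \<open>The embedding \<open>c\<close> of the scalars is a parameter because the targets differ:
  matrices through \<open>scal_mat\<close> for the representation, the free algebra through
  \<open>scal\<close> for its section.\<close>

definition linear_ext :: "(complex \<Rightarrow> 'r::ring_1) \<Rightarrow> ('m \<Rightarrow> 'r) \<Rightarrow> ('m \<Rightarrow>\<^sub>0 complex) \<Rightarrow> 'r" where
  "linear_ext c \<mu> p = (\<Sum>m\<in>keys p. c (lookup p m) * \<mu> m)"

context
  fixes c :: "complex \<Rightarrow> 'r::ring_1" and \<mu> :: "'m \<Rightarrow> 'r"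
  assumes c_add: "\<And>x y. c (x + y) = c x + c y"
begin

lemma linear_ext_zero: "linear_ext c \<mu> 0 = 0"
  by (simp add: linear_ext_def)

lemma linear_ext_superset:
  assumes "finite A" "keys p \<subseteq> A"
  shows "linear_ext c \<mu> p = (\<Sum>m\<in>A. c (lookup p m) * \<mu> m)"
proof -
  have "c 0 = 0" using c_add[of 0 0] by simp
  then show ?thesis
    unfolding linear_ext_def using assms
    by (intro sum.mono_neutral_left) (auto simp: in_keys_iff)
qed

lemma linear_ext_add: "linear_ext c \<mu> (p + q) = linear_ext c \<mu> p + linear_ext c \<mu> q"
proof -
  have "finite (keys p \<union> keys q)" by simp
  then show ?thesis
    using linear_ext_superset[of "keys p \<union> keys q"] keys_add[of p q]
    by (simp add: lookup_add c_add sum.distrib distrib_right)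
qed

lemma linear_ext_single: "linear_ext c \<mu> (single m z) = c z * \<mu> m"
  using linear_ext_superset[of "{m}" "single m z"] by simp

end

lemma linear_ext_scale:
  fixes c :: "complex \<Rightarrow> 'r::ring_1" and p :: "'m::monoid_add \<Rightarrow>\<^sub>0 complex"
  assumes "\<And>x y. c (x + y) = c x + c y" "\<And>x y. c (x * y) = c x * c y"
  shows "linear_ext c \<mu> (single 0 z * p) = c z * linear_ext c \<mu> p"
  by (induction p rule: poly_mapping_induct)
    (simp_all add: linear_ext_zero[OF assms(1)] linear_ext_single[OF assms(1)] linear_ext_add[OF assms(1)]
      mult_single assms(2) mult.assoc distrib_left)

lemma linear_ext_mult:
  fixes c :: "complex \<Rightarrow> 'r::ring_1" and \<mu> :: "'m::monoid_add \<Rightarrow> 'r"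
  assumes c: "\<And>x y. c (x + y) = c x + c y" "\<And>x y. c (x * y) = c x * c y" "\<And>x r. c x * r = r * c x"
    and \<mu>: "\<And>m n. \<mu> (m + n) = \<mu> m * \<mu> n"
  shows "linear_ext c \<mu> (p * q) = linear_ext c \<mu> p * linear_ext c \<mu> q"
proof (induction p rule: poly_mapping_induct)
  case (single k x)
  show ?case
  proof (induction q rule: poly_mapping_induct)
    case (single l y)
    have "c x * c y * (\<mu> k * \<mu> l) = c x * (c y * \<mu> k) * \<mu> l" by (simp add: mult.assoc)
    also have "\<dots> = c x * \<mu> k * (c y * \<mu> l)" unfolding c(3)[of y "\<mu> k"] by (simp add: mult.assoc)
    finally show ?case by (simp add: mult_single linear_ext_single[OF c(1)] c(2) \<mu>)
  qed (simp_all add: linear_ext_zero[OF c(1)] linear_ext_add[OF c(1)] distrib_left)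
qed (simp_all add: linear_ext_zero[OF c(1)] linear_ext_add[OF c(1)] distrib_right)

abbreviation scal :: "complex \<Rightarrow> 'm::monoid_add \<Rightarrow>\<^sub>0 complex" where
  "scal \<equiv> single 0"

lemma scal_add: "scal (x + y) = scal x + scal y"
  and scal_mult: "scal (x * y) = scal x * scal y"
  by (simp_all add: single_add mult_single)

lemma scal_commute: "scal z * p = p * scal z"
  by (induction p rule: poly_mapping_induct) (simp_all add: mult_single algebra_simps)

lemma scal_mult_single: "scal x * single k y = single k (x * y)"
  by (simp add: mult_single)

subsection \<open>Graded matrices\<close>

datatype 'a mat2 = Mat2 (m11: 'a) (m12: 'a) (m21: 'a) (m22: 'a)

instantiation mat2 :: (comm_ring_1) ring_1
begin

definition "0 = Mat2 0 0 0 0"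
definition "1 = Mat2 1 0 0 1"
definition "A + B = Mat2 (m11 A + m11 B) (m12 A + m12 B) (m21 A + m21 B) (m22 A + m22 B)"
definition "- A = Mat2 (- m11 A) (- m12 A) (- m21 A) (- m22 A)"
definition "(A::'a mat2) - B = Mat2 (m11 A - m11 B) (m12 A - m12 B) (m21 A - m21 B) (m22 A - m22 B)"
definition "A * B = Mat2 (m11 A * m11 B + m12 A * m21 B) (m11 A * m12 B + m12 A * m22 B)
  (m21 A * m11 B + m22 A * m21 B) (m21 A * m12 B + m22 A * m22 B)"

lemmas mat2_defs =
  zero_mat2_def one_mat2_def plus_mat2_def uminus_mat2_def minus_mat2_def times_mat2_def

instance
  by standard (simp_all add: mat2_defs algebra_simps)

end

lemma mat2_sel_simps [simp]:
  "m11 0 = 0" "m12 0 = 0" "m21 0 = 0" "m22 0 = 0"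
  "m11 1 = 1" "m12 1 = 0" "m21 1 = 0" "m22 1 = 1"
  "m11 (A + B) = m11 A + m11 B" "m12 (A + B) = m12 A + m12 B"
  "m21 (A + B) = m21 A + m21 B" "m22 (A + B) = m22 A + m22 B"
  "m11 (- A) = - m11 A" "m12 (- A) = - m12 A" "m21 (- A) = - m21 A" "m22 (- A) = - m22 A"
  "m11 (A - B) = m11 A - m11 B" "m12 (A - B) = m12 A - m12 B"
  "m21 (A - B) = m21 A - m21 B" "m22 (A - B) = m22 A - m22 B"
  "m11 (A * B) = m11 A * m11 B + m12 A * m21 B" "m12 (A * B) = m11 A * m12 B + m12 A * m22 B"
  "m21 (A * B) = m21 A * m11 B + m22 A * m21 B" "m22 (A * B) = m21 A * m12 B + m22 A * m22 B"
  by (simp_all add: mat2_defs)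

text \<open>The variables \<open>p, r\<close> are \<open>fwd False\<close>, \<open>fwd True\<close> and \<open>q, s\<close> are \<open>bwd False\<close>, \<open>bwd True\<close>.
  The monomial \<open>p\<^sup>i r\<^sup>k q\<^sup>j s\<^sup>l\<close> is the pair of the multiset with \<open>i\<close> times \<open>False\<close> and \<open>k\<close> times \<open>True\<close> and the
  multiset with \<open>j\<close> times \<open>False\<close> and \<open>l\<close> times \<open>True\<close>.\<close>

type_synonym path_ring = "(bool multiset \<times> bool multiset) \<Rightarrow>\<^sub>0 complex"

definition fwd :: "bool \<Rightarrow> path_ring" where
  "fwd b = single ({#b#}, {#}) 1"

definition bwd :: "bool \<Rightarrow> path_ring" where
  "bwd b = single ({#}, {#b#}) 1"

definition graded :: "int \<Rightarrow> path_ring set" where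
  "graded d = {f. \<forall>k\<in>keys f. int (size (fst k)) - int (size (snd k)) = d}"

lemma graded_zero [simp]: "0 \<in> graded d"
  by (simp add: graded_def)

lemma graded_single: "int (size (fst k)) - int (size (snd k)) = d \<Longrightarrow> single k c \<in> graded d"
  by (auto simp: graded_def)

lemma graded_one [simp]: "1 \<in> graded 0"
  using graded_single[of 0 0 1] by simp

lemma graded_add: "f \<in> graded d \<Longrightarrow> g \<in> graded d \<Longrightarrow> f + g \<in> graded d"
  using keys_add[of f g] by (auto simp: graded_def)

lemma graded_uminus: "f \<in> graded d \<Longrightarrow> - f \<in> graded d"
  by (simp add: graded_def in_keys_iff)

lemma graded_diff: "f \<in> graded d \<Longrightarrow> g \<in> graded d \<Longrightarrow> f - g \<in> graded d"
  using graded_add[OF _ graded_uminus, of f d g] by simp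

lemma graded_mult':
  assumes "f \<in> graded d" "g \<in> graded e" "d + e = n"
  shows "f * g \<in> graded n"
proof -
  have "int (size (fst k)) - int (size (snd k)) = n" if k: "k \<in> keys (f * g)" for k
  proof -
    obtain a b where "k = a + b" "a \<in> keys f" "b \<in> keys g"
      using subsetD[OF keys_mult k] by auto
    then show ?thesis using assms by (auto simp: graded_def)
  qed
  then show ?thesis by (simp add: graded_def)
qed

lemma graded_fwd [simp]: "fwd b \<in> graded 1" and graded_bwd [simp]: "bwd b \<in> graded (- 1)"
  unfolding fwd_def bwd_def by (rule graded_single; simp)+

lemma graded_Int: "f \<in> graded d \<Longrightarrow> f \<in> graded e \<Longrightarrow> d \<noteq> e \<Longrightarrow> f = 0"
  by (metis (mono_tags, lifting) equals0I graded_def keys_eq_empty mem_Collect_eq)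

definition balanced :: "path_ring mat2 set" where
  "balanced = {A. m11 A \<in> graded 0 \<and> m12 A \<in> graded 1 \<and> m21 A \<in> graded (- 1) \<and> m22 A \<in> graded 0}"

lemma balanced_zero [simp]: "0 \<in> balanced" and balanced_one [simp]: "1 \<in> balanced"
  by (simp_all add: balanced_def)

lemma balanced_add: "A \<in> balanced \<Longrightarrow> B \<in> balanced \<Longrightarrow> A + B \<in> balanced"
  and balanced_diff: "A \<in> balanced \<Longrightarrow> B \<in> balanced \<Longrightarrow> A - B \<in> balanced"
  by (auto simp: balanced_def intro: graded_add graded_diff)

lemma balanced_uminus: "A \<in> balanced \<Longrightarrow> - A \<in> balanced"
  by (auto simp: balanced_def intro: graded_uminus)

lemma balanced_mult: "A \<in> balanced \<Longrightarrow> B \<in> balanced \<Longrightarrow> A * B \<in> balanced"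
  by (auto simp: balanced_def intro!: graded_add elim: graded_mult')

lemma graded_direct_sum:
  assumes "f \<in> graded d" "f' \<in> graded d" "g \<in> graded e" "g' \<in> graded e" "d \<noteq> e" "f + g = f' + g'"
  shows "f = f'"
proof -
  have "f - f' \<in> graded d" using assms(1,2) by (rule graded_diff)
  moreover have "f - f' = g' - g" using assms(6) by (simp add: algebra_simps)
  then have "f - f' \<in> graded e" using graded_diff[OF assms(4,3)] by (simp only:)
  ultimately have "f - f' = 0" using assms(5) by (rule graded_Int)
  then show ?thesis by simp
qed

lemma balanced_eqI:
  assumes "A \<in> balanced" "B \<in> balanced"
    "m11 A + m12 A = m11 B + m12 B" "m21 A + m22 A = m21 B + m22 B"
  shows "A = B"
proof -
  have g: "m11 A \<in> graded 0" "m11 B \<in> graded 0" "m12 A \<in> graded 1" "m12 B \<in> graded 1"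
    "m21 A \<in> graded (- 1)" "m21 B \<in> graded (- 1)" "m22 A \<in> graded 0" "m22 B \<in> graded 0"
    using assms(1,2) by (simp_all add: balanced_def)
  have "m11 A = m11 B" by (rule graded_direct_sum[OF g(1-4) _ assms(3)]) simp
  moreover have "m21 A = m21 B" by (rule graded_direct_sum[OF g(5-8) _ assms(4)]) simp
  ultimately show ?thesis using assms(3,4) by (intro mat2.expand) auto
qed

fun gen_mat :: "conifold_gen \<Rightarrow> path_ring mat2" where
  "gen_mat GX = Mat2 0 (fwd False) (bwd False) 0"
| "gen_mat GY = Mat2 0 (fwd True) (bwd True) 0"
| "gen_mat GZ = Mat2 1 0 0 (- 1)"

definition scal_mat :: "complex \<Rightarrow> path_ring mat2" where
  "scal_mat z = Mat2 (scal z) 0 0 (scal z)"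

lemma scal_mat_add: "scal_mat (x + y) = scal_mat x + scal_mat y"
  and scal_mat_mult: "scal_mat (x * y) = scal_mat x * scal_mat y"
  and scal_mat_commute: "scal_mat x * A = A * scal_mat x"
  by (simp_all add: scal_mat_def mat2_defs scal_add scal_mult mult.commute)

definition rep :: "conifold_gen free_algebra \<Rightarrow> path_ring mat2" where
  "rep = linear_ext scal_mat (\<lambda>w. prod_list (map gen_mat (letters w)))"

lemma rep_add: "rep (p + q) = rep p + rep q"
  unfolding rep_def by (rule linear_ext_add) (rule scal_mat_add)

lemma rep_zero: "rep 0 = 0"
  unfolding rep_def by (rule linear_ext_zero) (rule scal_mat_add)

lemma rep_diff: "rep (p - q) = rep p - rep q"
  using rep_add[of "p - q" q] by (simp add: algebra_simps)

lemma rep_single: "rep (single w z) = scal_mat z * prod_list (map gen_mat (letters w))"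
  unfolding rep_def by (rule linear_ext_single) (rule scal_mat_add)

lemma rep_mult: "rep (p * q) = rep p * rep q"
  unfolding rep_def
  by (rule linear_ext_mult, rule scal_mat_add, rule scal_mat_mult, rule scal_mat_commute)
    (simp add: plus_word_def)

lemma rep_scal: "rep (scal z) = scal_mat z"
  by (simp add: rep_single zero_word_def)

lemma rep_one: "rep 1 = 1"
  by (simp add: single_one[symmetric] rep_scal scal_mat_def one_mat2_def del: single_one)

lemma rep_gen: "rep (gen g) = gen_mat g"
  by (simp add: gen_def rep_single scal_mat_def single_one[symmetric] mat2_defs del: single_one)
    (simp add: single_one)

lemma gen_mat_balanced: "gen_mat g \<in> balanced"
  by (cases g) (simp_all add: balanced_def graded_uminus)

lemma rep_balanced: "rep p \<in> balanced"
proof (induction p rule: poly_mapping_induct)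
  case (single w z)
  have "prod_list (map gen_mat u) \<in> balanced" for u
    by (induction u) (auto intro: balanced_mult gen_mat_balanced)
  moreover have "scal_mat z \<in> balanced"
    by (simp add: scal_mat_def balanced_def graded_single)
  ultimately show ?case by (simp add: rep_single balanced_mult)
qed (auto simp: rep_zero rep_add intro: balanced_add)


section \<open>Rings given by types as rings with a carrier\<close>

lemma ring_ring_of_type_algebra: "ring (ring_of_type_algebra :: 'a::ring_1 ring)"
proof -
  have "\<exists>y. x + y = 0" for x :: 'a
    using add.right_inverse by blast
  then show ?thesis
    unfolding ring_of_type_algebra_def using add.right_inverse
    by unfold_locales (auto simp: algebra_simps Units_def)
qed

lemma ring_of_type_algebra_simps [simp]:
  "carrier ring_of_type_algebra = UNIV"
  "x \<otimes>\<^bsub>ring_of_type_algebra\<^esub> y = x * y" "\<one>\<^bsub>ring_of_type_algebra\<^esub> = 1"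
  "\<zero>\<^bsub>ring_of_type_algebra\<^esub> = 0" "x \<oplus>\<^bsub>ring_of_type_algebra\<^esub> y = x + y"
  by (simp_all add: ring_of_type_algebra_def)

subsection \<open>Words modulo the relations\<close>

definition rel_ideal :: "conifold_gen free_algebra set" where
  "rel_ideal = genideal ring_of_type_algebra conifold_relations"

lemma ideal_rel_ideal: "ideal rel_ideal ring_of_type_algebra"
  unfolding rel_ideal_def by (intro ring.genideal_ideal ring_ring_of_type_algebra) simp

lemma
  shows rel_ideal_rel: "r \<in> conifold_relations \<Longrightarrow> r \<in> rel_ideal"
    and rel_ideal_zero: "0 \<in> rel_ideal"
    and rel_ideal_add: "p \<in> rel_ideal \<Longrightarrow> q \<in> rel_ideal \<Longrightarrow> p + q \<in> rel_ideal"
    and rel_ideal_lmult: "p \<in> rel_ideal \<Longrightarrow> a * p \<in> rel_ideal"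
    and rel_ideal_rmult: "p \<in> rel_ideal \<Longrightarrow> p * a \<in> rel_ideal"
    and rel_ideal_uminus: "p \<in> rel_ideal \<Longrightarrow> - p \<in> rel_ideal"
proof -
  interpret I: ideal rel_ideal ring_of_type_algebra by (rule ideal_rel_ideal)
  show "r \<in> conifold_relations \<Longrightarrow> r \<in> rel_ideal"
    unfolding rel_ideal_def using I.genideal_self[of conifold_relations] by auto
  show "0 \<in> rel_ideal"
    using additive_subgroup.zero_closed[OF I.is_additive_subgroup] by simp
  show "p \<in> rel_ideal \<Longrightarrow> q \<in> rel_ideal \<Longrightarrow> p + q \<in> rel_ideal" 
    using additive_subgroup.a_closed[OF I.is_additive_subgroup] by simp
  show l: "p \<in> rel_ideal \<Longrightarrow> a * p \<in> rel_ideal" for a using I.I_l_closed by simp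
  show "p \<in> rel_ideal \<Longrightarrow> p * a \<in> rel_ideal" using I.I_r_closed by simp
  show "p \<in> rel_ideal \<Longrightarrow> - p \<in> rel_ideal" using l[of "- 1"] by simp
qed

definition congr :: "conifold_gen free_algebra \<Rightarrow> conifold_gen free_algebra \<Rightarrow> bool" (infix "\<asymp>" 50) where
  "p \<asymp> q \<longleftrightarrow> p - q \<in> rel_ideal"

lemma congr_refl [simp]: "p \<asymp> p"
  by (simp add: congr_def rel_ideal_zero)

lemma congr_sym: "p \<asymp> q \<Longrightarrow> q \<asymp> p"
  using rel_ideal_uminus[of "p - q"] by (simp add: congr_def)

lemma congr_trans [trans]: "p \<asymp> q \<Longrightarrow> q \<asymp> r \<Longrightarrow> p \<asymp> r"
  using rel_ideal_add[of "p - q" "q - r"] by (simp add: congr_def)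

lemma congr_add: "p \<asymp> q \<Longrightarrow> p' \<asymp> q' \<Longrightarrow> p + p' \<asymp> q + q'"
  using rel_ideal_add[of "p - q" "p' - q'"] by (simp add: congr_def algebra_simps)

lemma congr_lmult: "p \<asymp> q \<Longrightarrow> a * p \<asymp> a * q"
  using rel_ideal_lmult[of "p - q" a] by (simp add: congr_def algebra_simps)

lemma congr_rmult: "p \<asymp> q \<Longrightarrow> p * a \<asymp> q * a"
  using rel_ideal_rmult[of "p - q" a] by (simp add: congr_def algebra_simps)

lemma congr_relations:
  "gZ * gZ \<asymp> 1" "gX * gZ \<asymp> - (gZ * gX)" "gY * gZ \<asymp> - (gZ * gY)"
  "gX * gX * gY \<asymp> gY * (gX * gX)" "gY * gY * gX \<asymp> gX * (gY * gY)"
  unfolding congr_def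
  by (rule rel_ideal_rel; simp add: conifold_relations_def power2_eq_square)+

fun xy :: "bool \<Rightarrow> conifold_gen" where
  "xy False = GX"
| "xy True = GY"

definition wrd :: "bool list \<Rightarrow> conifold_gen free_algebra" where
  "wrd w = single (Word (map xy w)) 1"

lemma wrd_Nil: "wrd [] = 1"
  by (simp add: wrd_def zero_word_def[symmetric])

lemma wrd_Cons: "wrd (a # w) = gen (xy a) * wrd w"
  by (simp add: wrd_def gen_def mult_single plus_word_def)

lemma congr_wrd_Cons: "wrd u \<asymp> wrd v \<Longrightarrow> wrd (a # u) \<asymp> wrd (a # v)"
  unfolding wrd_Cons by (rule congr_lmult)

text \<open>If \<open>a\<close> and \<open>b\<close> differ, the middle letter equals one of them,
  and the claim is one of the two relations saying that a square commutes with the other letter. So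
  letters two places apart may be exchanged, and the parity of a position is all that is
  preserved.\<close>

lemma congr_swap: "wrd (a # c # b # w) \<asymp> wrd (b # c # a # w)"
proof -
  have "gen (xy a) * (gen (xy c) * gen (xy b)) \<asymp> gen (xy b) * (gen (xy c) * gen (xy a))"
    using congr_relations(4,5) congr_sym[OF congr_relations(4)] congr_sym[OF congr_relations(5)]
    by (cases a; cases b; cases c) (simp_all add: mult.assoc)
  from congr_rmult[OF this, of "wrd w"] show ?thesis by (simp add: wrd_Cons mult.assoc)
qed

text \<open>The length condition under which \<open>splice u v\<close> alternates to its end, with
  \<open>u\<close> in the odd and \<open>v\<close> in the even positions.\<close>

definition interleaves :: "'a list \<Rightarrow> 'a list \<Rightarrow> bool" where
  "interleaves u v \<longleftrightarrow> length u = length v \<or> length u = Suc (length v)"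

text \<open>A letter moves past \<open>u\<close> within the odd positions by one exchange at
  distance two for each letter of \<open>u\<close>.\<close>

lemma congr_splice_move:
  "interleaves (a # u @ u') v \<Longrightarrow> wrd (splice (a # u @ u') v) \<asymp> wrd (splice (u @ a # u') v)"
proof (induction u arbitrary: v)
  case (Cons b u)
  then obtain c v' where v: "v = c # v'" by (cases v) (auto simp: interleaves_def)
  have "wrd (splice (a # (b # u) @ u') v) \<asymp> wrd (b # c # splice (a # u @ u') v')"
    using congr_swap[of a c b] by (simp add: v)
  also have "\<dots> \<asymp> wrd (b # c # splice (u @ a # u') v')"
    using Cons by (intro congr_wrd_Cons) (simp add: interleaves_def v)
  finally show ?case by (simp add: v)
qed simp

text \<open>The odd positions are rearranged by moving the required first letter to the front and
  recursing on the rest. Only the first list is treated; the even positions become odd once another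
  letter is put in front.\<close>

lemma congr_splice_fst:
  "mset u = mset u' \<Longrightarrow> interleaves u v \<Longrightarrow> wrd (splice u v) \<asymp> wrd (splice u' v)"
proof (induction u' arbitrary: u v)
  case (Cons a p)
  then have "a \<in> set u" by (metis list.set_intros(1) set_mset_mset)
  then obtain u1 u2 where u: "u = u1 @ a # u2" by (meson split_list)
  have perm: "mset (u1 @ u2) = mset p" using Cons.prems by (simp add: u)
  have il: "interleaves (a # u1 @ u2) v" using Cons.prems by (simp add: interleaves_def u)
  have 1: "wrd (splice u v) \<asymp> wrd (splice (a # u1 @ u2) v)"
    unfolding u by (rule congr_sym[OF congr_splice_move[OF il]])
  show ?case
  proof (cases v)
    case Nil
    then have "u1 @ u2 = []" using il by (simp add: interleaves_def)
    then have "p = []" using perm by simp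
    then show ?thesis using 1 \<open>u1 @ u2 = []\<close> by simp
  next
    case (Cons c v')
    have "wrd (splice (u1 @ u2) v') \<asymp> wrd (splice p v')"
      using il by (intro Cons.IH perm) (simp add: interleaves_def Cons)
    then have "wrd (splice (a # u1 @ u2) v) \<asymp> wrd (splice (a # p) v)"
      by (simp add: Cons congr_wrd_Cons)
    with 1 show ?thesis by (rule congr_trans)
  qed
qed simp

text \<open>The components collect the letters in odd and in even positions. A new first letter
  shifts every position by one, hence the exchange of the components.\<close>

fun alternating :: "'a list \<Rightarrow> 'a multiset \<times> 'a multiset" where
  "alternating [] = ({#}, {#})"
| "alternating (a # w) = (add_mset a (snd (alternating w)), fst (alternating w))"

lemma alternating_size:
  "size (fst (alternating w)) = size (snd (alternating w)) \<or>
    size (fst (alternating w)) = Suc (size (snd (alternating w)))"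
  by (induction w) auto

lemma alternating_splice: "interleaves u v \<Longrightarrow> alternating (splice u v) = (mset u, mset v)"
  by (induction u v rule: splice.induct) (auto simp: interleaves_def)

definition std_word :: "bool multiset \<times> bool multiset \<Rightarrow> bool list" where
  "std_word k = splice (sorted_list_of_multiset (fst k)) (sorted_list_of_multiset (snd k))"

lemma length_sorted_list_of_multiset: "length (sorted_list_of_multiset M) = size M"
  by (metis mset_sorted_list_of_multiset size_mset)

lemma alternating_std_word:
  "size (fst k) = size (snd k) \<or> size (fst k) = Suc (size (snd k)) \<Longrightarrow> alternating (std_word k) = k"
  by (simp add: std_word_def alternating_splice interleaves_def length_sorted_list_of_multiset)

text \<open>By induction the tail is already sorted in both parities. Prepending \<open>a\<close>
  exchanges the two lists and leaves just the new first list to be sorted.\<close>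

lemma congr_std_word: "wrd w \<asymp> wrd (std_word (alternating w))"
proof (induction w)
  case Nil
  show ?case by (simp add: std_word_def)
next
  case (Cons a w)
  obtain M N where MN: "alternating w = (M, N)" by fastforce
  have sz: "size M = size N \<or> size M = Suc (size N)" using alternating_size[of w] by (simp add: MN)
  have "wrd (a # w) \<asymp> wrd (a # splice (sorted_list_of_multiset M) (sorted_list_of_multiset N))"
    using Cons by (intro congr_wrd_Cons) (simp add: MN std_word_def)
  also have "\<dots> = wrd (splice (a # sorted_list_of_multiset N) (sorted_list_of_multiset M))" by simp
  also have "\<dots> \<asymp> wrd (splice (sorted_list_of_multiset (add_mset a N)) (sorted_list_of_multiset M))"
    using sz by (intro congr_splice_fst) (auto simp: interleaves_def length_sorted_list_of_multiset)
  finally show ?case by (simp add: MN std_word_def)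
qed

text \<open>Left multiplication by \<open>X\<close> or \<open>Y\<close> turns the second row into
  the first, with a forward variable as factor, and the first into the second, with a backward
  variable. This is the exchange in the recursion of \<open>alternating\<close>, so each row sum is
  a single monomial.\<close>

lemma rep_wrd_rows:
  "m11 (rep (wrd w)) + m12 (rep (wrd w)) = single (alternating w) 1"
  "m21 (rep (wrd w)) + m22 (rep (wrd w)) = single (prod.swap (alternating w)) 1"
proof (induction w)
  case Nil
  show "m11 (rep (wrd [])) + m12 (rep (wrd [])) = single (alternating []) 1"
    "m21 (rep (wrd [])) + m22 (rep (wrd [])) = single (prod.swap (alternating [])) 1"
    using single_one[where ?'a = "bool multiset \<times> bool multiset" and ?'b = complex]
    by (simp_all add: wrd_Nil rep_one zero_prod_def)
next
  case (Cons a w)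
  obtain M N where MN: "alternating w = (M, N)" by fastforce
  have g: "gen_mat (xy a) = Mat2 0 (fwd a) (bwd a) 0" by (cases a) simp_all
  have "m11 (rep (wrd (a # w))) + m12 (rep (wrd (a # w))) = fwd a * (m21 (rep (wrd w)) + m22 (rep (wrd w)))"
    by (simp add: wrd_Cons rep_mult rep_gen g algebra_simps)
  then show "m11 (rep (wrd (a # w))) + m12 (rep (wrd (a # w))) = single (alternating (a # w)) 1"
    by (simp add: Cons MN fwd_def mult_single plus_prod_def)
  have "m21 (rep (wrd (a # w))) + m22 (rep (wrd (a # w))) = bwd a * (m11 (rep (wrd w)) + m12 (rep (wrd w)))"
    by (simp add: wrd_Cons rep_mult rep_gen g algebra_simps)
  then show "m21 (rep (wrd (a # w))) + m22 (rep (wrd (a # w))) =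
      single (prod.swap (alternating (a # w))) 1"
    by (simp add: Cons MN bwd_def mult_single plus_prod_def)
qed

section \<open>The two idempotents and the normal form of words\<close>

definition idem1 :: "conifold_gen free_algebra" where "idem1 = scal (1/2) * (1 + gZ)"
definition idem2 :: "conifold_gen free_algebra" where "idem2 = scal (1/2) * (1 - gZ)"

lemma scal_half: "scal (1/2) * x + scal (1/2) * x = x"
  by (simp add: distrib_right[symmetric] scal_add[symmetric])

lemma idem_sum: "idem1 + idem2 = 1"
  unfolding idem1_def idem2_def
  using scal_half[of 1] by (simp add: algebra_simps)

lemma rep_idem: "rep idem1 = Mat2 1 0 0 0" "rep idem2 = Mat2 0 0 0 1"
proof -
  have h: "scal (1/2) + scal (1/2) = (1 :: path_ring)"
    by (simp only: scal_add[symmetric]) simp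
  then have h2: "scal (1/2) * 2 = (1 :: path_ring)"
    by (simp add: mult_2_right)
  show "rep idem1 = Mat2 1 0 0 0" "rep idem2 = Mat2 0 0 0 1"
    by (simp_all add: idem1_def idem2_def rep_mult rep_add rep_diff rep_scal rep_one rep_gen
      scal_mat_def mat2_defs h h2 distrib_left)
qed

lemma idem_gZ: "idem1 * gZ \<asymp> idem1" "idem2 * gZ \<asymp> - idem2"
proof -
  have m: "gZ + gZ * gZ \<asymp> gZ + 1" "gZ - gZ * gZ \<asymp> gZ - 1"
    using congr_relations(1) rel_ideal_uminus[of "gZ * gZ - 1"] by (auto simp: congr_def)
  have "idem1 * gZ = scal (1/2) * (gZ + gZ * gZ)" "idem2 * gZ = scal (1/2) * (gZ - gZ * gZ)"
    by (simp_all add: idem1_def idem2_def mult.assoc distrib_right left_diff_distrib)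
  moreover have "idem1 = scal (1/2) * (gZ + 1)" "- idem2 = scal (1/2) * (gZ - 1)"
    by (simp_all add: idem1_def idem2_def distrib_left right_diff_distrib)
  ultimately show "idem1 * gZ \<asymp> idem1" "idem2 * gZ \<asymp> - idem2"
    using congr_lmult[OF m(1)] congr_lmult[OF m(2)] by metis+
qed

text \<open>\<open>X\<close> and \<open>Y\<close> anticommute with \<open>Z\<close>, so moving
  either of them across \<open>1 + Z\<close> produces \<open>1 - Z\<close> and conversely.\<close>

lemma idem_gen:
  assumes "g \<noteq> GZ"
  shows "idem1 * gen g \<asymp> gen g * idem2" "idem2 * gen g \<asymp> gen g * idem1"
proof -
  have "gen g * gZ + gZ * gen g \<in> rel_ideal"
    using assms by (cases g) (auto intro!: rel_ideal_rel simp: conifold_relations_def)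
  then have m: "gen g + gZ * gen g \<asymp> gen g - gen g * gZ" "gen g - gZ * gen g \<asymp> gen g + gen g * gZ"
    using rel_ideal_uminus[of "gen g * gZ + gZ * gen g"] by (simp_all add: congr_def algebra_simps)
  have sc: "gen g * (scal (1/2) * x) = scal (1/2) * (gen g * x)" for x
    by (metis mult.assoc scal_commute)
  have "idem1 * gen g = scal (1/2) * (gen g + gZ * gen g)" "idem2 * gen g = scal (1/2) * (gen g - gZ * gen g)"
    by (simp_all add: idem1_def idem2_def mult.assoc distrib_right left_diff_distrib)
  moreover have "gen g * idem2 = scal (1/2) * (gen g - gen g * gZ)" "gen g * idem1 = scal (1/2) * (gen g + gen g * gZ)"
    unfolding idem1_def idem2_def sc by (simp_all add: distrib_left right_diff_distrib)
  ultimately show "idem1 * gen g \<asymp> gen g * idem2" "idem2 * gen g \<asymp> gen g * idem1"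
    using congr_lmult[OF m(1)] congr_lmult[OF m(2)] by metis+
qed

text \<open>Letters \<open>Z\<close> are absorbed by the idempotents at the price of a sign, which
  depends on the idempotent; hence one word \<open>u\<close> but two scalars. The images under
  \<open>rep\<close> are recorded with the same \<open>u\<close>, \<open>s\<close> and
  \<open>t\<close>, so that the lift of \<open>rep p\<close> can be compared with
  \<open>p\<close>.\<close>

lemma word_normal_form:
  "\<exists>u s t. idem1 * single (Word w) 1 \<asymp> scal s * (idem1 * wrd u) \<and>
     idem2 * single (Word w) 1 \<asymp> scal t * (idem2 * wrd u) \<and>
     m11 (rep (single (Word w) 1)) + m12 (rep (single (Word w) 1)) =
       single (alternating u) s \<and>
     m21 (rep (single (Word w) 1)) + m22 (rep (single (Word w) 1)) =
       single (prod.swap (alternating u)) t"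
proof (induction w)
  case Nil
  have "single (Word []) 1 = wrd []" by (simp add: wrd_def)
  then show ?case
    using rep_wrd_rows[of "[]"] by (intro exI[of _ "[]"] exI[of _ 1]) simp
next
  case (Cons g w)
  define p where "p = (single (Word w) 1 :: conifold_gen free_algebra)"
  obtain u s t where IH: "idem1 * p \<asymp> scal s * (idem1 * wrd u)" "idem2 * p \<asymp> scal t * (idem2 * wrd u)"
      "m11 (rep p) + m12 (rep p) = single (alternating u) s"
      "m21 (rep p) + m22 (rep p) = single (prod.swap (alternating u)) t"
    using Cons unfolding p_def by blast
  have gp: "single (Word (g # w)) 1 = gen g * p"
    by (simp add: p_def gen_def mult_single plus_word_def)
  show ?case
  proof (cases "g = GZ")
    case True
    have "idem1 * (gen g * p) \<asymp> idem1 * p"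
      using congr_rmult[OF idem_gZ(1), of p] by (simp add: True mult.assoc)
    then have 1: "idem1 * (gen g * p) \<asymp> scal s * (idem1 * wrd u)"
      using IH(1) congr_trans by blast
    have "idem2 * (gen g * p) \<asymp> - (idem2 * p)"
      using congr_rmult[OF idem_gZ(2), of p] by (simp add: True mult.assoc)
    also have "- (idem2 * p) \<asymp> - (scal t * (idem2 * wrd u))"
      using congr_lmult[OF IH(2), of "- 1"] by simp
    finally have 2: "idem2 * (gen g * p) \<asymp> scal (- t) * (idem2 * wrd u)"
      by (simp add: single_uminus)
    have "m21 (rep (gen g * p)) + m22 (rep (gen g * p)) = - (m21 (rep p) + m22 (rep p))"
      by (simp add: True rep_mult rep_gen)
    then have 3: "m21 (rep (gen g * p)) + m22 (rep (gen g * p)) = single (prod.swap (alternating u)) (- t)"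
      by (simp add: IH(4) single_uminus)
    have 4: "m11 (rep (gen g * p)) + m12 (rep (gen g * p)) = single (alternating u) s"
      by (simp add: True rep_mult rep_gen IH(3))
    show ?thesis unfolding gp using 1 2 3 4 by blast
  next
    case False
    then obtain a where a: "g = xy a" by (metis conifold_gen.exhaust xy.simps)
    obtain M N where MN: "alternating u = (M, N)" by fastforce
    have gm: "gen_mat g = Mat2 0 (fwd a) (bwd a) 0" unfolding a by (cases a) simp_all
    have sc: "gen g * (scal z * x) = scal z * (gen g * x)" for z x
      by (metis mult.assoc scal_commute)
    have step: "e * (gen g * p) \<asymp> scal z * (e * wrd (a # u))"
      if "e * gen g \<asymp> gen g * e'" "e' * p \<asymp> scal z * (e' * wrd u)" for e e' z
    proof -
      have "e * (gen g * p) \<asymp> gen g * (e' * p)"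
        using congr_rmult[OF that(1), of p] by (simp add: mult.assoc)
      also have "\<dots> \<asymp> gen g * (scal z * (e' * wrd u))"
        by (rule congr_lmult[OF that(2)])
      also have "\<dots> = scal z * ((gen g * e') * wrd u)"
        by (simp add: sc mult.assoc)
      also have "\<dots> \<asymp> scal z * ((e * gen g) * wrd u)"
        by (intro congr_lmult congr_rmult congr_sym[OF that(1)])
      finally show ?thesis by (simp add: wrd_Cons a mult.assoc)
    qed
    \<comment> \<open>Passing \<open>gen g\<close> exchanges the idempotents, so \<open>s\<close>
      and \<open>t\<close> change places.\<close>
    have 1: "idem1 * (gen g * p) \<asymp> scal t * (idem1 * wrd (a # u))"
      by (rule step[OF idem_gen(1)[OF False] IH(2)])
    have 2: "idem2 * (gen g * p) \<asymp> scal s * (idem2 * wrd (a # u))"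
      by (rule step[OF idem_gen(2)[OF False] IH(1)])
    have "m11 (rep (gen g * p)) + m12 (rep (gen g * p)) = fwd a * (m21 (rep p) + m22 (rep p))"
      by (simp add: rep_mult rep_gen gm algebra_simps)
    then have 3: "m11 (rep (gen g * p)) + m12 (rep (gen g * p)) = single (alternating (a # u)) t"
      by (simp add: IH(4) MN fwd_def mult_single plus_prod_def)
    have "m21 (rep (gen g * p)) + m22 (rep (gen g * p)) = bwd a * (m11 (rep p) + m12 (rep p))"
      by (simp add: rep_mult rep_gen gm algebra_simps)
    then have 4: "m21 (rep (gen g * p)) + m22 (rep (gen g * p)) =
        single (prod.swap (alternating (a # u))) s"
      by (simp add: IH(3) MN bwd_def mult_single plus_prod_def)
    show ?thesis unfolding gp using 1 2 3 4 by blast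
  qed
qed

text \<open>The entries in one row of a balanced matrix have different degrees, so the row is determined by its
  sum; this gives a linear section of the representation.\<close>

definition path_lift :: "path_ring mat2 \<Rightarrow> conifold_gen free_algebra" where
  "path_lift A = idem1 * linear_ext scal (\<lambda>k. wrd (std_word k)) (m11 A + m12 A) +
    idem2 * linear_ext scal (\<lambda>k. wrd (std_word (prod.swap k))) (m21 A + m22 A)"

lemma path_lift_add: "path_lift (A + B) = path_lift A + path_lift B"
proof -
  have "m11 (A + B) + m12 (A + B) = (m11 A + m12 A) + (m11 B + m12 B)"
    "m21 (A + B) + m22 (A + B) = (m21 A + m22 A) + (m21 B + m22 B)"
    by (simp_all add: algebra_simps)
  then show ?thesis
    unfolding path_lift_def by (simp only: linear_ext_add[OF scal_add]) (simp add: algebra_simps)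
qed

lemma path_lift_scal: "path_lift (scal_mat z * A) = scal z * path_lift A"
proof -
  have "m11 (scal_mat z * A) + m12 (scal_mat z * A) = scal z * (m11 A + m12 A)"
    "m21 (scal_mat z * A) + m22 (scal_mat z * A) = scal z * (m21 A + m22 A)"
    by (simp_all add: scal_mat_def algebra_simps)
  moreover have "e * (scal z * x) = scal z * (e * x)" for e x :: "conifold_gen free_algebra"
    by (metis mult.assoc scal_commute)
  ultimately show ?thesis
    unfolding path_lift_def
    by (simp only: linear_ext_scale[OF scal_add scal_mult]) (simp add: algebra_simps)
qed

lemma path_lift_zero: "path_lift 0 = 0"
  by (simp add: path_lift_def linear_ext_zero[OF scal_add])

text \<open>Both sides are linear, so words suffice. There the row sums of the normal form are
  single monomials, whose standard words are congruent to \<open>u\<close>, and the two idempotents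
  add up to 1.\<close>

lemma path_lift_rep: "path_lift (rep p) \<asymp> p"
proof (induction p rule: poly_mapping_induct)
  case zero
  show ?case by (simp add: rep_zero path_lift_zero)
next
  case (add p q)
  then show ?case by (simp add: rep_add path_lift_add congr_add)
next
  case (single k z)
  obtain w where w: "k = Word w" by (cases k)
  define p where "p = (single (Word w) 1 :: conifold_gen free_algebra)"
  obtain u s t where u: "idem1 * p \<asymp> scal s * (idem1 * wrd u)" "idem2 * p \<asymp> scal t * (idem2 * wrd u)"
      "m11 (rep p) + m12 (rep p) = single (alternating u) s"
      "m21 (rep p) + m22 (rep p) = single (prod.swap (alternating u)) t"
    using word_normal_form[of w] unfolding p_def by blast
  have sc: "e * (scal z * x) = scal z * (e * x)" for e x :: "conifold_gen free_algebra" and z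
    by (metis mult.assoc scal_commute)
  have "path_lift (rep p) = scal s * (idem1 * wrd (std_word (alternating u))) +
      scal t * (idem2 * wrd (std_word (alternating u)))"
    by (simp add: path_lift_def u linear_ext_single[OF scal_add] sc)
  also have "\<dots> \<asymp> scal s * (idem1 * wrd u) + scal t * (idem2 * wrd u)"
    by (intro congr_add congr_lmult congr_sym[OF congr_std_word])
  also have "\<dots> \<asymp> idem1 * p + idem2 * p"
    by (intro congr_add congr_sym[OF u(1)] congr_sym[OF u(2)])
  also have "\<dots> = p" by (simp add: distrib_right[symmetric] idem_sum)
  finally have "scal z * path_lift (rep p) \<asymp> scal z * p" by (rule congr_lmult)
  moreover have "single k z = scal z * p"
    by (simp add: p_def w scal_mult_single)
  ultimately show ?case by (simp add: rep_mult rep_scal path_lift_scal)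
qed

text \<open>The relations hold for the matrices, so \<open>rep\<close> vanishes on
  \<open>rel_ideal\<close>. Conversely, if \<open>rep p\<close> is zero, then \<open>p\<close> is
  congruent to the lift of zero.\<close>

lemma rep_eq_zero_iff: "rep p = 0 \<longleftrightarrow> p \<in> rel_ideal"
proof
  show "p \<in> rel_ideal" if "rep p = 0"
    using path_lift_rep[of p] rel_ideal_uminus[of "- p"] by (simp add: that path_lift_zero congr_def)
  have K: "ideal {p. rep p = 0} ring_of_type_algebra"
  proof (rule idealI)
    show "ring (ring_of_type_algebra :: conifold_gen free_algebra ring)"
      by (rule ring_ring_of_type_algebra)
    then interpret F: ring "ring_of_type_algebra :: conifold_gen free_algebra ring" .
    have "\<ominus>\<^bsub>ring_of_type_algebra\<^esub> a = - a" for a :: "conifold_gen free_algebra"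
      by (rule F.minus_equality) auto
    then show "subgroup {p. rep p = 0} (add_monoid ring_of_type_algebra)"
      using rep_diff[of 0] by (intro F.add.subgroupI) (auto simp: rep_zero rep_add intro: exI[of _ 0])
  qed (auto simp: rep_mult)
  have "conifold_relations \<subseteq> {p. rep p = 0}"
    by (auto simp: conifold_relations_def rep_diff rep_add rep_mult rep_gen rep_one power2_eq_square mat2_defs mult_ac)
  then have "rel_ideal \<subseteq> {p. rep p = 0}"
    unfolding rel_ideal_def by (intro ring.genideal_minimal ring_ring_of_type_algebra K)
  then show "rep p = 0" if "p \<in> rel_ideal" using that by blast
qed

lemma rep_sum: "rep (sum h A) = (\<Sum>i\<in>A. rep (h i))"
  by (induction A rule: infinite_finite_induct) (simp_all add: rep_zero rep_add)

lemma mat2_sel_sum: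
  "m11 (sum h A) = (\<Sum>i\<in>A. m11 (h i))" "m12 (sum h A) = (\<Sum>i\<in>A. m12 (h i))"
  "m21 (sum h A) = (\<Sum>i\<in>A. m21 (h i))" "m22 (sum h A) = (\<Sum>i\<in>A. m22 (h i))"
  by (induction A rule: infinite_finite_induct; simp)+

text \<open>The degrees of the entries are what makes every monomial a word: in the first row the
  forward letters are as many as the backward ones or one more, in the second row the reverse.
  Exactly then \<open>alternating\<close> recovers the monomial from its standard word.\<close>

lemma rep_path_lift:
  assumes A: "A \<in> balanced"
  shows "rep (path_lift A) = A"
proof (rule balanced_eqI[OF rep_balanced A])
  have k1: "alternating (std_word k) = k" if "k \<in> keys (m11 A + m12 A)" for k
  proof (rule alternating_std_word)
    have "int (size (fst k)) - int (size (snd k)) = 0 \<or> int (size (fst k)) - int (size (snd k)) = 1"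
      using that A keys_add[of "m11 A" "m12 A"] by (auto simp: balanced_def graded_def)
    then show "size (fst k) = size (snd k) \<or> size (fst k) = Suc (size (snd k))" by linarith
  qed
  have k2: "prod.swap (alternating (std_word (prod.swap k))) = k" if "k \<in> keys (m21 A + m22 A)" for k
  proof -
    have "int (size (fst k)) - int (size (snd k)) = 0 \<or> int (size (fst k)) - int (size (snd k)) = - 1"
      using that A keys_add[of "m21 A" "m22 A"] by (auto simp: balanced_def graded_def)
    then have "size (snd k) = size (fst k) \<or> size (snd k) = Suc (size (fst k))" by linarith
    then show ?thesis by (simp add: alternating_std_word)
  qed
  have lin: "m11 (rep (linear_ext scal h f)) + m12 (rep (linear_ext scal h f)) =
        (\<Sum>k\<in>keys f. scal (lookup f k) * (m11 (rep (h k)) + m12 (rep (h k))))"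
      "m21 (rep (linear_ext scal h f)) + m22 (rep (linear_ext scal h f)) =
        (\<Sum>k\<in>keys f. scal (lookup f k) * (m21 (rep (h k)) + m22 (rep (h k))))"
    for h and f :: path_ring
    unfolding linear_ext_def
    by (simp_all add: rep_sum mat2_sel_sum rep_mult rep_scal scal_mat_def sum.distrib algebra_simps)
  define f where "f = m11 A + m12 A"
  define g where "g = m21 A + m22 A"
  have "m11 (rep (path_lift A)) + m12 (rep (path_lift A)) =
      m11 (rep (linear_ext scal (\<lambda>k. wrd (std_word k)) f)) + m12 (rep (linear_ext scal (\<lambda>k. wrd (std_word k)) f))"
    by (simp add: path_lift_def rep_add rep_mult rep_idem f_def)
  also have "\<dots> = (\<Sum>k\<in>keys f. single k (lookup f k))"
    unfolding lin by (intro sum.cong refl) (simp add: rep_wrd_rows scal_mult_single k1 f_def)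
  finally show "m11 (rep (path_lift A)) + m12 (rep (path_lift A)) = m11 A + m12 A"
    by (simp add: poly_mapping_sum_single f_def)
  have "m21 (rep (path_lift A)) + m22 (rep (path_lift A)) =
      m21 (rep (linear_ext scal (\<lambda>k. wrd (std_word (prod.swap k))) g)) +
      m22 (rep (linear_ext scal (\<lambda>k. wrd (std_word (prod.swap k))) g))"
    by (simp add: path_lift_def rep_add rep_mult rep_idem g_def)
  also have "\<dots> = (\<Sum>k\<in>keys g. single k (lookup g k))"
    unfolding lin by (intro sum.cong refl) (simp add: rep_wrd_rows scal_mult_single k2 g_def)
  finally show "m21 (rep (path_lift A)) + m22 (rep (path_lift A)) = m21 A + m22 A"
    by (simp add: poly_mapping_sum_single g_def)
qed

definition subalg :: "'a::ring_1 set \<Rightarrow> 'a ring" where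
  "subalg B = ring_of_type_algebra\<lparr>carrier := B\<rparr>"

lemma subalg_simps [simp]:
  "carrier (subalg B) = B" "x \<otimes>\<^bsub>subalg B\<^esub> y = x * y" "\<one>\<^bsub>subalg B\<^esub> = 1"
  "\<zero>\<^bsub>subalg B\<^esub> = 0" "x \<oplus>\<^bsub>subalg B\<^esub> y = x + y"
  by (simp_all add: subalg_def ring_of_type_algebra_def)

lemma range_rep: "range rep = balanced"
  using rep_balanced rep_path_lift by (auto intro: range_eqI[OF sym])

lemma ring_subalg_balanced: "ring (subalg balanced)"
proof -
  have "ring_hom_ring ring_of_type_algebra ring_of_type_algebra rep"
    by (intro ring_hom_ringI2 ring_ring_of_type_algebra ring_hom_memI)
      (auto simp: rep_mult rep_add rep_one)
  from ring_hom_ring.img_is_ring[OF this] show ?thesis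
    by (simp add: range_rep subalg_def)
qed

theorem conifold_algebra_iso: "\<exists>h. h \<in> ring_iso conifold_algebra (subalg balanced)"
proof -
  have "rep \<in> ring_hom ring_of_type_algebra (subalg balanced)"
    by (intro ring_hom_memI) (simp_all add: rep_mult rep_add rep_one rep_balanced)
  then have hom: "ring_hom_ring ring_of_type_algebra (subalg balanced) rep"
    by (intro ring_hom_ringI2 ring_ring_of_type_algebra ring_subalg_balanced)
  have ker: "a_kernel ring_of_type_algebra (subalg balanced) rep = rel_ideal"
    unfolding a_kernel_def' using rep_eq_zero_iff by simp
  have "rep ` carrier ring_of_type_algebra = carrier (subalg balanced)"
    by (simp add: range_rep)
  from ring_hom_ring.FactRing_iso_set[OF hom this] show ?thesis
    unfolding ker conifold_algebra_def rel_ideal_def[symmetric] by blast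
qed

section \<open>Contraction to the center\<close>

lemma cring_ring_center:
  fixes R (structure)
  assumes "ring R"
  shows "cring (ring_center R)"
proof -
  interpret ring R by (rule assms)
  define H where "H = {c \<in> carrier R. \<forall>a\<in>carrier R. c \<otimes> a = a \<otimes> c}"
  have "subcring H R"
  proof (rule subcringI)
    show "subring H R"
    proof (rule subringI)
      show "H \<subseteq> carrier R" "\<one> \<in> H" by (auto simp: H_def)
      show "\<ominus> h \<in> H" if "h \<in> H" for h
        using that by (auto simp: H_def l_minus r_minus)
      show "h1 \<otimes> h2 \<in> H" if h: "h1 \<in> H" "h2 \<in> H" for h1 h2
      proof -
        have c: "h1 \<in> carrier R" "h2 \<in> carrier R" using h by (simp_all add: H_def)
        have "h1 \<otimes> h2 \<otimes> a = a \<otimes> (h1 \<otimes> h2)" if a: "a \<in> carrier R" for a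
        proof -
          have "h1 \<otimes> h2 \<otimes> a = h1 \<otimes> (a \<otimes> h2)" using h(2) c a by (simp add: H_def m_assoc)
          also have "\<dots> = (h1 \<otimes> a) \<otimes> h2" using c a by (simp add: m_assoc)
          also have "\<dots> = a \<otimes> (h1 \<otimes> h2)" using h(1) c a by (simp add: H_def m_assoc)
          finally show ?thesis .
        qed
        then show ?thesis using c by (simp add: H_def)
      qed
      show "h1 \<oplus> h2 \<in> H" if "h1 \<in> H" "h2 \<in> H" for h1 h2
        using that by (auto simp: H_def l_distr r_distr)
    qed
    show "h1 \<otimes> h2 = h2 \<otimes> h1" if "h1 \<in> H" "h2 \<in> H" for h1 h2
      using that unfolding H_def by blast
  qed
  then show ?thesis
    unfolding ring_center_def H_def[symmetric] using subcring_iff[of H] unfolding H_def by blast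
qed

lemma ring_center_simps [simp]:
  "\<one>\<^bsub>ring_center R\<^esub> = \<one>\<^bsub>R\<^esub>" "\<zero>\<^bsub>ring_center R\<^esub> = \<zero>\<^bsub>R\<^esub>"
  "x \<otimes>\<^bsub>ring_center R\<^esub> y = x \<otimes>\<^bsub>R\<^esub> y" "x \<oplus>\<^bsub>ring_center R\<^esub> y = x \<oplus>\<^bsub>R\<^esub> y"
  by (simp_all add: ring_center_def)

lemma mem_ring_center:
  "c \<in> carrier (ring_center R) \<longleftrightarrow> c \<in> carrier R \<and> (\<forall>a\<in>carrier R. c \<otimes>\<^bsub>R\<^esub> a = a \<otimes>\<^bsub>R\<^esub> c)"
  by (simp add: ring_center_def)

lemma ring_center_commute:
  "c \<in> carrier (ring_center R) \<Longrightarrow> a \<in> carrier R \<Longrightarrow> c \<otimes>\<^bsub>R\<^esub> a = a \<otimes>\<^bsub>R\<^esub> c"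
  by (simp add: ring_center_def)

lemma ring_center_carrier: "c \<in> carrier (ring_center R) \<Longrightarrow> c \<in> carrier R"
  by (simp add: ring_center_def)

lemma center_inclusion_hom:
  assumes "ring R"
  shows "ring_hom_ring (ring_center R) R (\<lambda>x. x)"
  using assms cring.axioms(1)[OF cring_ring_center[OF assms]]
  by (intro ring_hom_ringI2 ring_hom_memI) (simp_all add: ring_center_carrier)

text \<open>For central \<open>a\<close>, the product \<open>a r b\<close> equals
  \<open>r (a b)\<close>. Two-sided primeness of \<open>P\<close> thus gives ordinary primeness on
  central elements.\<close>

lemma center_contraction_prime:
  assumes R: "ring R" and P: "P \<in> prime_spec R"
  shows "center_contraction R P \<in> prime_spec (ring_center R)"
proof -
  interpret R: ring R by (rule R)
  interpret Z: cring "ring_center R" by (rule cring_ring_center[OF R])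
  have idl: "ideal P R" and ne: "P \<noteq> carrier R"
    and pr: "\<And>a b. a \<in> carrier R \<Longrightarrow> b \<in> carrier R \<Longrightarrow>
      (\<And>r. r \<in> carrier R \<Longrightarrow> a \<otimes>\<^bsub>R\<^esub> r \<otimes>\<^bsub>R\<^esub> b \<in> P) \<Longrightarrow> a \<in> P \<or> b \<in> P"
    using P unfolding prime_spec_def two_sided_prime_def by blast+
  interpret P: ideal P R by (rule idl)
  have "ideal {r \<in> carrier (ring_center R). r \<in> P} (ring_center R)"
    using ring_hom_ring.ideal_vimage[OF center_inclusion_hom[OF R] idl] .
  then have "ideal (center_contraction R P) (ring_center R)"
    by (simp add: center_contraction_def Collect_conj_eq Int_commute)
  moreover have "\<one>\<^bsub>R\<^esub> \<notin> P" using P.one_imp_carrier ne by blast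
  then have "center_contraction R P \<noteq> carrier (ring_center R)"
    using Z.one_closed by (auto simp: center_contraction_def)
  moreover have "a \<in> center_contraction R P \<or> b \<in> center_contraction R P"
    if a: "a \<in> carrier (ring_center R)" and b: "b \<in> carrier (ring_center R)"
      and ab: "\<forall>r\<in>carrier (ring_center R). a \<otimes>\<^bsub>R\<^esub> r \<otimes>\<^bsub>R\<^esub> b \<in> center_contraction R P" for a b
  proof -
    have ac: "a \<in> carrier R" "b \<in> carrier R" using a b by (simp_all add: ring_center_carrier)
    have ab1: "a \<otimes>\<^bsub>R\<^esub> b \<in> P"
      using ab Z.one_closed ac by (auto simp: center_contraction_def)
    have "a \<otimes>\<^bsub>R\<^esub> r \<otimes>\<^bsub>R\<^esub> b \<in> P" if r: "r \<in> carrier R" for r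
    proof -
      have "a \<otimes>\<^bsub>R\<^esub> r \<otimes>\<^bsub>R\<^esub> b = r \<otimes>\<^bsub>R\<^esub> (a \<otimes>\<^bsub>R\<^esub> b)"
        using ring_center_commute[OF a r] ac r by (simp add: R.m_assoc)
      then show ?thesis using P.I_l_closed[OF ab1 r] by simp
    qed
    then show ?thesis using pr ac a b by (auto simp: center_contraction_def)
  qed
  ultimately show ?thesis
    by (simp add: prime_spec_def two_sided_prime_def)
qed

text \<open>A central ideal \<open>I\<close> lies in the contraction of \<open>P\<close> iff it lies
  in \<open>P\<close>, so the preimage of the open set of \<open>I\<close> is the open set of the
  two-sided ideal generated by \<open>I\<close>.\<close>

lemma continuous_center_contraction:
  assumes R: "ring R"
  shows "continuous_map (zariski R) (zariski (ring_center R)) (center_contraction R)"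
proof -
  interpret R: ring R by (rule R)
  have Z: "ring (ring_center R)" using cring_ring_center[OF R] by (rule cring.axioms(1))
  have "openin (zariski R) {P \<in> prime_spec R. center_contraction R P \<in> zariski_open (ring_center R) I}"
    if I: "ideal I (ring_center R)" for I
  proof -
    have Ic: "I \<subseteq> carrier (ring_center R)" using I by (meson additive_subgroup.a_subset ideal.axioms(1))
    then have IR: "I \<subseteq> carrier R"
      using ring_center_carrier[of _ R] by (rule subset_trans[OF _ subsetI])
    have "I \<subseteq> center_contraction R P \<longleftrightarrow> genideal R I \<subseteq> P" if "P \<in> prime_spec R" for P
    proof -
      have "ideal P R" using that by (simp add: prime_spec_def two_sided_prime_def)
      from R.Idl_subset_ideal[OF this IR] show ?thesis using Ic by (auto simp: center_contraction_def)
    qed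
    then have "{P \<in> prime_spec R. center_contraction R P \<in> zariski_open (ring_center R) I} =
        zariski_open R (genideal R I)"
      using center_contraction_prime[OF R] by (auto simp: zariski_open_def)
    then show ?thesis
      unfolding openin_zariski[OF R] using R.genideal_ideal[OF IR] by blast
  qed
  then show ?thesis
    unfolding continuous_map_def
    using center_contraction_prime[OF R]
    by (auto simp: topspace_zariski[OF R] topspace_zariski[OF Z] openin_zariski[OF Z])
qed

section \<open>Transport of ideals, primes and centers along ring isomorphisms\<close>

lemma ring_iso_ideal_image:
  assumes h: "h \<in> ring_iso R S" and R: "ring R" and S: "ring S" and I: "ideal I R"
  shows "ideal (h ` I) S"
proof -
  interpret R: ring R by (rule R)
  interpret S: ring S by (rule S)
  interpret I: ideal I R by (rule I)
  have bij: "bij_betw h (carrier R) (carrier S)" using h by (simp add: ring_iso_def)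
  define g where "g = inv_into (carrier R) h"
  have g: "g \<in> ring_iso S R" unfolding g_def by (rule ring_iso_set_sym[OF R h])
  then have "ring_hom_ring S R g"
    by (intro ring_hom_ringI2 R S) (simp add: ring_iso_def)
  from ring_hom_ring.ideal_vimage[OF this I]
  have "ideal {s \<in> carrier S. g s \<in> I} S" .
  moreover have "{s \<in> carrier S. g s \<in> I} = h ` I"
  proof (intro equalityI subsetI)
    fix s assume "s \<in> {s \<in> carrier S. g s \<in> I}"
    then show "s \<in> h ` I"
      using bij_betw_inv_into_right[OF bij, of s] unfolding g_def by force
  next
    fix s assume "s \<in> h ` I"
    then obtain r where r: "r \<in> I" "s = h r" by blast
    then have "r \<in> carrier R" using additive_subgroup.a_Hcarr[OF I.is_additive_subgroup] by blast
    then show "s \<in> {s \<in> carrier S. g s \<in> I}"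
      using r bij_betw_apply[OF bij] bij_betw_inv_into_left[OF bij] by (simp add: g_def)
  qed
  ultimately show ?thesis by simp
qed

lemma ring_iso_two_sided_prime_image:
  assumes h: "h \<in> ring_iso R S" and R: "ring R" and S: "ring S" and P: "two_sided_prime P R"
  shows "two_sided_prime (h ` P) S"
proof -
  have bij: "bij_betw h (carrier R) (carrier S)" and hom: "h \<in> ring_hom R S" using h by (simp_all add: ring_iso_def)
  have Pc: "P \<subseteq> carrier R"
    using P by (meson two_sided_prime_def additive_subgroup.a_subset ideal.axioms(1))
  have inj: "inj_on h (carrier R)" and img: "h ` carrier R = carrier S" using bij by (auto simp: bij_betw_def)
  have mem: "h x \<in> h ` P \<longleftrightarrow> x \<in> P" if "x \<in> carrier R" for x
    using inj_on_image_mem_iff[OF inj that Pc] .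
  show ?thesis
    unfolding two_sided_prime_def
  proof (intro conjI ballI impI)
    show "ideal (h ` P) S" using P by (intro ring_iso_ideal_image[OF h R S]) (simp add: two_sided_prime_def)
    show "h ` P \<noteq> carrier S"
      using P inj_on_image_eq_iff[OF inj Pc order_refl] by (simp add: two_sided_prime_def img)
    fix a b assume ab: "a \<in> carrier S" "b \<in> carrier S" "\<forall>r\<in>carrier S. a \<otimes>\<^bsub>S\<^esub> r \<otimes>\<^bsub>S\<^esub> b \<in> h ` P"
    obtain a' b' where a': "a' \<in> carrier R" "b' \<in> carrier R" "a = h a'" "b = h b'"
      using ab img by blast
    have "a' \<otimes>\<^bsub>R\<^esub> r \<otimes>\<^bsub>R\<^esub> b' \<in> P" if r: "r \<in> carrier R" for r
    proof -
      have "h (a' \<otimes>\<^bsub>R\<^esub> r \<otimes>\<^bsub>R\<^esub> b') = a \<otimes>\<^bsub>S\<^esub> h r \<otimes>\<^bsub>S\<^esub> b"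
        using a' r R by (simp add: ring_hom_mult[OF hom] monoid.m_closed[OF ring.is_monoid[OF R]])
      moreover have "h r \<in> carrier S" using img r by blast
      ultimately have "h (a' \<otimes>\<^bsub>R\<^esub> r \<otimes>\<^bsub>R\<^esub> b') \<in> h ` P" using ab(3) by simp
      then show ?thesis
        using mem a' r by (simp add: monoid.m_closed[OF ring.is_monoid[OF R]])
    qed
    then have "a' \<in> P \<or> b' \<in> P" using P a' unfolding two_sided_prime_def by blast
    then show "a \<in> h ` P \<or> b \<in> h ` P" using a' by blast
  qed
qed

lemma ring_iso_prime_spec:
  assumes h: "h \<in> ring_iso R S" and R: "ring R" and S: "ring S"
  shows "bij_betw ((`) h) (prime_spec R) (prime_spec S)"
proof -
  have bij: "bij_betw h (carrier R) (carrier S)" using h by (simp add: ring_iso_def)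
  have sub: "P \<subseteq> carrier R" if "P \<in> prime_spec R" for P R
    using that by (metis prime_spec_def mem_Collect_eq two_sided_prime_def additive_subgroup.a_subset ideal.axioms(1))
  define g where "g = inv_into (carrier R) h"
  have g: "g \<in> ring_iso S R" unfolding g_def by (rule ring_iso_set_sym[OF R h])
  show ?thesis
  proof (rule bij_betw_byWitness[where f' = "(`) g"])
    show "\<forall>P\<in>prime_spec R. g ` h ` P = P"
      unfolding g_def using bij sub by (metis bij_betw_imp_inj_on inv_into_image_cancel)
    show "\<forall>P\<in>prime_spec S. h ` g ` P = P"
      unfolding g_def using bij sub by (metis bij_betw_imp_surj_on image_inv_into_cancel)
    show "(`) h ` prime_spec R \<subseteq> prime_spec S"
      using ring_iso_two_sided_prime_image[OF h R S] by (auto simp: prime_spec_def)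
    show "(`) g ` prime_spec S \<subseteq> prime_spec R"
      using ring_iso_two_sided_prime_image[OF g S R] by (auto simp: prime_spec_def)
  qed
qed

lemma ring_iso_ring_center:
  assumes h: "h \<in> ring_iso R S" and R: "ring R"
  shows "h \<in> ring_iso (ring_center R) (ring_center S)"
    and "h ` carrier (ring_center R) = carrier (ring_center S)"
proof -
  have bij: "bij_betw h (carrier R) (carrier S)" and hom: "h \<in> ring_hom R S" using h by (simp_all add: ring_iso_def)
  then have inj: "inj_on h (carrier R)" and img: "h ` carrier R = carrier S" by (auto simp: bij_betw_def)
  have iff: "h c \<in> carrier (ring_center S) \<longleftrightarrow> c \<in> carrier (ring_center R)" if c: "c \<in> carrier R" for c
  proof -
    have "h c \<otimes>\<^bsub>S\<^esub> h a = h a \<otimes>\<^bsub>S\<^esub> h c \<longleftrightarrow> c \<otimes>\<^bsub>R\<^esub> a = a \<otimes>\<^bsub>R\<^esub> c" if a: "a \<in> carrier R" for a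
      using c a inj by (simp add: ring_hom_mult[OF hom, symmetric] inj_on_eq_iff monoid.m_closed[OF ring.is_monoid[OF R]])
    moreover have "h c \<in> carrier S" using c img by blast
    ultimately show ?thesis using c unfolding mem_ring_center img[symmetric] by auto
  qed
  have sub: "carrier (ring_center R) \<subseteq> carrier R" "carrier (ring_center S) \<subseteq> carrier S"
    by (rule subsetI, erule ring_center_carrier)+
  show im: "h ` carrier (ring_center R) = carrier (ring_center S)"
  proof
    show "h ` carrier (ring_center R) \<subseteq> carrier (ring_center S)" using iff sub by auto
    show "carrier (ring_center S) \<subseteq> h ` carrier (ring_center R)"
    proof
      fix s assume s: "s \<in> carrier (ring_center S)"
      then obtain r where "r \<in> carrier R" "s = h r" using sub img by blast
      then show "s \<in> h ` carrier (ring_center R)" using iff s by blast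
    qed
  qed
  have "h \<in> ring_hom (ring_center R) (ring_center S)"
    using im sub hom by (intro ring_hom_memI) (auto simp: ring_hom_mult ring_hom_add ring_hom_one subset_iff)
  moreover have "bij_betw h (carrier (ring_center R)) (carrier (ring_center S))"
    using im inj sub by (auto simp: bij_betw_def intro: inj_on_subset)
  ultimately show "h \<in> ring_iso (ring_center R) (ring_center S)" by (simp add: ring_iso_def)
qed

section \<open>The center as a cone\<close>

text \<open>As a type, the degree-zero part becomes an instance of \<open>comm_ring_1\<close>, which
  makes \<open>prime_set\<close>, \<open>regular_at\<close>, charts and the dimension argument
  applicable to it.\<close>

typedef cone = "graded 0"
  morphisms cone_val Abs_cone
  using graded_zero by blast

setup_lifting type_definition_cone

instantiation cone :: comm_ring_1
begin

lift_definition zero_cone :: cone is 0 by simp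
lift_definition one_cone :: cone is 1 by simp
lift_definition plus_cone :: "cone \<Rightarrow> cone \<Rightarrow> cone" is "(+)" by (rule graded_add)
lift_definition uminus_cone :: "cone \<Rightarrow> cone" is uminus by (rule graded_uminus)
lift_definition minus_cone :: "cone \<Rightarrow> cone \<Rightarrow> cone" is "(-)" by (rule graded_diff)
lift_definition times_cone :: "cone \<Rightarrow> cone \<Rightarrow> cone" is "(*)" by (rule graded_mult'[where d = 0 and e = 0]) simp_all

lemmas cone_val_simps [simp] =
  zero_cone.rep_eq one_cone.rep_eq plus_cone.rep_eq uminus_cone.rep_eq minus_cone.rep_eq times_cone.rep_eq

instance
  by standard (simp_all add: cone_val_inject[symmetric] algebra_simps)

end

lemma cone_val_graded [simp]: "cone_val r \<in> graded 0"
  by (rule cone_val)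

lemma cone_val_sum: "cone_val (sum h A) = (\<Sum>i\<in>A. cone_val (h i))"
  by (induction A rule: infinite_finite_induct) simp_all

definition diag :: "cone \<Rightarrow> path_ring mat2" where
  "diag r = Mat2 (cone_val r) 0 0 (cone_val r)"

lemma diag_add: "diag (r + s) = diag r + diag s"
  and diag_mult: "diag (r * s) = diag r * diag s"
  and diag_one: "diag 1 = 1"
  and diag_commute: "diag r * A = A * diag r"
  by (simp_all add: diag_def mat2_defs mult.commute)

lemma inj_diag: "inj diag"
  by (auto simp: inj_def diag_def cone_val_inject)

lemma diag_balanced [simp]: "diag r \<in> balanced"
  by (simp add: diag_def balanced_def)

text \<open>Multiplication by a monomial shifts the coefficients injectively, so they can be read
  off at \<open>k + l\<close>.\<close>

lemma single_mult_cancel: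
  fixes f :: path_ring
  assumes "single k 1 * f = single k 1 * g"
  shows "f = g"
proof (rule poly_mapping_eqI)
  fix l
  have *: "lookup (single k 1 * h) (k + l) = lookup h l" for h :: path_ring
    by (induction h rule: poly_mapping_induct) (auto simp: mult_single lookup_single lookup_add distrib_left when_def)
  show "lookup f l = lookup g l"
    using assms *[of f] *[of g] by simp
qed

definition E1 :: "path_ring mat2" where "E1 = Mat2 1 0 0 0"
definition E2 :: "path_ring mat2" where "E2 = Mat2 0 0 0 1"
definition fwd_mat :: "bool \<Rightarrow> path_ring mat2" where "fwd_mat b = Mat2 0 (fwd b) 0 0"
definition bwd_mat :: "bool \<Rightarrow> path_ring mat2" where "bwd_mat b = Mat2 0 0 (bwd b) 0"

lemma elementary_balanced [simp]:
  "E1 \<in> balanced" "E2 \<in> balanced" "fwd_mat b \<in> balanced" "bwd_mat b \<in> balanced"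
  by (simp_all add: balanced_def E1_def E2_def fwd_mat_def bwd_mat_def)

text \<open>Commuting with \<open>E1\<close> forces the off-diagonal entries to vanish, and
  commuting with one \<open>fwd_mat\<close> then forces the diagonal entries to agree after
  cancelling its variable.\<close>

lemma center_balanced: "carrier (ring_center (subalg balanced)) = range diag"
proof
  show "range diag \<subseteq> carrier (ring_center (subalg balanced))"
    by (auto simp: mem_ring_center diag_commute)
  show "carrier (ring_center (subalg balanced)) \<subseteq> range diag"
  proof
    fix A assume "A \<in> carrier (ring_center (subalg balanced))"
    then have A: "A \<in> balanced" and c: "\<And>B. B \<in> balanced \<Longrightarrow> A * B = B * A" by (auto simp: mem_ring_center)
    have "m12 (A * E1) = m12 (E1 * A)" "m21 (A * E1) = m21 (E1 * A)" using c[of E1] by simp_all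
    then have 0: "m12 A = 0" "m21 A = 0" by (simp_all add: E1_def)
    have "m12 (A * fwd_mat True) = m12 (fwd_mat True * A)" using c[of "fwd_mat True"] by simp
    then have "fwd True * m11 A = fwd True * m22 A" by (simp add: fwd_mat_def mult.commute)
    then have "m11 A = m22 A" unfolding fwd_def by (rule single_mult_cancel)
    moreover have "m11 A \<in> graded 0" using A by (simp add: balanced_def)
    ultimately have "A = diag (Abs_cone (m11 A))"
      using 0 by (intro mat2.expand) (simp add: diag_def Abs_cone_inverse)
    then show "A \<in> range diag" by blast
  qed
qed

lemma diag_iso: "diag \<in> ring_iso ring_of_type_algebra (ring_center (subalg balanced))"
  by (auto simp: ring_iso_def bij_betw_def center_balanced inj_diag diag_mult diag_add diag_one intro!: ring_hom_memI)

lemma ideal_ring_of_type_algebra_iff: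
  "ideal I (ring_of_type_algebra :: 'a::comm_ring_1 ring) \<longleftrightarrow> ideals.subspace I"
proof
  assume I: "ideal I (ring_of_type_algebra :: 'a ring)"
  show "ideals.subspace I"
    using additive_subgroup.zero_closed[OF ideal.axioms(1)[OF I]] additive_subgroup.a_closed[OF ideal.axioms(1)[OF I]]
      ideal.I_l_closed[OF I] by (intro ideals.subspaceI) auto
next
  assume I: "ideals.subspace I"
  interpret F: ring "ring_of_type_algebra :: 'a ring" by (rule ring_ring_of_type_algebra)
  have inv: "\<ominus>\<^bsub>ring_of_type_algebra\<^esub> a = - a" for a :: 'a
    by (rule F.minus_equality) auto
  show "ideal I (ring_of_type_algebra :: 'a ring)"
  proof (rule idealI)
    show "subgroup I (add_monoid ring_of_type_algebra)"
      using I by (intro F.add.subgroupI)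
        (auto simp: inv intro: ideals.subspace_0 ideals.subspace_add ideals.subspace_neg)
    show "x \<otimes>\<^bsub>ring_of_type_algebra\<^esub> a \<in> I" "a \<otimes>\<^bsub>ring_of_type_algebra\<^esub> x \<in> I" if "a \<in> I" for a x
      using ideals.subspace_scale[OF I that, of x] by (simp_all add: mult.commute)
  qed (rule F.ring_axioms)
qed

lemma prime_spec_ring_of_type_algebra:
  "prime_spec (ring_of_type_algebra :: 'a::comm_ring_1 ring) = {P. prime_set P}"
proof -
  have "P = UNIV \<longleftrightarrow> 1 \<in> P" if "ideals.subspace P" for P :: "'a set"
    using ideals.subspace_scale[OF that, of 1] by auto
  moreover have "(\<forall>r. a * r * b \<in> P) \<longleftrightarrow> a * b \<in> P" if "ideals.subspace P" for a b and P :: "'a set"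
  proof
    show "a * b \<in> P" if "\<forall>r. a * r * b \<in> P" using that[rule_format, of 1] by simp
    show "\<forall>r. a * r * b \<in> P" if "a * b \<in> P"
      using ideals.subspace_scale[OF \<open>ideals.subspace P\<close> that] by (auto simp: mult_ac)
  qed
  ultimately have "two_sided_prime P (ring_of_type_algebra :: 'a ring) \<longleftrightarrow> prime_set P" for P :: "'a set"
    by (cases "ideals.subspace P") (simp_all add: two_sided_prime_def prime_set_def ideal_ring_of_type_algebra_iff)
  then show ?thesis by (simp add: prime_spec_def)
qed

lemma center_primes: "bij_betw ((`) diag) {q. prime_set q} (prime_spec (ring_center (subalg balanced)))"
  using ring_iso_prime_spec[OF diag_iso ring_ring_of_type_algebra cring.axioms(1)[OF cring_ring_center[OF ring_subalg_balanced]]]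
  by (simp add: prime_spec_ring_of_type_algebra)

lemma ideal_balancedI:
  assumes "I \<subseteq> balanced" "0 \<in> I" "\<And>A B. A \<in> I \<Longrightarrow> B \<in> I \<Longrightarrow> A + B \<in> I"
    "\<And>A B. A \<in> I \<Longrightarrow> B \<in> balanced \<Longrightarrow> B * A \<in> I" "\<And>A B. A \<in> I \<Longrightarrow> B \<in> balanced \<Longrightarrow> A * B \<in> I"
  shows "ideal I (subalg balanced)"
proof -
  interpret L: ring "subalg balanced" by (rule ring_subalg_balanced)
  have inv: "\<ominus>\<^bsub>subalg balanced\<^esub> A = - A" if "A \<in> balanced" for A
    using that by (intro L.minus_equality) (auto intro: balanced_uminus)
  have "- A \<in> I" if "A \<in> I" for A
    using assms(4)[OF that balanced_uminus[OF balanced_one]] by simp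
  then show ?thesis
    using assms inv by (intro idealI L.ring_axioms L.add.subgroupI) auto
qed

lemma
  assumes "ideal I (subalg balanced)"
  shows ideal_balanced_subset: "I \<subseteq> balanced"
    and ideal_balanced_add: "A \<in> I \<Longrightarrow> B \<in> I \<Longrightarrow> A + B \<in> I"
    and ideal_balanced_lmult: "A \<in> I \<Longrightarrow> B \<in> balanced \<Longrightarrow> B * A \<in> I"
    and ideal_balanced_rmult: "A \<in> I \<Longrightarrow> B \<in> balanced \<Longrightarrow> A * B \<in> I"
    and ideal_balanced_diff: "A \<in> I \<Longrightarrow> B \<in> I \<Longrightarrow> A - B \<in> I"
proof -
  note s = ideal.axioms(1)[OF assms]
  show "I \<subseteq> balanced"
    using additive_subgroup.a_subset[OF s] by simp
  show add: "A \<in> I \<Longrightarrow> B \<in> I \<Longrightarrow> A + B \<in> I" for A B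
    using additive_subgroup.a_closed[OF s] by simp
  show l: "A \<in> I \<Longrightarrow> B \<in> balanced \<Longrightarrow> B * A \<in> I" for A B
    using ideal.I_l_closed[OF assms] by simp
  show "A \<in> I \<Longrightarrow> B \<in> balanced \<Longrightarrow> A * B \<in> I"
    using ideal.I_r_closed[OF assms] by simp
  show "A - B \<in> I" if "A \<in> I" "B \<in> I"
    using add[OF that(1) l[OF that(2) balanced_uminus[OF balanced_one]]] by simp
qed

section \<open>Primes of the matrix algebra\<close>

definition trace :: "path_ring mat2 \<Rightarrow> cone" where
  "trace A = Abs_cone (m11 A + m22 A)"

lemma cone_val_trace: "A \<in> balanced \<Longrightarrow> cone_val (trace A) = m11 A + m22 A"
  by (simp add: trace_def Abs_cone_inverse balanced_def graded_add)

lemma trace_add: "A \<in> balanced \<Longrightarrow> B \<in> balanced \<Longrightarrow> trace (A + B) = trace A + trace B"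
  by (simp add: cone_val_inject[symmetric] cone_val_trace balanced_add algebra_simps)

lemma trace_commute: "A \<in> balanced \<Longrightarrow> B \<in> balanced \<Longrightarrow> trace (A * B) = trace (B * A)"
  by (simp add: cone_val_inject[symmetric] cone_val_trace balanced_mult algebra_simps)

lemma trace_diag: "A \<in> balanced \<Longrightarrow> trace (diag r * A) = r * trace A"
  by (simp add: cone_val_inject[symmetric] cone_val_trace balanced_mult) (simp add: diag_def algebra_simps)

lemma trace_E1: "trace E1 = 1"
  by (simp add: cone_val_inject[symmetric] cone_val_trace E1_def balanced_def)

text \<open>In the notation of the paper these are \<open>x\<close>, \<open>y\<close> and \<open>z \<plusminus> D/2\<close>.\<close>

lift_definition edge :: "bool \<Rightarrow> bool \<Rightarrow> cone" is "\<lambda>b c. fwd b * bwd c"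
  by (rule graded_mult'[of _ 1 _ "- 1"]) simp_all

text \<open>For full matrices the scalar matrix of the trace of \<open>A\<close> is the sum of all
  \<open>E_ij A E_ji\<close>. The off-diagonal matrix units are not balanced;
  \<open>fwd_mat b\<close> and \<open>bwd_mat c\<close> replace them at the price of the factor
  \<open>edge b c\<close>.\<close>

lemma trace_expansion:
  assumes "A \<in> balanced"
  shows "diag (edge b c * trace A) =
    diag (edge b c) * (E1 * A * E1) + diag (edge b c) * (E2 * A * E2) + fwd_mat b * A * bwd_mat c + bwd_mat c * A * fwd_mat b"
  using assms
  by (intro mat2.expand)
    (simp add: diag_def E1_def E2_def fwd_mat_def bwd_mat_def cone_val_trace edge.rep_eq algebra_simps)

lemma cone_val_trace_elementary:
  assumes "A \<in> balanced"
  shows "cone_val (trace (E1 * A)) = m11 A" "cone_val (trace (E2 * A)) = m22 A"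
    "cone_val (trace (bwd_mat c * A)) = bwd c * m12 A" "cone_val (trace (fwd_mat b * A)) = fwd b * m21 A"
  using assms
  by (simp_all add: cone_val_trace balanced_mult) (simp_all add: E1_def E2_def fwd_mat_def bwd_mat_def)

text \<open>This is the expansion of \<open>A\<close> in dual bases of the trace pairing: the
  families \<open>E1, E2, bwd_mat c, fwd_mat b\<close> and
  \<open>f E1, f E2, fwd_mat b, bwd_mat c\<close>, with \<open>f = edge b c\<close>, are dual up to
  the factor \<open>f\<close>.\<close>

lemma dual_expansion:
  assumes "A \<in> balanced"
  shows "diag (edge b c) * A =
    diag (trace (E1 * A)) * (diag (edge b c) * E1) + diag (trace (E2 * A)) * (diag (edge b c) * E2) +
    diag (trace (bwd_mat c * A)) * fwd_mat b + diag (trace (fwd_mat b * A)) * bwd_mat c"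
  using assms
  by (intro mat2.expand)
    (simp add: diag_def cone_val_trace_elementary, simp add: E1_def E2_def fwd_mat_def bwd_mat_def edge.rep_eq algebra_simps)

text \<open>The radical of the trace pairing modulo \<open>q\<close>.\<close>

definition trace_prime :: "cone set \<Rightarrow> path_ring mat2 set" where
  "trace_prime q = {A \<in> balanced. \<forall>B\<in>balanced. trace (B * A) \<in> q}"

lemma trace_prime_contraction:
  assumes q: "prime_set q"
  shows "center_contraction (subalg balanced) (trace_prime q) = diag ` q"
proof -
  have "diag r \<in> trace_prime q \<longleftrightarrow> r \<in> q" for r
  proof
    assume "diag r \<in> trace_prime q"
    then have "trace (E1 * diag r) \<in> q" by (simp add: trace_prime_def)
    then show "r \<in> q" by (simp add: diag_commute[symmetric] trace_diag trace_E1)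
  next
    assume "r \<in> q"
    then show "diag r \<in> trace_prime q"
      using prime_set_mult[OF q]
      by (auto simp: trace_prime_def diag_commute[symmetric] trace_diag mult.commute[of r])
  qed
  then show ?thesis
    by (auto simp: center_contraction_def center_balanced)
qed

text \<open>If neither \<open>A\<close> nor \<open>B\<close> were in it, multiples \<open>M\<close>
  of \<open>A\<close> and \<open>N\<close> of \<open>B\<close> would have traces outside
  \<open>q\<close>. But \<open>f tr(M) tr(N)\<close> is a sum of traces of products
  \<open>U M V N\<close>, and a cyclic shift of each exhibits a product \<open>A r B\<close> inside,
  so it lies in \<open>q\<close>. As \<open>f\<close> is outside \<open>q\<close>, this is
  impossible.\<close>

lemma trace_prime_prime:
  assumes q: "prime_set q" and f: "edge b c \<notin> q"
  shows "two_sided_prime (trace_prime q) (subalg balanced)"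
  unfolding two_sided_prime_def
proof (intro conjI ballI impI)
  note m = balanced_mult
  show "ideal (trace_prime q) (subalg balanced)"
  proof (rule ideal_balancedI)
    have "trace 0 = 0" by (simp add: cone_val_inject[symmetric] cone_val_trace)
    then show "0 \<in> trace_prime q" using prime_set_zero[OF q] by (simp add: trace_prime_def)
    show "trace_prime q \<subseteq> balanced" by (auto simp: trace_prime_def)
    show "A + B \<in> trace_prime q" if "A \<in> trace_prime q" "B \<in> trace_prime q" for A B
      using that prime_set_add[OF q] by (auto simp: trace_prime_def distrib_left trace_add m balanced_add)
    show "B * A \<in> trace_prime q" if A: "A \<in> trace_prime q" and B: "B \<in> balanced" for A B
    proof -
      have "trace (C * (B * A)) \<in> q" if C: "C \<in> balanced" for C
        using A m[OF C B] by (simp add: trace_prime_def mult.assoc[symmetric])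
      then show ?thesis using A B by (simp add: trace_prime_def m)
    qed
    show "A * B \<in> trace_prime q" if A: "A \<in> trace_prime q" and B: "B \<in> balanced" for A B
    proof -
      have "trace (C * (A * B)) \<in> q" if C: "C \<in> balanced" for C
      proof -
        have Ab: "A \<in> balanced" using A by (simp add: trace_prime_def)
        have "trace (C * (A * B)) = trace (B * (C * A))"
          using trace_commute[of "C * A" B] Ab B C by (simp add: m mult.assoc)
        also have "\<dots> = trace ((B * C) * A)" by (simp add: mult.assoc)
        finally show ?thesis using A m[OF B C] by (simp add: trace_prime_def)
      qed
      then show ?thesis using A B by (simp add: trace_prime_def m)
    qed
  qed
  have "trace (E1 * 1) \<notin> q" using prime_set_one[OF q] by (simp add: trace_E1)
  then have "1 \<notin> trace_prime q" unfolding trace_prime_def using elementary_balanced(1) by blast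
  then show "trace_prime q \<noteq> carrier (subalg balanced)" by auto
  fix A B assume A: "A \<in> carrier (subalg balanced)" and B: "B \<in> carrier (subalg balanced)"
    and AB: "\<forall>r\<in>carrier (subalg balanced). A \<otimes>\<^bsub>subalg balanced\<^esub> r \<otimes>\<^bsub>subalg balanced\<^esub> B \<in> trace_prime q"
  show "A \<in> trace_prime q \<or> B \<in> trace_prime q"
  proof (rule ccontr)
    assume "\<not> ?thesis"
    then obtain C D where C: "C \<in> balanced" "trace (C * A) \<notin> q" and D: "D \<in> balanced" "trace (D * B) \<notin> q"
      using A B by (auto simp: trace_prime_def)
    define M where "M = C * A"
    define N where "N = B * D"
    have M: "M \<in> balanced" and N: "N \<in> balanced" using A B C D by (simp_all add: M_def N_def m)
    have tm: "trace (U * M * V * N) \<in> q" if U: "U \<in> balanced" and V: "V \<in> balanced" for U V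
    proof -
      have "trace (U * M * V * N) = trace ((U * C * A * V * B) * D)" by (simp add: M_def N_def mult.assoc)
      also have "\<dots> = trace (D * (U * C * A * V * B))"
        using U V A B C D by (intro trace_commute) (simp_all add: m)
      also have "\<dots> = trace ((D * U * C) * (A * V * B))" by (simp add: mult.assoc)
      finally show ?thesis using AB V m U C D by (simp add: trace_prime_def)
    qed
    have "edge b c * trace M * trace N = trace (diag (edge b c * trace M) * N)"
      using N by (simp add: trace_diag)
    also have "\<dots> = trace ((diag (edge b c) * E1) * M * E1 * N) + trace ((diag (edge b c) * E2) * M * E2 * N) +
        trace (fwd_mat b * M * bwd_mat c * N) + trace (bwd_mat c * M * fwd_mat b * N)"
      unfolding trace_expansion[OF M] distrib_right using M N
      by (simp add: trace_add m balanced_add mult.assoc)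
    also have "\<dots> \<in> q"
      by (intro prime_set_add[OF q] tm) (simp_all add: m)
    finally have "edge b c * trace M * trace N \<in> q" .
    moreover have "trace N \<notin> q"
      using D B trace_commute[of B D] by (simp add: N_def)
    ultimately show False using C f by (simp add: prime_set_mult_iff[OF q] M_def)
  qed
qed

text \<open>If \<open>A\<close> is in \<open>P\<close>, then \<open>trace_expansion\<close> puts
  \<open>f tr(B A)\<close> into \<open>P\<close> and hence \<open>tr(B A)\<close> into
  \<open>q\<close>. If all these traces are in \<open>q\<close>, then \<open>dual_expansion\<close>
  puts \<open>f A\<close> into \<open>P\<close>; as \<open>f\<close> is central,
  \<open>f r A\<close> is in \<open>P\<close> for every \<open>r\<close>, and \<open>f\<close> is
  not.\<close>

lemma prime_eq_trace_prime:
  assumes q: "prime_set q" and f: "edge b c \<notin> q"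
    and P: "two_sided_prime P (subalg balanced)" and Pq: "center_contraction (subalg balanced) P = diag ` q"
  shows "P = trace_prime q"
proof -
  note m = balanced_mult
  have idl: "ideal P (subalg balanced)" using P by (simp add: two_sided_prime_def)
  note I = ideal_balanced_subset[OF idl] ideal_balanced_add[OF idl] ideal_balanced_lmult[OF idl] ideal_balanced_rmult[OF idl]
  have diag_mem: "diag r \<in> P \<longleftrightarrow> r \<in> q" for r
  proof -
    have "diag r \<in> P \<longleftrightarrow> diag r \<in> diag ` q"
      unfolding Pq[symmetric] by (auto simp: center_contraction_def center_balanced)
    then show ?thesis using inj_diag by (auto simp: inj_image_mem_iff)
  qed
  show ?thesis
  proof (intro equalityI subsetI)
    fix A assume A: "A \<in> P"
    have "trace (B * A) \<in> q" if B: "B \<in> balanced" for B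
    proof -
      have X: "B * A \<in> P" using A B by (rule I(3))
      have t: "U * (B * A) * V \<in> P" if "U \<in> balanced" "V \<in> balanced" for U V
        using I(4)[OF I(3)[OF X that(1)] that(2)] .
      then have "diag (edge b c * trace (B * A)) \<in> P"
        unfolding trace_expansion[OF subsetD[OF I(1) X]] by (intro I(2) t I(3)[OF t]) simp_all
      then show ?thesis using f by (simp add: diag_mem prime_set_mult_iff[OF q])
    qed
    then show "A \<in> trace_prime q" using A I(1) by (auto simp: trace_prime_def)
  next
    fix A assume A: "A \<in> trace_prime q"
    then have Ab: "A \<in> balanced" and tr: "\<And>B. B \<in> balanced \<Longrightarrow> diag (trace (B * A)) \<in> P"
      by (auto simp: trace_prime_def diag_mem)
    have fA: "diag (edge b c) * A \<in> P"
      unfolding dual_expansion[OF Ab] by (intro I(2) I(4) tr) (simp_all add: m)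
    have "diag (edge b c) * r * A \<in> P" if "r \<in> balanced" for r
      using I(3)[OF fA that] by (simp add: diag_commute mult.assoc)
    then have "diag (edge b c) \<in> P \<or> A \<in> P"
      using P Ab unfolding two_sided_prime_def by simp
    then show "A \<in> P" using f by (simp add: diag_mem)
  qed
qed

text \<open>In the monoid of monomials a sum is 0 only if both summands are. The constant
  coefficient is therefore a ring homomorphism, the evaluation at the origin.\<close>

lemma lookup_mult_0:
  fixes f g :: path_ring
  shows "lookup (f * g) 0 = lookup f 0 * lookup g 0"
proof (induction f rule: poly_mapping_induct)
  case (single k x)
  show ?case
  proof (induction g rule: poly_mapping_induct)
    case (single l y)
    have "k + l = 0 \<longleftrightarrow> k = 0 \<and> l = 0"
      by (cases k; cases l) (auto simp: zero_prod_def)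
    then show ?case by (auto simp: mult_single lookup_single when_def)
  qed (simp_all add: distrib_left lookup_add)
qed (simp_all add: distrib_right lookup_add)

lemma graded_lookup_0: "f \<in> graded d \<Longrightarrow> d \<noteq> 0 \<Longrightarrow> lookup f 0 = 0"
proof (rule ccontr)
  assume "f \<in> graded d" "d \<noteq> 0" "lookup f 0 \<noteq> 0"
  then have "0 \<in> keys f" "\<forall>k\<in>keys f. int (size (fst k)) - int (size (snd k)) = d"
    by (simp_all add: graded_def in_keys_iff)
  then have "int (size (fst (0 :: bool multiset \<times> bool multiset))) - int (size (snd (0 :: bool multiset \<times> bool multiset))) = d"
    by blast
  then show False using \<open>d \<noteq> 0\<close> by simp
qed

definition const_coeff :: "cone \<Rightarrow> complex" where
  "const_coeff r = lookup (cone_val r) 0"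

lemma const_coeff_simps [simp]:
  "const_coeff 0 = 0" "const_coeff 1 = 1" "const_coeff (r + s) = const_coeff r + const_coeff s"
  "const_coeff (r * s) = const_coeff r * const_coeff s" "const_coeff (r - s) = const_coeff r - const_coeff s"
  by (simp_all add: const_coeff_def lookup_add lookup_minus lookup_mult_0)

definition vertex :: "cone set" where
  "vertex = {r. const_coeff r = 0}"

lemma prime_set_vertex: "prime_set vertex"
  by (rule prime_setI) (auto simp: vertex_def)

lemma edge_vertex: "edge b c \<in> vertex"
proof -
  have "lookup (fwd b) 0 = 0" by (simp add: fwd_def lookup_single zero_prod_def)
  then show ?thesis by (simp add: vertex_def const_coeff_def edge.rep_eq lookup_mult_0)
qed

definition cone_scal :: "complex \<Rightarrow> cone" where
  "cone_scal z = Abs_cone (scal z)"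

lemma cone_val_scal: "cone_val (cone_scal z) = scal z"
  by (simp add: cone_scal_def Abs_cone_inverse graded_single)

lemma const_coeff_scal [simp]: "const_coeff (cone_scal z) = z"
  by (simp add: const_coeff_def cone_val_scal)

lemma ring_morph_cone_scal: "ring_morph cone_scal"
  by (simp add: ring_morph_def cone_val_inject[symmetric] cone_val_scal scal_add scal_mult)

text \<open>A monomial of degree zero other than 1 contains a forward and a backward letter, and
  these two split off as an edge.\<close>

lemma vertex_generated:
  assumes q: "ideals.subspace q" and e: "\<And>b c. edge b c \<in> q"
  shows "vertex \<subseteq> q"
proof
  fix r assume r: "r \<in> vertex"
  define mono where "mono k = Abs_cone (single k (lookup (cone_val r) k))" for k
  have k: "size (fst k) = size (snd k)" "k \<noteq> 0" if "k \<in> keys (cone_val r)" for k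
  proof -
    show "size (fst k) = size (snd k)" using that cone_val_graded[of r] by (auto simp: graded_def)
    show "k \<noteq> 0" using that r by (auto simp: vertex_def const_coeff_def in_keys_iff)
  qed
  have mono: "cone_val (mono k) = single k (lookup (cone_val r) k)"
    if "k \<in> keys (cone_val r)" for k
    using k(1)[OF that] by (simp add: mono_def Abs_cone_inverse graded_single)
  have "mono k \<in> q" if kk: "k \<in> keys (cone_val r)" for k
  proof -
    obtain M N where MN: "k = (M, N)" by fastforce
    have sz: "size M = size N" "M \<noteq> {#} \<or> N \<noteq> {#}" using k[OF kk] by (auto simp: MN zero_prod_def)
    then have "M \<noteq> {#}" "N \<noteq> {#}" by auto
    then obtain b M' c N' where ab: "M = add_mset b M'" "N = add_mset c N'" by (meson multiset_cases)
    define s where "s = Abs_cone (single (M', N') (lookup (cone_val r) k))"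
    have "cone_val s = single (M', N') (lookup (cone_val r) k)"
      using sz by (simp add: s_def Abs_cone_inverse graded_single ab)
    then have "mono k = s * edge b c"
      unfolding cone_val_inject[symmetric] mono[OF kk]
      by (simp add: edge.rep_eq fwd_def bwd_def mult_single MN ab)
    then show ?thesis using ideals.subspace_scale[OF q e] by simp
  qed
  then have "(\<Sum>k\<in>keys (cone_val r). mono k) \<in> q"
    by (rule ideals.subspace_sum[OF q])
  also have "(\<Sum>k\<in>keys (cone_val r). mono k) = r"
    unfolding cone_val_inject[symmetric] cone_val_sum
    by (subst poly_mapping_sum_single[of "cone_val r", symmetric]) (intro sum.cong refl mono)
  finally show "r \<in> q" .
qed

text \<open>A prime containing all edges contains \<open>vertex\<close>. Together with the scalars
  \<open>vertex\<close> exhausts the ring, so a larger ideal would contain a nonzero scalar and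
  hence 1.\<close>

lemma prime_set_off_vertex:
  assumes q: "prime_set q" "q \<noteq> vertex"
  obtains b c where "edge b c \<notin> q"
proof (rule ccontr)
  assume "\<not> thesis"
  then have e: "edge b c \<in> q" for b c using that by blast
  have sub: "vertex \<subseteq> q" using q(1) e by (intro vertex_generated) (auto simp: prime_set_def)
  moreover have "q \<subseteq> vertex"
  proof
    fix r assume r: "r \<in> q"
    show "r \<in> vertex"
    proof (rule ccontr)
      assume n: "r \<notin> vertex"
      define z where "z = const_coeff r"
      have "r - cone_scal z \<in> vertex" by (simp add: vertex_def z_def)
      then have "r - (r - cone_scal z) \<in> q" using prime_set_diff[OF q(1) r] sub by blast
      then have "cone_scal (inverse z) * cone_scal z \<in> q" using prime_set_mult[OF q(1)] by simp
      moreover have "cone_scal (inverse z) * cone_scal z = 1"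
        using n ring_morph_mult[OF ring_morph_cone_scal, of "inverse z" z] ring_morph_1[OF ring_morph_cone_scal]
        by (simp add: z_def vertex_def)
      ultimately show False using prime_set_one[OF q(1)] by simp
    qed
  qed
  ultimately show False using q(2) by blast
qed

definition vertex_prime1 :: "path_ring mat2 set" where
  "vertex_prime1 = {A \<in> balanced. lookup (m11 A) 0 = 0}"
definition vertex_prime2 :: "path_ring mat2 set" where
  "vertex_prime2 = {A \<in> balanced. lookup (m22 A) 0 = 0}"

lemma balanced_lookup_0: "A \<in> balanced \<Longrightarrow> lookup (m12 A) 0 = 0" "A \<in> balanced \<Longrightarrow> lookup (m21 A) 0 = 0"
  by (auto simp: balanced_def intro: graded_lookup_0)

text \<open>The off-diagonal entries have nonzero degree and thus no constant term, so the constant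
  coefficient of either diagonal entry is multiplicative on balanced matrices. The two primes are
  the kernels of the resulting characters with values in the complex numbers.\<close>

lemma vertex_prime_prime:
  "two_sided_prime vertex_prime1 (subalg balanced)" "two_sided_prime vertex_prime2 (subalg balanced)"
proof -
  have p: "two_sided_prime {A \<in> balanced. ev A = 0} (subalg balanced)"
    if add: "\<And>A B. ev (A + B) = ev A + ev B" and one: "ev 1 = 1"
      and mult: "\<And>A B. A \<in> balanced \<Longrightarrow> B \<in> balanced \<Longrightarrow> ev (A * B) = ev A * ev B"
    for ev :: "path_ring mat2 \<Rightarrow> complex"
    unfolding two_sided_prime_def
  proof (intro conjI ballI impI)
    have "ev 0 = 0" using add[of 0 0] by simp
    then show "ideal {A \<in> balanced. ev A = 0} (subalg balanced)"
      by (intro ideal_balancedI) (auto simp: add mult balanced_add balanced_mult)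
    show "{A \<in> balanced. ev A = 0} \<noteq> carrier (subalg balanced)"
    proof -
      have "1 \<notin> {A \<in> balanced. ev A = 0}" "1 \<in> carrier (subalg balanced)" using one by simp_all
      then show ?thesis by blast
    qed
    show "A \<in> {A \<in> balanced. ev A = 0} \<or> B \<in> {A \<in> balanced. ev A = 0}"
      if "A \<in> carrier (subalg balanced)" "B \<in> carrier (subalg balanced)"
        "\<forall>r\<in>carrier (subalg balanced). A \<otimes>\<^bsub>subalg balanced\<^esub> r \<otimes>\<^bsub>subalg balanced\<^esub> B \<in> {A \<in> balanced. ev A = 0}" for A B
      using that(1,2) that(3)[rule_format, of 1] by (auto simp: mult)
  qed
  show "two_sided_prime vertex_prime1 (subalg balanced)" "two_sided_prime vertex_prime2 (subalg balanced)"
    unfolding vertex_prime1_def vertex_prime2_def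
    by (rule p; simp add: lookup_add lookup_mult_0 balanced_lookup_0)+
qed

lemma vertex_prime_contraction:
  "center_contraction (subalg balanced) vertex_prime1 = diag ` vertex"
  "center_contraction (subalg balanced) vertex_prime2 = diag ` vertex"
  by (auto simp: center_contraction_def center_balanced vertex_prime1_def vertex_prime2_def vertex_def
      const_coeff_def) (auto simp: diag_def)

lemma vertex_prime_distinct: "vertex_prime1 \<noteq> vertex_prime2"
proof -
  have "E1 \<in> vertex_prime2" "E1 \<notin> vertex_prime1"
    using elementary_balanced(1) by (simp_all add: vertex_prime1_def vertex_prime2_def E1_def)
  then show ?thesis by blast
qed

lemma prime_over_vertex:
  assumes P: "two_sided_prime P (subalg balanced)"
    and Pq: "center_contraction (subalg balanced) P = diag ` vertex"
  shows "P = vertex_prime1 \<or> P = vertex_prime2"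
proof -
  note m = balanced_mult
  have idl: "ideal P (subalg balanced)" using P by (simp add: two_sided_prime_def)
  note I = ideal_balanced_subset[OF idl] ideal_balanced_add[OF idl] ideal_balanced_lmult[OF idl] ideal_balanced_rmult[OF idl]
  have diag_mem: "diag r \<in> P \<longleftrightarrow> r \<in> vertex" for r
  proof -
    have "diag r \<in> P \<longleftrightarrow> diag r \<in> diag ` vertex"
      unfolding Pq[symmetric] by (auto simp: center_contraction_def center_balanced)
    then show ?thesis using inj_diag by (auto simp: inj_image_mem_iff)
  qed
  have pr: "A \<in> P \<or> B \<in> P" if "A \<in> balanced" "B \<in> balanced" "\<And>r. r \<in> balanced \<Longrightarrow> A * r * B \<in> P" for A B
    using P that unfolding two_sided_prime_def by simp
  define J where "J = {A \<in> balanced. lookup (m11 A) 0 = 0 \<and> lookup (m22 A) 0 = 0}"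
  have scal_in: "Mat2 f 0 0 f * A \<in> P" if "f \<in> graded 0" "lookup f 0 = 0" "A \<in> balanced" for f A
  proof -
    have "Mat2 f 0 0 f = diag (Abs_cone f)" using that by (simp add: diag_def Abs_cone_inverse)
    moreover have "Abs_cone f \<in> vertex" using that by (simp add: vertex_def const_coeff_def Abs_cone_inverse)
    ultimately show ?thesis using I(4) diag_mem that(3) by simp
  qed
  have JJ: "A * B \<in> P" if A: "A \<in> J" and B: "B \<in> J" for A B
  proof -
    have Ab: "A \<in> balanced" "B \<in> balanced" using A B by (auto simp: J_def)
    define s where "s f = Mat2 f 0 0 f" for f :: path_ring
    \<comment> \<open>Each summand carries a scalar matrix with entry in \<open>vertex\<close>, and
      such matrices lie in \<open>P\<close>. For the off-diagonal entries the scalar is the diagonal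
      entry occurring in each product.\<close>
    have "A * B = s (m11 (A * B)) * E1 + s (m11 A) * (E1 * B * E2) + s (m22 B) * (E1 * A * E2) +
        s (m22 A) * (E2 * B * E1) + s (m11 B) * (E2 * A * E1) + s (m22 (A * B)) * E2"
      by (intro mat2.expand) (simp add: s_def E1_def E2_def algebra_simps)
    also have "\<dots> \<in> P"
    proof -
      have g: "m11 (A * B) \<in> graded 0" "m22 (A * B) \<in> graded 0" "m11 A \<in> graded 0" "m22 A \<in> graded 0"
          "m11 B \<in> graded 0" "m22 B \<in> graded 0"
        using Ab m[OF Ab] by (simp_all add: balanced_def)
      have l: "lookup (m11 (A * B)) 0 = 0" "lookup (m22 (A * B)) 0 = 0"
          "lookup (m11 A) 0 = 0" "lookup (m22 A) 0 = 0"
          "lookup (m11 B) 0 = 0" "lookup (m22 B) 0 = 0"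
        using A B by (simp_all add: J_def lookup_add lookup_mult_0 balanced_lookup_0)
      show ?thesis
        unfolding s_def by (intro I(2) scal_in g l m elementary_balanced Ab)
    qed
    finally show ?thesis .
  qed
  \<comment> \<open>\<open>A r\<close> is again in \<open>J\<close>, so every \<open>A r A\<close>
    is in \<open>P\<close>; primeness applied to \<open>A\<close> twice gives \<open>A\<close>
    itself.\<close>
  have JP: "A \<in> P" if A: "A \<in> J" for A
  proof -
    have Ab: "A \<in> balanced" using A by (auto simp: J_def)
    have "A * r \<in> J" if r: "r \<in> balanced" for r
      using A r m[OF Ab r] by (simp add: J_def lookup_add lookup_mult_0 balanced_lookup_0[OF Ab] balanced_lookup_0[OF r])
    then show ?thesis using pr[OF Ab Ab] JJ[OF _ A] by blast
  qed
  have "E1 * r * E2 \<in> P" if "r \<in> balanced" for r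
  proof (rule JP)
    have "E1 * r * E2 \<in> balanced" using that by (simp add: m)
    then show "E1 * r * E2 \<in> J" by (simp add: J_def E1_def E2_def)
  qed
  then have E: "E1 \<in> P \<or> E2 \<in> P" by (intro pr) simp_all
  \<comment> \<open>The kernel of \<open>ev\<close> is complemented by the scalar matrices, and the
    only scalar of the form \<open>cone_scal z\<close> in \<open>vertex\<close> is zero. So
    \<open>P\<close> cannot be larger than the kernel it contains.\<close>
  have max: "P = {A \<in> balanced. ev A = 0}"
    if sub: "{A \<in> balanced. ev A = 0} \<subseteq> P" and ev: "\<And>A z. ev (A - diag (cone_scal z)) = ev A - z"
    for ev :: "path_ring mat2 \<Rightarrow> complex"
  proof (intro equalityI sub subsetI)
    fix A assume A: "A \<in> P"
    then have Ab: "A \<in> balanced" using I(1) by blast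
    then have "A - diag (cone_scal (ev A)) \<in> P"
      using sub by (auto simp: ev balanced_diff)
    then have "A - (A - diag (cone_scal (ev A))) \<in> P" by (rule ideal_balanced_diff[OF idl A])
    then have "cone_scal (ev A) \<in> vertex" by (simp add: diag_mem)
    then show "A \<in> {A \<in> balanced. ev A = 0}" using Ab by (simp add: vertex_def)
  qed
  show ?thesis
    using E
  proof
    assume e: "E1 \<in> P"
    have "A \<in> P" if "A \<in> balanced" "lookup (m22 A) 0 = 0" for A
    proof -
      have "A - A * E1 \<in> J" using that by (simp add: J_def balanced_diff m) (simp add: E1_def)
      from I(2)[OF JP[OF this] I(3)[OF e that(1)]] show ?thesis by simp
    qed
    then have "P = vertex_prime2"
      unfolding vertex_prime2_def by (intro max) (auto simp: diag_def cone_val_scal lookup_minus)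
    then show ?thesis ..
  next
    assume e: "E2 \<in> P"
    have "A \<in> P" if "A \<in> balanced" "lookup (m11 A) 0 = 0" for A
    proof -
      have "A - A * E2 \<in> J" using that by (simp add: J_def balanced_diff m) (simp add: E2_def)
      from I(2)[OF JP[OF this] I(3)[OF e that(1)]] show ?thesis by simp
    qed
    then have "P = vertex_prime1"
      unfolding vertex_prime1_def by (intro max) (auto simp: diag_def cone_val_scal lookup_minus)
    then show ?thesis ..
  qed
qed

section \<open>Monomials of the cone\<close>

lemma cone_induct [case_names mono add]:
  assumes mono: "\<And>r k z. size (fst k) = size (snd k) \<Longrightarrow> cone_val r = single k z \<Longrightarrow> P r"
    and add: "\<And>r s. P r \<Longrightarrow> P s \<Longrightarrow> P (r + s)"
  shows "P (r :: cone)"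
proof -
  define m where "m k = Abs_cone (single k (lookup (cone_val r) k))" for k
  have m: "cone_val (m k) = single k (lookup (cone_val r) k)"
      "size (fst k) = size (snd k)"
    if "k \<in> keys (cone_val r)" for k
  proof -
    show s: "size (fst k) = size (snd k)" using that cone_val_graded[of r] by (auto simp: graded_def)
    show "cone_val (m k) = single k (lookup (cone_val r) k)"
      using s by (simp add: m_def Abs_cone_inverse graded_single)
  qed
  have zero: "P 0" by (rule mono[of 0 _ 0]) simp_all
  have "P (\<Sum>k\<in>A. m k)" if "finite A" "A \<subseteq> keys (cone_val r)" for A
    using that
  proof (induction A rule: finite_induct)
    case (insert k A)
    then have "P (m k)" using m[of k] by (intro mono) auto
    then show ?case using insert add by simp
  qed (simp add: zero)
  from this[OF finite_keys order_refl] have "P (\<Sum>k\<in>keys (cone_val r). m k)" .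
  also have "(\<Sum>k\<in>keys (cone_val r). m k) = r"
    unfolding cone_val_inject[symmetric] cone_val_sum
    by (subst poly_mapping_sum_single[of "cone_val r", symmetric]) (intro sum.cong refl m)
  finally show ?thesis .
qed

lemma edge_val: "cone_val (edge b c) = single ({#b#}, {#c#}) 1"
  by (simp add: edge.rep_eq fwd_def bwd_def mult_single)

lemma edge_power_val:
  "cone_val (edge b c ^ n) = single (replicate_mset n b, replicate_mset n c) 1"
proof (induction n)
  case 0
  show ?case using single_one[where ?'a = "bool multiset \<times> bool multiset" and ?'b = complex]
    by (simp add: zero_prod_def)
next
  case (Suc n)
  then show ?case by (simp add: edge_val mult_single)
qed

lemma keys_multE:
  assumes "k \<in> keys (f * g)"
  obtains a b where "a \<in> keys f" "b \<in> keys g" "k = a + b"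
proof -
  have "k \<in> {a + b |a b. a \<in> keys f \<and> b \<in> keys g}"
    by (rule subsetD[OF keys_mult assms])
  then show thesis by (elim CollectE exE conjE) (rule that)
qed

lemma size_bool_multiset: "size M = count M b + count M (\<not> b)"
  by (induction M) auto

section \<open>Regularity away from the vertex\<close>

context
  fixes g :: "'a::comm_ring_1 \<Rightarrow> cone" and t :: cone and m :: "bool multiset \<times> bool multiset"
  assumes g: "ring_morph g" and t: "cone_val t = single m 1"
begin

lemma keys_t_mult: "k \<in> keys (cone_val (t * r)) \<Longrightarrow> \<exists>l\<in>keys (cone_val r). k = m + l"
  by (auto simp: t elim: keys_multE)

text \<open>Keeps track of a weight for which every value used so far is homogeneous of weight zero;
  it is what the injectivity argument needs for the next variable.\<close>

lemma poly_eval_keys: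
  fixes \<omega> :: "bool multiset \<times> bool multiset \<Rightarrow> nat"
  assumes \<omega>: "\<And>k l. \<omega> (k + l) = \<omega> k + \<omega> l" "\<omega> m = 0"
    and keys: "\<And>a k. k \<in> keys (cone_val (g a)) \<Longrightarrow> \<omega> k = 0"
  shows "k \<in> keys (cone_val (poly_eval g t p)) \<Longrightarrow> \<omega> k = 0"
proof (induction p arbitrary: k)
  case 0
  then show ?case by (simp add: poly_eval_0[OF g])
next
  case (pCons a p)
  have "k \<in> keys (cone_val (g a)) \<union> keys (cone_val (t * poly_eval g t p))"
    using pCons.prems keys_add[of "cone_val (g a)" "cone_val (t * poly_eval g t p)"]
    unfolding poly_eval_pCons[OF g] plus_cone.rep_eq by blast
  then show ?case
  proof
    show ?case if "k \<in> keys (cone_val (g a))" using keys[OF that] .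
    show ?case if k: "k \<in> keys (cone_val (t * poly_eval g t p))"
    proof -
      obtain l where l: "l \<in> keys (cone_val (poly_eval g t p))" "k = m + l"
        using keys_t_mult[OF k] by blast
      show ?thesis using pCons.IH[OF l(1)] by (simp add: l(2) \<omega>)
    qed
  qed
qed

text \<open>The constant term has weight zero and all the remaining terms have positive weight, so
  nothing cancels between them. Both parts vanish, the monomial \<open>t\<close> can be cancelled,
  and induction applies.\<close>

lemma poly_eval_inj:
  fixes \<omega> :: "bool multiset \<times> bool multiset \<Rightarrow> nat"
  assumes \<omega>: "\<And>k l. \<omega> (k + l) = \<omega> k + \<omega> l" "\<omega> m = 1"
    and keys: "\<And>a k. k \<in> keys (cone_val (g a)) \<Longrightarrow> \<omega> k = 0"
    and inj: "\<And>a. g a = 0 \<Longrightarrow> a = 0"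
  shows "poly_eval g t p = 0 \<Longrightarrow> p = 0"
proof (induction p)
  case (pCons a p)
  define r where "r = t * poly_eval g t p"
  have sum: "g a + r = 0" using pCons.prems by (simp add: poly_eval_pCons[OF g] r_def)
  have "keys (cone_val (g a)) = {}"
  proof (rule ccontr)
    assume "keys (cone_val (g a)) \<noteq> {}"
    then obtain k where k: "k \<in> keys (cone_val (g a))" by blast
    have "k \<notin> keys (cone_val r)"
    proof
      assume "k \<in> keys (cone_val r)"
      then obtain l where "k = m + l" unfolding r_def using keys_t_mult by blast
      then show False using keys[OF k] by (simp add: \<omega>)
    qed
    then have "lookup (cone_val (g a + r)) k \<noteq> 0"
      using k by (simp add: lookup_add in_keys_iff)
    then show False by (simp add: sum)
  qed
  then have ga: "g a = 0" by (simp add: cone_val_inject[symmetric])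
  then have "cone_val (t * poly_eval g t p) = 0" using sum by (simp add: r_def)
  then have "cone_val (poly_eval g t p) = 0"
    using single_mult_cancel[of m "cone_val (poly_eval g t p)" 0] by (simp add: t)
  then have "p = 0" using pCons.IH by (simp add: cone_val_inject[symmetric])
  then show ?case using inj[OF ga] by simp
qed simp

end

text \<open>Three edges suffice as variables: the product of \<open>edge b c\<close> with the
  opposite edge equals the product of the other two, so the fourth edge is available once
  \<open>edge b c\<close> is inverted.\<close>

definition chart :: "bool \<Rightarrow> bool \<Rightarrow> complex poly poly poly \<Rightarrow> cone" where
  "chart b c = poly_eval (poly_eval (poly_eval cone_scal (edge b c)) (edge b (\<not> c))) (edge (\<not> b) c)"

lemma ring_morph_chart: "ring_morph (chart b c)"
  unfolding chart_def by (intro ring_morph_poly_eval ring_morph_cone_scal)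

lemma chart_base: "chart b c [:[:[:0, 1:]:]:] = edge b c"
  unfolding chart_def
  by (simp add: poly_eval_const poly_eval_X ring_morph_poly_eval ring_morph_cone_scal)

text \<open>The three weights are triangular with respect to the variables: each one is 1 on its own
  edge and 0 on the edges adjoined before. So the variables are adjoined one by one, each
  independent of the previous ones.\<close>

lemma chart_kernel: "chart b c p = 0 \<Longrightarrow> p = 0"
proof -
  note m1 = ring_morph_poly_eval[OF ring_morph_cone_scal, of "edge b c"]
  note m2 = ring_morph_poly_eval[OF m1, of "edge b (\<not> c)"]
  define \<omega>0 \<omega>1 \<omega>2 :: "bool multiset \<times> bool multiset \<Rightarrow> nat"
    where "\<omega>0 k = count (fst k) b" and "\<omega>1 k = count (snd k) (\<not> c)" and "\<omega>2 k = count (fst k) (\<not> b)" for k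
  have add: "\<omega>0 (k + l) = \<omega>0 k + \<omega>0 l" "\<omega>1 (k + l) = \<omega>1 k + \<omega>1 l" "\<omega>2 (k + l) = \<omega>2 k + \<omega>2 l" for k l
    by (simp_all add: \<omega>0_def \<omega>1_def \<omega>2_def)
  have k0: "\<omega>0 k = 0" "\<omega>1 k = 0" "\<omega>2 k = 0" if "k \<in> keys (cone_val (cone_scal z))" for k z
    using that by (auto simp: cone_val_scal \<omega>0_def \<omega>1_def \<omega>2_def split: if_splits)
  have v: "\<omega>0 ({#b#}, {#c#}) = 1" "\<omega>1 ({#b#}, {#c#}) = 0" "\<omega>2 ({#b#}, {#c#}) = 0"
      "\<omega>1 ({#b#}, {#\<not> c#}) = 1" "\<omega>2 ({#b#}, {#\<not> c#}) = 0" "\<omega>2 ({#\<not> b#}, {#c#}) = 1"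
    by (simp_all add: \<omega>0_def \<omega>1_def \<omega>2_def)
  have i0: "z = 0" if "cone_scal z = 0" for z
    using that const_coeff_scal[of z] by simp
  have i1: "p = 0" if "poly_eval cone_scal (edge b c) p = 0" for p
    by (rule poly_eval_inj[where \<omega> = \<omega>0, OF ring_morph_cone_scal edge_val])
      (rule add v that | erule k0 i0)+
  have k1: "\<omega>1 k = 0" "\<omega>2 k = 0" if "k \<in> keys (cone_val (poly_eval cone_scal (edge b c) p))" for k p
    by (rule poly_eval_keys[where \<omega> = \<omega>1, OF ring_morph_cone_scal edge_val], (rule add v that | erule k0)+)
      (rule poly_eval_keys[where \<omega> = \<omega>2, OF ring_morph_cone_scal edge_val], (rule add v that | erule k0)+)
  have i2: "p = 0" if "poly_eval (poly_eval cone_scal (edge b c)) (edge b (\<not> c)) p = 0" for p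
    by (rule poly_eval_inj[where \<omega> = \<omega>1, OF m1 edge_val]) (rule add v that | erule k1 i1)+
  have k2: "\<omega>2 k = 0"
    if "k \<in> keys (cone_val (poly_eval (poly_eval cone_scal (edge b c)) (edge b (\<not> c)) p))" for k p
    by (rule poly_eval_keys[where \<omega> = \<omega>2, OF m1 edge_val]) (rule add v that | erule k1)+
  show "p = 0" if "chart b c p = 0"
    by (rule poly_eval_inj[where \<omega> = \<omega>2, OF m2 edge_val])
      (rule add v that[unfolded chart_def] | erule k2 i2)+
qed

lemma chart_surj: "\<exists>k y. chart b c [:[:[:0, 1:]:]:] ^ k * r = chart b c y"
  unfolding chart_base
proof (induction r rule: cone_induct)
  case (mono r e z)
  define M N where "M = fst e" and "N = snd e"
  have e: "e = (M, N)" and sz: "size M = size N" using mono(1) by (simp_all add: M_def N_def)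
  \<comment> \<open>Multiply the monomial by \<open>edge b c\<close> to the power
    \<open>count M (\<not> b)\<close>. Every forward letter \<open>\<not> b\<close> can then be
    paired with a new backward \<open>c\<close>, and all original backward letters are paired with
    forward letters \<open>b\<close>; their number fits because \<open>M\<close> and
    \<open>N\<close> have the same size. No opposite edge remains.\<close>
  define y where "y = [:[:[:z:]:]:] * [:[:[:0, 1:]:]:] ^ count N c * [:[:0, 1:]:] ^ count N (\<not> c) *
    [:0, 1:] ^ count M (\<not> b)"
  have y: "chart b c y = cone_scal z * edge b c ^ count N c * edge b (\<not> c) ^ count N (\<not> c) *
      edge (\<not> b) c ^ count M (\<not> b)"
  proof -
    have "chart b c [:[:[:z:]:]:] = cone_scal z" "chart b c [:[:[:0, 1:]:]:] = edge b c"
        "chart b c [:[:0, 1:]:] = edge b (\<not> c)" "chart b c [:0, 1:] = edge (\<not> b) c"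
      unfolding chart_def
      by (simp_all add: poly_eval_const poly_eval_X ring_morph_poly_eval ring_morph_cone_scal)
    then show ?thesis
      unfolding y_def by (simp only: ring_morph_mult[OF ring_morph_chart] ring_morph_power[OF ring_morph_chart])
  qed
  have exps: "replicate_mset (count M (\<not> b)) b + M = replicate_mset (count N c) b +
        replicate_mset (count N (\<not> c)) b + replicate_mset (count M (\<not> b)) (\<not> b)"
      "replicate_mset (count M (\<not> b)) c + N = replicate_mset (count N c) c +
        replicate_mset (count N (\<not> c)) (\<not> c) + replicate_mset (count M (\<not> b)) c"
  proof -
    have s: "count M b + count M (\<not> b) = count N c + count N (\<not> c)"
      using sz size_bool_multiset[of M b] size_bool_multiset[of N c] by simp
    show "replicate_mset (count M (\<not> b)) b + M = replicate_mset (count N c) b +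
        replicate_mset (count N (\<not> c)) b + replicate_mset (count M (\<not> b)) (\<not> b)"
      by (rule multiset_eqI, rename_tac a, case_tac "a = b") (use s in auto)
    show "replicate_mset (count M (\<not> b)) c + N = replicate_mset (count N c) c +
        replicate_mset (count N (\<not> c)) (\<not> c) + replicate_mset (count M (\<not> b)) c"
      by (rule multiset_eqI, rename_tac a, case_tac "a = c") auto
  qed
  have "edge b c ^ count M (\<not> b) * r = chart b c y"
    unfolding cone_val_inject[symmetric] y times_cone.rep_eq edge_power_val cone_val_scal mono(2) e
    by (simp add: mult_single exps)
  then show ?case by blast
next
  case (add r s)
  then obtain k y l z where h: "edge b c ^ k * r = chart b c y" "edge b c ^ l * s = chart b c z" by blast
  define f0 where "f0 = ([:[:[:0, 1:]:]:] :: complex poly poly poly)"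
  have "edge b c ^ (k + l) * (r + s) = edge b c ^ l * (edge b c ^ k * r) + edge b c ^ k * (edge b c ^ l * s)"
    by (simp add: power_add algebra_simps)
  also have "\<dots> = chart b c (f0 ^ l * y + f0 ^ k * z)"
    unfolding h by (simp only: ring_morph_mult[OF ring_morph_chart] ring_morph_power[OF ring_morph_chart]
      ring_morph_add[OF ring_morph_chart] chart_base f0_def)
  finally show ?case by blast
qed

theorem regular_at_off_vertex:
  assumes q: "prime_set q" "q \<noteq> vertex"
  shows "regular_at q"
proof -
  obtain b c where "edge b c \<notin> q" using prime_set_off_vertex[OF q] .
  then have f: "chart b c [:[:[:0, 1:]:]:] \<notin> q" by (simp add: chart_base)
  have "regular_at Q" if "prime_set Q" for Q :: "complex poly poly poly set"
    using that by (intro regular_at_poly[OF regular_at_poly[OF regular_at_poly[OF regular_at_field]]])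
  then show ?thesis
    by (intro regular_at_chart[OF ring_morph_chart _ _ _ q(1) f]) (rule chart_surj | erule chart_kernel | blast)+
qed

theorem noetherian_off_vertex:
  assumes q: "prime_set q" "q \<noteq> vertex" and J: "ideals.subspace J"
  shows "\<exists>G. finite G \<and> G \<subseteq> J \<and> generates_at q G J"
proof -
  obtain b c where "edge b c \<notin> q" using prime_set_off_vertex[OF q] .
  then have f: "chart b c [:[:[:0, 1:]:]:] \<notin> q" by (simp add: chart_base)
  have "fin_gen K" if "ideals.subspace K" for K :: "complex poly poly poly set"
    using that by (intro Hilbert_basis[OF Hilbert_basis[OF Hilbert_basis[OF fin_gen_field]]])
  then show ?thesis
    by (intro noetherian_at_chart[OF ring_morph_chart _ _ _ q(1) f J]) (rule chart_surj | erule chart_kernel | blast)+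
qed

section \<open>The dimension of the cone\<close>

definition height_le :: "nat \<Rightarrow> cone \<Rightarrow> bool" where
  "height_le n r \<longleftrightarrow> (\<forall>k\<in>keys (cone_val r). size (fst k) \<le> n)"

lemma height_le_mono: "height_le n r \<Longrightarrow> n \<le> n' \<Longrightarrow> height_le n' r"
  by (auto simp: height_le_def)

lemma height_le_mult: "height_le n r \<Longrightarrow> height_le n' s \<Longrightarrow> height_le (n + n') (r * s)"
  unfolding height_le_def
proof
  fix k assume h: "\<forall>k\<in>keys (cone_val r). size (fst k) \<le> n"
      "\<forall>k\<in>keys (cone_val s). size (fst k) \<le> n'"
    and k: "k \<in> keys (cone_val (r * s))"
  from k obtain a b where "a \<in> keys (cone_val r)" "b \<in> keys (cone_val s)" "k = a + b"
    unfolding times_cone.rep_eq by (rule keys_multE)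
  then show "size (fst k) \<le> n + n'" using h by (auto intro!: add_mono)
qed

lemma height_le_power: "height_le n r \<Longrightarrow> height_le (i * n) (r ^ i)"
proof (induction i)
  case 0
  show ?case by (simp add: height_le_def)
next
  case (Suc i)
  then show ?case using height_le_mult[of n r "i * n" "r ^ i"] by simp
qed

lemma height_le_exists: "\<exists>n. height_le n r"
  unfolding height_le_def
  by (rule exI[of _ "Max ((\<lambda>k. size (fst k)) ` keys (cone_val r))"]) auto

text \<open>A balanced monomial is determined by three numbers, the common size of its halves and
  the number of \<open>True\<close> letters in each. This is where the dimension 3 comes
  from.\<close>

lemma card_balanced_monomials:
  fixes n
  defines "K \<equiv> {k :: bool multiset \<times> bool multiset. size (fst k) = size (snd k) \<and> size (fst k) \<le> n}"
  shows "finite K" "card K \<le> (n + 1) ^ 3"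
proof -
  define e where "e k = (count (fst k) True, size (fst k), count (snd k) True)" for k :: "bool multiset \<times> bool multiset"
  have inj: "inj_on e K"
  proof (rule inj_onI)
    fix k l assume k: "k \<in> K" and l: "l \<in> K" and kl: "e k = e l"
    have c: "count (fst k) True = count (fst l) True" "size (fst k) = size (fst l)" "count (snd k) True = count (snd l) True"
      using kl by (auto simp: e_def)
    then have "count (fst k) False = count (fst l) False" "count (snd k) False = count (snd l) False"
      using size_bool_multiset[of "fst k" True] size_bool_multiset[of "fst l" True]
        size_bool_multiset[of "snd k" True] size_bool_multiset[of "snd l" True] k l by (auto simp: K_def)
    then have "count (fst k) a = count (fst l) a" "count (snd k) a = count (snd l) a" for a
      using c by (cases a; simp)+
    then show "k = l" by (intro prod_eqI multiset_eqI)
  qed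
  have sub: "e ` K \<subseteq> {..n} \<times> {..n} \<times> {..n}"
  proof
    fix x assume "x \<in> e ` K"
    then obtain k where k: "k \<in> K" "x = e k" by blast
    then show "x \<in> {..n} \<times> {..n} \<times> {..n}"
      using count_le_size[of "fst k" True] count_le_size[of "snd k" True] by (auto simp: K_def e_def)
  qed
  show "finite K" by (rule inj_on_finite[OF inj sub]) simp
  have "card K \<le> card ({..n} \<times> {..n} \<times> {..n})" by (rule card_inj_on_le[OF inj sub]) simp
  also have "\<dots> = (n + 1) ^ 3"
    by (simp only: card_cartesian_product card_atMost power3_eq_cube Suc_eq_plus1 mult.assoc)
  finally show "card K \<le> (n + 1) ^ 3" .
qed

lemma coeff_sum_monom: "coeff (\<Sum>i<n. monom (a i) i) k = (if k < n then a k else 0)"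
  by (simp add: coeff_sum sum.delta)

lemma poly_eval_sum_monom:
  "ring_morph f \<Longrightarrow> poly_eval f t (\<Sum>i<n. monom (a i) i) = (\<Sum>i<n. f (a i) * t ^ i)"
  by (simp add: ring_morph_sum[OF ring_morph_poly_eval] poly_eval_monom)

lemma lookup_scal_mult: "lookup (scal z * f) k = z * lookup f k"
  for f :: path_ring
  by (induction f rule: poly_mapping_induct)
    (simp_all add: scal_mult_single lookup_single when_def lookup_add distrib_left)

text \<open>If all four elements have height at most \<open>n\<close>, their products of powers with
  exponents below \<open>N\<close> use only balanced monomials of height at most
  \<open>4 n N\<close>. For large \<open>N\<close> there are more products than monomials, and the
  coefficients of a linear relation among the products form the polynomial.\<close>

lemma cone_dependence:
  "\<exists>G. G \<noteq> 0 \<and> poly_eval (poly_eval (poly_eval (poly_eval cone_scal w) z) y) x G = 0"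
proof -
  obtain nx ny nz nw where "height_le nx x" "height_le ny y" "height_le nz z" "height_le nw w"
    using height_le_exists by metis
  then obtain n where n: "height_le n x" "height_le n y" "height_le n z" "height_le n w"
    using height_le_mono[of _ _ "nx + ny + nz + nw"] by (meson le_add1 le_add2 le_trans)
  \<comment> \<open>With this \<open>N\<close>, the number of monomials is at most
    \<open>(4 n N + 1)^3\<close>, hence at most \<open>N^3 (4 n + 1)^3\<close>, which is below
    \<open>N^4\<close> because \<open>N\<close> exceeds \<open>(4 n + 1)^3\<close>.\<close>
  define N where "N = (4 * n + 1) ^ 3 + 1"
  define I where "I = {..<N} \<times> {..<N} \<times> {..<N} \<times> {..<N}"
  define K where "K = {k :: bool multiset \<times> bool multiset. size (fst k) = size (snd k) \<and> size (fst k) \<le> 4 * n * N}"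
  define v where "v = (\<lambda>(i, j, k, l). x ^ i * y ^ j * z ^ k * w ^ l)"
  have "card K \<le> (4 * n * N + 1) ^ 3" "finite K" unfolding K_def by (rule card_balanced_monomials)+
  moreover have "(4 * n * N + 1) ^ 3 \<le> (N * (4 * n + 1)) ^ 3"
    by (intro power_mono) (auto simp: N_def algebra_simps)
  moreover have "(N * (4 * n + 1)) ^ 3 = N ^ 3 * (4 * n + 1) ^ 3" by (rule power_mult_distrib)
  moreover have "N ^ 3 * (4 * n + 1) ^ 3 < N ^ 3 * N" by (simp add: N_def)
  moreover have "N ^ 3 * N = card I" by (simp add: I_def card_cartesian_product power3_eq_cube)
  ultimately have card: "card K < card I" and fin: "finite K" by linarith+
  have "finite I" by (simp add: I_def)
  from linear_dependence[OF fin this card, of "\<lambda>p. lookup (cone_val (v p))"]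
  obtain c where c: "\<exists>p\<in>I. c p \<noteq> 0"
      "\<And>k. k \<in> K \<Longrightarrow> (\<Sum>p\<in>I. c p * lookup (cone_val (v p)) k) = 0"
    by blast
  have v0: "lookup (cone_val (v p)) k = 0" if p: "p \<in> I" and k: "k \<notin> K" for p k
  proof (rule ccontr)
    assume "lookup (cone_val (v p)) k \<noteq> 0"
    then have kk: "k \<in> keys (cone_val (v p))" by (simp add: in_keys_iff)
    obtain i j r l where ijrl: "p = (i, j, r, l)" "i \<le> N" "j \<le> N" "r \<le> N" "l \<le> N"
      using p by (auto simp: I_def)
    have "height_le (i * n + j * n + r * n + l * n) (v p)"
      unfolding ijrl v_def prod.case by (intro height_le_mult height_le_power n)
    moreover have "i * n + j * n + r * n + l * n \<le> N * n + N * n + N * n + N * n"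
      using ijrl by (intro add_mono mult_right_mono) auto
    moreover have "N * n + N * n + N * n + N * n = 4 * n * N" by simp
    ultimately have "height_le (4 * n * N) (v p)" using height_le_mono by simp
    then have "size (fst k) \<le> 4 * n * N" using kk by (simp add: height_le_def)
    moreover have "size (fst k) = size (snd k)"
      using kk cone_val_graded[of "v p"] by (auto simp: graded_def)
    ultimately show False using k by (simp add: K_def)
  qed
  define G where "G = (\<Sum>i<N. monom (\<Sum>j<N. monom (\<Sum>k<N. monom (\<Sum>l<N. monom (c (i, j, k, l)) l) k) j) i)"
  have "G \<noteq> 0"
  proof
    assume "G = 0"
    obtain i j k l where i: "i < N" "j < N" "k < N" "l < N" "c (i, j, k, l) \<noteq> 0"
      using c(1) by (auto simp: I_def)
    then have "coeff (coeff (coeff (coeff G i) j) k) l = c (i, j, k, l)"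
      by (simp add: G_def coeff_sum_monom)
    then show False using i \<open>G = 0\<close> by simp
  qed
  have "poly_eval (poly_eval (poly_eval (poly_eval cone_scal w) z) y) x G =
      (\<Sum>i<N. \<Sum>j<N. \<Sum>k<N. \<Sum>l<N. cone_scal (c (i, j, k, l)) * v (i, j, k, l))"
    unfolding G_def v_def
    by (simp add: poly_eval_sum_monom ring_morph_poly_eval ring_morph_cone_scal sum_distrib_right)
      (simp add: mult_ac)
  also have "\<dots> = (\<Sum>p\<in>I. cone_scal (c p) * v p)"
    by (simp add: I_def sum.cartesian_product split_beta)
  also have "\<dots> = 0"
  proof -
    have "lookup (cone_val (\<Sum>p\<in>I. cone_scal (c p) * v p)) k = 0" for k
    proof -
      have "lookup (cone_val (\<Sum>p\<in>I. cone_scal (c p) * v p)) k =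
          (\<Sum>p\<in>I. c p * lookup (cone_val (v p)) k)"
        by (simp add: cone_val_sum lookup_sum cone_val_scal lookup_scal_mult)
      then show ?thesis using c(2) v0 by (cases "k \<in> K") auto
    qed
    then have "cone_val (\<Sum>p\<in>I. cone_scal (c p) * v p) = 0" by (intro poly_mapping_eqI) simp
    then show ?thesis by (simp add: cone_val_inject[symmetric])
  qed
  finally show ?thesis using \<open>G \<noteq> 0\<close> by blast
qed

section \<open>The vertex is singular\<close>

text \<open>The coefficients of the four edge monomials. On \<open>vertex\<close> this is the class
  in the cotangent space, the quotient of \<open>vertex\<close> by its square.\<close>

definition linear_part :: "cone \<Rightarrow> complex ^ (bool \<times> bool)" where
  "linear_part r = (\<chi> p. lookup (cone_val r) ({#fst p#}, {#snd p#}))"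

lemma linear_part_add: "linear_part (r + s) = linear_part r + linear_part s"
  by (simp add: linear_part_def lookup_add vec_eq_iff)

lemma linear_part_zero: "linear_part 0 = 0"
  by (simp add: linear_part_def vec_eq_iff)

text \<open>Write \<open>r\<close> as its constant coefficient plus an element of
  \<open>vertex\<close>. A product of two elements of \<open>vertex\<close> has height at least 2 in
  every term and contributes nothing linear.\<close>

lemma linear_part_mult:
  assumes s: "s \<in> vertex"
  shows "linear_part (r * s) = const_coeff r *s linear_part s"
proof -
  define r' where "r' = r - cone_scal (const_coeff r)"
  have r': "r' \<in> vertex" by (simp add: r'_def vertex_def)
  have pos: "1 \<le> size (fst k)" if "t \<in> vertex" "k \<in> keys (cone_val t)" for t k
  proof -
    have "size (fst k) = size (snd k)" using that(2) cone_val_graded[of t] by (auto simp: graded_def)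
    moreover have "k \<noteq> 0" using that by (auto simp: vertex_def const_coeff_def in_keys_iff)
    ultimately have "size (fst k) \<noteq> 0" by (auto simp: prod_eq_iff)
    then show ?thesis by linarith
  qed
  have z: "lookup (cone_val (r' * s)) k = 0" if k: "size (fst k) = 1" for k
  proof (rule ccontr)
    assume "lookup (cone_val (r' * s)) k \<noteq> 0"
    then have "k \<in> keys (cone_val r' * cone_val s)" by (simp add: in_keys_iff)
    then obtain a b where "k = a + b" "1 \<le> size (fst a)" "1 \<le> size (fst b)"
      using pos[OF r'] pos[OF s] by (meson keys_multE)
    then show False using k by simp
  qed
  have "r * s = r' * s + cone_scal (const_coeff r) * s" by (simp add: r'_def algebra_simps)
  then have "linear_part (r * s) = linear_part (r' * s) + linear_part (cone_scal (const_coeff r) * s)"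
    by (simp only: linear_part_add)
  moreover have "linear_part (r' * s) = 0"
    using z by (simp add: linear_part_def vec_eq_iff)
  ultimately show ?thesis
    by (simp add: linear_part_def vec_eq_iff cone_val_scal lookup_scal_mult)
qed

lemma linear_part_edge: "linear_part (edge b c) = axis (b, c) 1"
  by (auto simp: linear_part_def edge_val lookup_single when_def vec_eq_iff axis_def)

text \<open>The linear parts of the edges form a basis of a space of dimension 4. A factor outside
  \<open>vertex\<close> multiplies linear parts by a nonzero constant, so even local generators must
  have linear parts spanning that space.\<close>

theorem vertex_not_generated:
  assumes F: "finite F" "card F \<le> 3" "F \<subseteq> vertex"
  shows "\<not> generates_at vertex F vertex"
proof
  assume gen: "generates_at vertex F vertex"
  have span: "x \<in> vertex \<and> linear_part x \<in> vec.span (linear_part ` F)" if "x \<in> ideals.span F" for x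
  proof (rule ideals.span_induct[OF that, where P = "\<lambda>x. x \<in> vertex \<and> linear_part x \<in> vec.span (linear_part ` F)"])
    show "ideals.subspace {x. x \<in> vertex \<and> linear_part x \<in> vec.span (linear_part ` F)}"
      using prime_set_zero[OF prime_set_vertex] prime_set_add[OF prime_set_vertex] prime_set_mult[OF prime_set_vertex]
      by (intro ideals.subspaceI)
        (auto simp: linear_part_zero linear_part_add linear_part_mult vec.span_zero intro: vec.span_add vec.span_scale)
    show "x \<in> vertex \<and> linear_part x \<in> vec.span (linear_part ` F)" if "x \<in> F" for x
      using that F(3) by (auto intro: vec.span_base)
  qed
  have "axis p 1 \<in> vec.span (linear_part ` F)" for p :: "bool \<times> bool"
  proof -
    obtain b c where p: "p = (b, c)" by fastforce
    obtain u where u: "u \<notin> vertex" "u * edge b c \<in> ideals.span F"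
      using gen edge_vertex unfolding generates_at_def by blast
    have "const_coeff u *s axis p 1 \<in> vec.span (linear_part ` F)"
      using span[OF u(2)] by (simp add: linear_part_mult edge_vertex linear_part_edge p)
    then have "inverse (const_coeff u) *s (const_coeff u *s axis p 1) \<in> vec.span (linear_part ` F)"
      by (rule vec.span_scale)
    then show ?thesis using u(1) by (simp add: vertex_def vector_smult_assoc)
  qed
  then have "cart_basis \<subseteq> vec.span (linear_part ` F)" by (auto simp: cart_basis_def)
  then have "(UNIV :: (complex ^ (bool \<times> bool)) set) \<subseteq> vec.span (linear_part ` F)"
    using vec.span_minimal[OF _ vec.subspace_span] span_cart_basis by metis
  then have "vec.dim (UNIV :: (complex ^ (bool \<times> bool)) set) \<le> card (linear_part ` F)"
    using F(1) by (intro vec.dim_le_card) auto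
  moreover have "CARD(bool \<times> bool) = 4"
    by (simp add: card_cartesian_product UNIV_Times_UNIV[symmetric] del: UNIV_Times_UNIV)
  ultimately have "4 \<le> card (linear_part ` F)"
    unfolding vec_dim_card by simp
  then show False using card_image_le[OF F(1), of linear_part] F(2) by linarith
qed

section \<open>The contraction of the conifold algebra\<close>

lemma two_sided_prime_iff_primeideal:
  assumes "cring R"
  shows "two_sided_prime P R \<longleftrightarrow> primeideal P R"
proof -
  interpret R: cring R by (rule assms)
  show ?thesis
  proof
    assume P: "two_sided_prime P R"
    then have idl: "ideal P R" and ne: "P \<noteq> carrier R" by (simp_all add: two_sided_prime_def)
    show "primeideal P R"
    proof (rule primeidealI[OF idl assms ne[symmetric]])
      fix a b assume ab: "a \<in> carrier R" "b \<in> carrier R" "a \<otimes>\<^bsub>R\<^esub> b \<in> P"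
      have "a \<otimes>\<^bsub>R\<^esub> r \<otimes>\<^bsub>R\<^esub> b \<in> P" if r: "r \<in> carrier R" for r
      proof -
        have "r \<otimes>\<^bsub>R\<^esub> (a \<otimes>\<^bsub>R\<^esub> b) \<in> P" using ab(3) r by (rule ideal.I_l_closed[OF idl])
        moreover have "a \<otimes>\<^bsub>R\<^esub> r \<otimes>\<^bsub>R\<^esub> b = r \<otimes>\<^bsub>R\<^esub> (a \<otimes>\<^bsub>R\<^esub> b)"
          using ab(1,2) r by (simp add: R.m_assoc R.m_comm R.m_lcomm)
        ultimately show ?thesis by simp
      qed
      then show "a \<in> P \<or> b \<in> P" using P ab(1,2) unfolding two_sided_prime_def by blast
    qed
  next
    assume "primeideal P R"
    then interpret P: primeideal P R .
    show "two_sided_prime P R"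
      unfolding two_sided_prime_def
    proof (intro conjI ballI impI)
      show "ideal P R" by (rule P.is_ideal)
      show "P \<noteq> carrier R" using P.I_notcarr by simp
      fix a b assume ab: "a \<in> carrier R" "b \<in> carrier R" "\<forall>r\<in>carrier R. a \<otimes>\<^bsub>R\<^esub> r \<otimes>\<^bsub>R\<^esub> b \<in> P"
      then have "a \<otimes>\<^bsub>R\<^esub> \<one>\<^bsub>R\<^esub> \<otimes>\<^bsub>R\<^esub> b \<in> P" by blast
      then show "a \<in> P \<or> b \<in> P" using P.I_prime ab(1,2) by simp
    qed
  qed
qed

section \<open>From conditions on a type to an isomorphic ring with a carrier\<close>

context
  fixes g :: "'a::comm_ring_1 \<Rightarrow> 'r" and R :: "('r, 'm) ring_scheme"
  assumes g: "g \<in> ring_iso ring_of_type_algebra R" and R: "cring R"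
begin

lemma iso_mult: "g (x * y) = g x \<otimes>\<^bsub>R\<^esub> g y"
  using ring_iso_memE(2)[OF g, of x y] by simp

lemma iso_add: "g (x + y) = g x \<oplus>\<^bsub>R\<^esub> g y"
  using ring_iso_memE(3)[OF g, of x y] by simp

lemma iso_bij: "inj g" "range g = carrier R"
  using ring_iso_memE(5)[OF g] by (simp_all add: bij_betw_def)

lemma iso_zero: "g 0 = \<zero>\<^bsub>R\<^esub>"
proof -
  interpret R: cring R by (rule R)
  have "g 0 \<oplus>\<^bsub>R\<^esub> g 0 = g 0" using iso_add[of 0 0] by simp
  moreover have "g 0 \<in> carrier R" using iso_bij(2) by blast
  ultimately show ?thesis by (metis R.add.l_cancel_one)
qed

lemma iso_bij_primes: "bij_betw ((`) g) {q. prime_set q} (prime_spec R)"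
  using ring_iso_prime_spec[OF g ring_ring_of_type_algebra cring.axioms(1)[OF R]]
  by (simp add: prime_spec_ring_of_type_algebra)

lemma primeideal_image: "prime_set q \<Longrightarrow> primeideal (g ` q) R"
  using bij_betwE[OF iso_bij_primes] two_sided_prime_iff_primeideal[OF R]
  by (auto simp: prime_spec_def)

lemma prime_set_vimage:
  assumes "primeideal K R"
  shows "prime_set (g -` K)"
proof -
  have "K \<in> prime_spec R" using assms two_sided_prime_iff_primeideal[OF R] by (simp add: prime_spec_def)
  then obtain q where "prime_set q" "K = g ` q"
    using iso_bij_primes unfolding bij_betw_def by blast
  then show ?thesis using iso_bij(1) by (simp add: inj_vimage_image_eq)
qed

lemma subspace_vimage:
  assumes J: "ideal J R"
  shows "ideals.subspace (g -` J)"
proof (rule ideals.subspaceI)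
  note s = ideal.axioms(1)[OF J]
  show "0 \<in> g -` J" using additive_subgroup.zero_closed[OF s] by (simp add: iso_zero)
  show "x + y \<in> g -` J" if "x \<in> g -` J" "y \<in> g -` J" for x y
    using additive_subgroup.a_closed[OF s] that by (simp add: iso_add)
  show "c * x \<in> g -` J" if x: "x \<in> g -` J" for c x
  proof -
    have "g c \<in> carrier R" using iso_bij(2) by blast
    then show ?thesis using ideal.I_l_closed[OF J] x by (simp add: iso_mult)
  qed
qed

lemma genideal_image: "g x \<in> genideal R (g ` F) \<longleftrightarrow> x \<in> ideals.span F"
proof
  interpret R: cring R by (rule R)
  have sub: "g ` F \<subseteq> carrier R" using iso_bij(2) by blast
  show "g x \<in> genideal R (g ` F)" if "x \<in> ideals.span F"
  proof -
    have "F \<subseteq> g -` genideal R (g ` F)" using R.genideal_self[OF sub] by blast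
    then have "ideals.span F \<subseteq> g -` genideal R (g ` F)"
      by (rule ideals.span_minimal[OF _ subspace_vimage[OF R.genideal_ideal[OF sub]]])
    then show ?thesis using that by blast
  qed
  show "x \<in> ideals.span F" if x: "g x \<in> genideal R (g ` F)"
  proof -
    have "ideal (g ` ideals.span F) R"
      by (rule ring_iso_ideal_image[OF g ring_ring_of_type_algebra R.ring_axioms])
        (simp add: ideal_ring_of_type_algebra_iff)
    moreover have "g ` F \<subseteq> g ` ideals.span F" using ideals.span_superset by (rule image_mono)
    ultimately have "genideal R (g ` F) \<subseteq> g ` ideals.span F" by (rule R.genideal_minimal)
    then have "g x \<in> g ` ideals.span F" using x by blast
    then show ?thesis by (simp only: inj_image_mem_iff[OF iso_bij(1)])
  qed
qed

lemma locally_generates_image: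
  assumes q: "prime_set q"
  shows "primeideal.locally_generates (g ` q) R (g ` F) (g ` J) \<longleftrightarrow> generates_at q F J"
proof -
  interpret P: primeideal "g ` q" R by (rule primeideal_image[OF q])
  have d: "carrier R - g ` q = g ` (- q)"
    unfolding iso_bij(2)[symmetric] Compl_eq_Diff_UNIV by (rule image_set_diff[OF iso_bij(1), symmetric])
  show ?thesis
    unfolding P.locally_generates_def generates_at_def d
    by (simp add: iso_mult[symmetric] genideal_image Bex_def)
qed

lemma regular_localization_image:
  assumes q: "prime_set q" and reg: "regular_at q"
    and noeth: "\<And>J. ideals.subspace J \<Longrightarrow> \<exists>G. finite G \<and> G \<subseteq> J \<and> generates_at q G J"
  shows "regular_local_ring (localization R (g ` q))"
proof -
  interpret P: primeideal "g ` q" R by (rule primeideal_image[OF q])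
  obtain n C F where C: "\<And>i. i \<le> n \<Longrightarrow> prime_set (C i)" "\<And>i. i < n \<Longrightarrow> C i \<subset> C (Suc i)" "C n = q"
      and F: "finite F" "card F \<le> n" "F \<subseteq> q" "generates_at q F q"
    using reg unfolding regular_at_def by blast
  show ?thesis
  proof (rule P.regular_localizationI[where n = n and C = "\<lambda>i. g ` C i" and F = "g ` F"])
    show "primeideal (g ` C i) R" if "i \<le> n" for i using primeideal_image[OF C(1)[OF that]] .
    show "g ` C i \<subset> g ` C (Suc i)" if "i < n" for i
      using C(2)[OF that] iso_bij(1) by (simp add: psubset_eq inj_image_subset_iff inj_image_eq_iff)
    show "g ` C n = g ` q" by (simp add: C(3))
    show "finite (g ` F)" using F(1) by simp
    show "card (g ` F) \<le> n" using card_image_le[OF F(1), of g] F(2) by linarith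
    show "g ` F \<subseteq> g ` q" using F(3) by (rule image_mono)
    show "P.locally_generates (g ` F) (g ` q)" using F(4) locally_generates_image[OF q] by simp
    show "\<exists>G. finite G \<and> G \<subseteq> J \<and> P.locally_generates G J" if J: "ideal J R" for J
    proof -
      have im: "g ` (g -` J) = J"
        using iso_bij(2) additive_subgroup.a_subset[OF ideal.axioms(1)[OF J]] by (simp add: image_vimage_eq Int_absorb2)
      obtain G where G: "finite G" "G \<subseteq> g -` J" "generates_at q G (g -` J)"
        using noeth[OF subspace_vimage[OF J]] by blast
      have "P.locally_generates (g ` G) J"
        using locally_generates_image[OF q, of G "g -` J"] G(3) im by simp
      moreover have "g ` G \<subseteq> J" using G(2) by blast
      ultimately show ?thesis using G(1) by (intro exI[of _ "g ` G"]) simp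
    qed
  qed
qed

text \<open>A regular localization would supply local generators, at most as many as the dimension
  of \<open>R\<close>, which bounds that of the localization. Their preimages under \<open>g\<close>
  contradict \<open>ngen\<close>.\<close>

lemma singular_localization_image:
  assumes q: "prime_set q" and dim: "krull_dim R \<le> enat n"
    and ngen: "\<And>F. finite F \<Longrightarrow> card F \<le> n \<Longrightarrow> F \<subseteq> q \<Longrightarrow> \<not> generates_at q F q"
  shows "\<not> regular_local_ring (localization R (g ` q))"
proof
  interpret P: primeideal "g ` q" R by (rule primeideal_image[OF q])
  assume "regular_local_ring (localization R (g ` q))"
  then obtain F where F: "finite F" "F \<subseteq> g ` q" "P.locally_generates F (g ` q)" "enat (card F) \<le> krull_dim R"
    by (rule P.regular_localizationE)
  obtain F' where F': "F' \<subseteq> q" "F = g ` F'" using F(2) by (meson subset_image_iff)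
  have inj: "inj_on g F'" using iso_bij(1) by (rule inj_on_subset) simp
  have "enat (card F) \<le> enat n" using F(4) dim by (rule order_trans)
  then have "card F' \<le> n" by (simp add: F'(2) card_image[OF inj])
  moreover have "finite F'" using F(1) F'(2) inj by (simp add: finite_image_iff)
  ultimately show False
    using ngen[of F'] F'(1) F(3) locally_generates_image[OF q, of F' q] by (simp add: F'(2))
qed

text \<open>A longer chain of primes can be cut off after \<open>n + 1\<close> steps, so it is
  enough to exclude chains of exactly that length.\<close>

lemma krull_dim_image_le:
  assumes "\<And>C :: nat \<Rightarrow> 'a set. \<not> ((\<forall>i\<le>Suc n. prime_set (C i)) \<and> (\<forall>i<Suc n. C i \<subset> C (Suc i)))"
  shows "krull_dim R \<le> enat n"
  unfolding krull_dim_def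
proof (rule Sup_least, clarify)
  fix k and C :: "nat \<Rightarrow> 'r set"
  assume C: "\<forall>i\<le>k. primeideal (C i) R" "\<forall>i<k. C i \<subset> C (Suc i)"
  show "enat k \<le> enat n"
  proof (rule ccontr)
    assume "\<not> enat k \<le> enat n"
    then have k: "Suc n \<le> k" by simp
    have "g -` C i \<subset> g -` C (Suc i)" if i: "i < Suc n" for i
    proof -
      have ss: "C i \<subset> C (Suc i)" using C(2) i k by simp
      then obtain x where x: "x \<in> C (Suc i)" "x \<notin> C i" by blast
      have p: "primeideal (C (Suc i)) R" using C(1) i k by simp
      have "x \<in> carrier R"
        by (rule additive_subgroup.a_Hcarr[OF ideal.axioms(1)[OF primeideal.axioms(1)[OF p]] x(1)])
      then obtain y where "x = g y" using iso_bij(2) by blast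
      then show ?thesis using x ss by auto
    qed
    moreover have "prime_set (g -` C i)" if "i \<le> Suc n" for i
      using C(1) that k by (intro prime_set_vimage) simp
    ultimately show False using assms[of "\<lambda>i. g -` C i"] by blast
  qed
qed

end

text \<open>At the vertex three local generators are not enough although the dimension is at most 3;
  every other prime has the certificate obtained from a chart.\<close>

lemma singular_points_cone:
  assumes g: "g \<in> ring_iso (ring_of_type_algebra :: cone ring) R" and R: "cring R"
  shows "singular_points R = {g ` vertex}"
proof -
  have "\<not> ((\<forall>i\<le>Suc 3. prime_set (C i)) \<and> (\<forall>i<Suc 3. C i \<subset> C (Suc i)))" for C :: "nat \<Rightarrow> cone set"
  proof (intro notI, elim conjE)
    assume "\<forall>i\<le>Suc 3. prime_set (C i)" "\<forall>i<Suc 3. C i \<subset> C (Suc i)"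
    then show False by (intro no_prime_chain[OF ring_morph_cone_scal cone_dependence, of C]) simp_all
  qed
  then have dim: "krull_dim R \<le> enat 3" by (rule krull_dim_image_le[OF g R])
  have "regular_local_ring (localization R (g ` q)) \<longleftrightarrow> q \<noteq> vertex" if q: "prime_set q" for q
    using singular_localization_image[OF g R prime_set_vertex dim vertex_not_generated]
      regular_localization_image[OF g R q regular_at_off_vertex[OF q] noetherian_off_vertex[OF q]]
    by blast
  moreover have "prime_spec R = (`) g ` {q. prime_set q}"
    using iso_bij_primes[OF g R] by (simp add: bij_betw_def)
  ultimately show ?thesis
    using prime_set_vertex by (auto simp: singular_points_def)
qed

text \<open>Away from \<open>vertex\<close> some edge lies outside the prime of the center. Then
  \<open>trace_prime\<close> is a prime over it, and \<open>prime_eq_trace_prime\<close> says that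
  it is the only one.\<close>

lemma center_contraction_balanced_bij:
  "bij_betw (center_contraction (subalg balanced))
    {P \<in> prime_spec (subalg balanced). center_contraction (subalg balanced) P \<noteq> diag ` vertex}
    (prime_spec (ring_center (subalg balanced)) - {diag ` vertex})"
proof -
  have contr: "\<exists>q b c. prime_set q \<and> p = diag ` q \<and> edge b c \<notin> q"
    if p: "p \<in> prime_spec (ring_center (subalg balanced))" "p \<noteq> diag ` vertex" for p
  proof -
    obtain q where q: "prime_set q" "p = diag ` q"
      using p(1) center_primes unfolding bij_betw_def by blast
    then have "q \<noteq> vertex" using p(2) by blast
    then obtain b c where "edge b c \<notin> q" using prime_set_off_vertex q(1) by blast
    then show ?thesis using q by blast
  qed
  note spec = center_contraction_prime[OF ring_subalg_balanced]
  show ?thesis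
  proof (rule bij_betw_imageI)
    show "inj_on (center_contraction (subalg balanced))
        {P \<in> prime_spec (subalg balanced). center_contraction (subalg balanced) P \<noteq> diag ` vertex}"
    proof (rule inj_onI, clarify)
      fix P P' assume P: "P \<in> prime_spec (subalg balanced)" "center_contraction (subalg balanced) P \<noteq> diag ` vertex"
        and P': "P' \<in> prime_spec (subalg balanced)"
        and eq: "center_contraction (subalg balanced) P = center_contraction (subalg balanced) P'"
      obtain q b c where q: "prime_set q" "center_contraction (subalg balanced) P = diag ` q" "edge b c \<notin> q"
        using contr[OF spec[OF P(1)] P(2)] by blast
      have "P = trace_prime q" "P' = trace_prime q"
        using P P' eq q by (auto intro!: prime_eq_trace_prime[OF q(1,3)] simp: prime_spec_def)
      then show "P = P'" by simp
    qed
    show "center_contraction (subalg balanced) `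
        {P \<in> prime_spec (subalg balanced). center_contraction (subalg balanced) P \<noteq> diag ` vertex} =
        prime_spec (ring_center (subalg balanced)) - {diag ` vertex}"
    proof (intro equalityI subsetI)
      fix p assume "p \<in> prime_spec (ring_center (subalg balanced)) - {diag ` vertex}"
      then have p: "p \<noteq> diag ` vertex" and "\<exists>q b c. prime_set q \<and> p = diag ` q \<and> edge b c \<notin> q"
        using contr by blast+
      then obtain q b c where q: "prime_set q" "p = diag ` q" "edge b c \<notin> q" by blast
      have "trace_prime q \<in> prime_spec (subalg balanced)"
        using trace_prime_prime[OF q(1,3)] by (simp add: prime_spec_def)
      then show "p \<in> center_contraction (subalg balanced) `
          {P \<in> prime_spec (subalg balanced). center_contraction (subalg balanced) P \<noteq> diag ` vertex}"
        using trace_prime_contraction[OF q(1)] p q(2) by (intro image_eqI[of _ _ "trace_prime q"]) auto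
    qed (use spec in blast)
  qed
qed

lemma center_contraction_balanced_fiber:
  "{P \<in> prime_spec (subalg balanced). center_contraction (subalg balanced) P = diag ` vertex} =
    {vertex_prime1, vertex_prime2}"
  using prime_over_vertex vertex_prime_prime vertex_prime_contraction by (auto simp: prime_spec_def)

section \<open>Transport of the contraction along an isomorphism\<close>

context
  fixes h R S and s :: "'a set"
  assumes h: "h \<in> ring_iso R S" and R: "ring R" and S: "ring S" and s: "s \<subseteq> carrier R"
begin

lemma inj_on_carrier: "inj_on h (carrier R)"
  using h by (auto simp: ring_iso_def bij_betw_def)

lemma prime_spec_subset_carrier: "P \<in> prime_spec R \<Longrightarrow> P \<subseteq> carrier R"
  by (simp add: prime_spec_def two_sided_prime_def additive_subgroup.a_subset ideal.axioms(1))

lemma center_contraction_image: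
  assumes "P \<subseteq> carrier R"
  shows "center_contraction S (h ` P) = h ` center_contraction R P"
proof -
  have "carrier (ring_center R) \<subseteq> carrier R" by (rule subsetI, erule ring_center_carrier)
  then show ?thesis
    unfolding center_contraction_def ring_iso_ring_center(2)[OF h R, symmetric]
    using inj_on_image_Int[OF inj_on_carrier assms] by simp
qed

lemma center_contraction_image_eq_iff:
  assumes "P \<in> prime_spec R"
  shows "center_contraction S (h ` P) = h ` s \<longleftrightarrow> center_contraction R P = s"
proof -
  have P: "P \<subseteq> carrier R" by (rule prime_spec_subset_carrier[OF assms])
  then have "center_contraction R P \<subseteq> carrier R" by (auto simp: center_contraction_def)
  then show ?thesis
    unfolding center_contraction_image[OF P] using inj_on_image_eq_iff[OF inj_on_carrier _ s] by simp
qed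

text \<open>The predicate \<open>Q\<close> lets one statement serve twice: with the identity for the
  fiber over \<open>s\<close>, and with \<open>Not\<close> for its complement.\<close>

lemma image_contraction_set:
  "(`) h ` {P \<in> prime_spec R. Q (center_contraction R P = s)} =
    {P \<in> prime_spec S. Q (center_contraction S P = h ` s)}"
proof -
  have "prime_spec S = (`) h ` prime_spec R"
    using ring_iso_prime_spec[OF h R S] by (simp add: bij_betw_def)
  then show ?thesis using center_contraction_image_eq_iff by auto
qed

lemma card_fiber_transfer:
  "card {P \<in> prime_spec R. center_contraction R P = s} = card {P \<in> prime_spec S. center_contraction S P = h ` s}"
proof -
  have "inj_on ((`) h) {P \<in> prime_spec R. center_contraction R P = s}"
    using ring_iso_prime_spec[OF h R S] by (auto simp: bij_betw_def intro: inj_on_subset)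
  then show ?thesis
    using card_image image_contraction_set[of "\<lambda>x. x"] by fastforce
qed

text \<open>Contraction commutes with taking images under \<open>h\<close>. The composite with the
  contraction in \<open>S\<close> is bijective, and the bijection induced by \<open>h\<close> on the
  primes of the centers is cancelled from it.\<close>

lemma bij_contraction_transfer:
  assumes "bij_betw (center_contraction S) {P \<in> prime_spec S. center_contraction S P \<noteq> h ` s}
    (prime_spec (ring_center S) - {h ` s})"
  shows "bij_betw (center_contraction R) {P \<in> prime_spec R. center_contraction R P \<noteq> s}
    (prime_spec (ring_center R) - {s})"
proof -
  let ?A = "{P \<in> prime_spec R. center_contraction R P \<noteq> s}"
  let ?A' = "{P \<in> prime_spec S. center_contraction S P \<noteq> h ` s}"
  have "inj_on ((`) h) ?A"
    using ring_iso_prime_spec[OF h R S] by (auto simp: bij_betw_def intro: inj_on_subset)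
  then have "bij_betw ((`) h) ?A ?A'"
    using image_contraction_set[of Not] by (simp add: bij_betw_def)
  then have "bij_betw (center_contraction S \<circ> (`) h) ?A (prime_spec (ring_center S) - {h ` s})"
    using assms by (rule bij_betw_trans)
  then have 1: "bij_betw ((`) h \<circ> center_contraction R) ?A (prime_spec (ring_center S) - {h ` s})"
    by (rule bij_betw_cong[THEN iffD1, rotated]) (simp add: center_contraction_image prime_spec_subset_carrier)
  have Z: "bij_betw ((`) h) (prime_spec (ring_center R)) (prime_spec (ring_center S))"
    by (rule ring_iso_prime_spec[OF ring_iso_ring_center(1)[OF h R]
          cring.axioms(1)[OF cring_ring_center[OF R]] cring.axioms(1)[OF cring_ring_center[OF S]]])
  have sub: "p \<subseteq> carrier R" if "p \<in> prime_spec (ring_center R)" for p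
  proof -
    have "p \<subseteq> carrier (ring_center R)"
      using that by (simp add: prime_spec_def two_sided_prime_def additive_subgroup.a_subset ideal.axioms(1))
    then show ?thesis using ring_center_carrier by (rule subset_trans[OF _ subsetI])
  qed
  have "(`) h ` (prime_spec (ring_center R) - {s}) = prime_spec (ring_center S) - {h ` s}"
  proof -
    have e: "h ` p = h ` s \<longleftrightarrow> p = s" if "p \<in> prime_spec (ring_center R)" for p
      by (rule inj_on_image_eq_iff[OF inj_on_carrier sub[OF that] s])
    have im: "prime_spec (ring_center S) = (`) h ` prime_spec (ring_center R)"
      using Z by (simp add: bij_betw_def)
    show ?thesis unfolding im using e by auto
  qed
  then have 2: "bij_betw ((`) h) (prime_spec (ring_center R) - {s}) (prime_spec (ring_center S) - {h ` s})"
    using Z by (auto simp: bij_betw_def intro: inj_on_subset)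
  have "center_contraction R ` ?A \<subseteq> prime_spec (ring_center R) - {s}"
    using center_contraction_prime[OF R] by auto
  then show ?thesis using bij_betw_comp_iff2[OF 2] 1 by blast
qed

end

lemma center_contraction_conifold:
  "\<exists>s. singular_points (ring_center conifold_algebra) = {s} \<and>
    bij_betw (center_contraction conifold_algebra)
      {P \<in> prime_spec conifold_algebra. center_contraction conifold_algebra P \<noteq> s}
      (prime_spec (ring_center conifold_algebra) - {s}) \<and>
    card {P \<in> prime_spec conifold_algebra. center_contraction conifold_algebra P = s} = 2"
proof -
  let ?L = "subalg balanced"
  obtain h where h: "h \<in> ring_iso conifold_algebra ?L"
    using conifold_algebra_iso by blast
  have R: "ring conifold_algebra"
    unfolding conifold_algebra_def by (intro ideal.quotient_is_ring ring.genideal_ideal ring_ring_of_type_algebra) simp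
  note L = ring_subalg_balanced
  note Z = cring_ring_center[OF R]
  let ?Z = "ring_center conifold_algebra"
  \<comment> \<open>The inverse of \<open>h\<close> is needed on centers only:
    \<open>k \<circ> diag\<close> then identifies \<open>cone\<close> with the center of the
    conifold algebra, and the image \<open>s\<close> of \<open>vertex\<close> is the singular
    point.\<close>
  define k where "k = inv_into (carrier ?Z) h"
  note hZ = ring_iso_ring_center[OF h R]
  have "k \<in> ring_iso (ring_center ?L) ?Z"
    unfolding k_def by (rule ring_iso_set_sym[OF cring.axioms(1)[OF Z] hZ(1)])
  then have g: "k \<circ> diag \<in> ring_iso ring_of_type_algebra ?Z"
    by (rule ring_iso_set_trans[OF diag_iso])
  define s where "s = (k \<circ> diag) ` vertex"
  have "range diag = h ` carrier ?Z" using hZ(2) center_balanced by simp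
  then have "diag r \<in> h ` carrier ?Z" for r by blast
  then have kd: "h (k (diag r)) = diag r" "k (diag r) \<in> carrier ?Z" for r
    unfolding k_def by (simp_all add: f_inv_into_f inv_into_into)
  then have hs: "h ` s = diag ` vertex" by (simp add: s_def image_image)
  have sc: "s \<subseteq> carrier conifold_algebra"
    unfolding s_def by (rule image_subsetI, simp only: o_apply, rule ring_center_carrier[OF kd(2)])
  show ?thesis
  proof (intro exI conjI)
    show "singular_points ?Z = {s}"
      unfolding s_def by (rule singular_points_cone[OF g Z])
    show "bij_betw (center_contraction conifold_algebra)
      {P \<in> prime_spec conifold_algebra. center_contraction conifold_algebra P \<noteq> s} (prime_spec ?Z - {s})"
      using center_contraction_balanced_bij by (intro bij_contraction_transfer[OF h R L sc]) (simp add: hs)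
    show "card {P \<in> prime_spec conifold_algebra. center_contraction conifold_algebra P = s} = 2"
      unfolding card_fiber_transfer[OF h R L sc] hs center_contraction_balanced_fiber
      using vertex_prime_distinct by simp
  qed
qed

theorem lemma5p6:
  defines "R\<^sub>c \<equiv> ring_center conifold_algebra"
    and "\<psi> \<equiv> center_contraction conifold_algebra"
  shows "continuous_map (zariski conifold_algebra) (zariski R\<^sub>c) \<psi> \<and>
    (\<exists>s. singular_points R\<^sub>c = {s} \<and>
      bij_betw \<psi> {P \<in> prime_spec conifold_algebra. \<psi> P \<noteq> s} (prime_spec R\<^sub>c - {s}) \<and>
      card {P \<in> prime_spec conifold_algebra. \<psi> P = s} = 2)"
proof -
  have "ring conifold_algebra"
    unfolding conifold_algebra_def by (intro ideal.quotient_is_ring ring.genideal_ideal ring_ring_of_type_algebra) simp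
  then show ?thesis
    unfolding R\<^sub>c_def \<psi>_def using continuous_center_contraction center_contraction_conifold by blast
qed

end
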